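(* Let $\mathcal A$ be an irreducible essential complex hyperplane arrangement with Orlik–Solomon algebra $A$ over a field $K$, and let $e_i\in V:=A_1$ be the elements corresponding to the hyperplanes of $\mathcal A$. (a) If $\mathcal A$ is noncentral, then the singular variety of $A$ is $V$. (b) If $\mathcal A$ is central, then the singular variety of $A$ is the hyperplane of $V$ spanned by the elements $e_i-e_j$.
   Context: An arrangement $\mathcal A$ is a finite set of affine hyperplanes in $\mathbb C^\ell$, essential in the sense that its intersection poset has rank $\ell$; it is central if the intersection of all its hyperplanes is nonempty. The product of arrangements $\mathcal A_i$ in $\mathbb C^{\ell_i}$ ($i=1,2$) is the arrangement in $\mathbb C^{\ell_1+\ell_2}$ consisting of the hyperplanes $H\times\mathbb C^{\ell_2}$ for $H\in\mathcal A_1$ and $\mathbb C^{\ell_1}\times H$ for $H\in\mathcal A_2$. An arrangement is irreducible if it is not (up to an affine change of coordinates) a product of two arrangements in spaces of positive dimension. Let $E$ be the exterior algebra over $K$ on generators $e_i$ corresponding to the hyperplanes $H_i$. A set of $t$ hyperplanes is dependent if its intersection is nonempty of codimension less than $t$. The Orlik–Solomon algebra is $A=E/I$, where $I$ is generated by $\partial(e_{i_1}\wedge\cdots\wedge e_{i_t})=\sum_j(-1)^j e_{i_1}\wedge\cdots\wedge\widehat{e_{i_j}}\wedge\cdots\wedge e_{i_t}$ for minimal dependent sets $\{H_{i_1},\dots,H_{i_t}\}$ and the monomials $e_{i_1}\wedge\cdots\wedge e_{i_t}$ with $H_{i_1}\cap\cdots\cap H_{i_t}=\emptyset$; one has $A_1=E_1$,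 with basis the $e_i$, and $A\cong\mathrm H^*(X;K)$ for $X$ the complement of $\mathcal A$. For an $E$-module $M$, an element $x\in V=E_1$ is singular on $M$ if $\{m\in M: xm=0\}\neq xM$; the set of singular elements is the singular variety of $M$. *)

theory Defs
  imports
    "Jordan_Normal_Form.VS_Connect"
    "HOL-Algebra.QuotRing"
    "HOL-Library.Function_Algebras"
begin

section \<open>Hyperplane arrangements\<close>

text \<open>The ambient space \<open>\<complex>\<^sup>n\<close> is \<^term>\<open>carrier_vec n :: complex vec set\<close>.\<close>

definition affine_hyperplane :: "nat \<Rightarrow> complex vec set \<Rightarrow> bool" where
  "affine_hyperplane n H \<longleftrightarrow>
     (\<exists>a c. a \<in> carrier_vec n \<and> a \<noteq> 0\<^sub>v n \<and> H = {x \<in> carrier_vec n. a \<bullet> x = c})"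

text \<open>Intersection of a family of hyperplanes; the empty family gives the whole space.\<close>

definition flat :: "nat \<Rightarrow> complex vec set set \<Rightarrow> complex vec set" where
  "flat n B = carrier_vec n \<inter> \<Inter>B"

definition intersection_poset :: "nat \<Rightarrow> complex vec set set \<Rightarrow> complex vec set set" where
  "intersection_poset n A = {X. X \<noteq> {} \<and> (\<exists>B\<subseteq>A. X = flat n B)}"

text \<open>The rank of a (finite) poset is the maximal length of a chain, where a chain with \<open>k + 1\<close>
  elements has length \<open>k\<close>. Reversing the order, as is usual for the intersection poset, does not
  affect chains.\<close>

definition poset_rank :: "'a set set \<Rightarrow> nat" where
  "poset_rank L = Max {card C - 1 | C. subset.chain L C}"

definition arrangement :: "nat \<Rightarrow> complex vec set set \<Rightarrow> bool" where
  "arrangement n A \<longleftrightarrow> finite A \<and> (\<forall>H\<in>A. affine_hyperplane n H) \<and>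
     poset_rank (intersection_poset n A) = n"

definition central :: "nat \<Rightarrow> complex vec set set \<Rightarrow> bool" where
  "central n A \<longleftrightarrow> flat n A \<noteq> {}"

definition product_arrangement ::
  "nat \<Rightarrow> complex vec set set \<Rightarrow> nat \<Rightarrow> complex vec set set \<Rightarrow> complex vec set set" where
  "product_arrangement n1 A1 n2 A2 =
     {{v @\<^sub>v w | v w. v \<in> H \<and> w \<in> carrier_vec n2} | H. H \<in> A1} \<union>
     {{v @\<^sub>v w | v w. v \<in> carrier_vec n1 \<and> w \<in> H} | H. H \<in> A2}"

definition affine_coordinate_change :: "nat \<Rightarrow> (complex vec \<Rightarrow> complex vec) \<Rightarrow> bool" where
  "affine_coordinate_change n f \<longleftrightarrow>
     (\<exists>P b. P \<in> carrier_mat n n \<and> invertible_mat P \<and> b \<in> carrier_vec n \<and> f = (\<lambda>x. P *\<^sub>v x + b))"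

definition irreducible_arrangement :: "nat \<Rightarrow> complex vec set set \<Rightarrow> bool" where
  "irreducible_arrangement n A \<longleftrightarrow>
     \<not> (\<exists>n1 n2 A1 A2 f. 0 < n1 \<and> 0 < n2 \<and> n1 + n2 = n \<and>
          arrangement n1 A1 \<and> arrangement n2 A2 \<and> affine_coordinate_change n f \<and>
          (\<lambda>H. f ` H) ` A = product_arrangement n1 A1 n2 A2)"

text \<open>The codimension of a nonempty affine subspace \<open>X\<close>, through the dimension of its space of
  directions \<open>{x - y | x, y \<in> X}\<close>.\<close>

definition codim :: "nat \<Rightarrow> complex vec set \<Rightarrow> nat" where
  "codim n X = n - vectorspace.dim class_ring
     ((module_vec TYPE(complex) n)\<lparr>carrier := {x - y | x y. x \<in> X \<and> y \<in> X}\<rparr>)"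

text \<open>For index sets the hyperplanes are enumerated by an injective family \<open>H\<close>.\<close>

definition dependent_hyperplanes :: "nat \<Rightarrow> ('i \<Rightarrow> complex vec set) \<Rightarrow> 'i set \<Rightarrow> bool" where
  "dependent_hyperplanes n H S \<longleftrightarrow> flat n (H ` S) \<noteq> {} \<and> codim n (flat n (H ` S)) < card S"

definition minimal_dependent :: "nat \<Rightarrow> ('i \<Rightarrow> complex vec set) \<Rightarrow> 'i set \<Rightarrow> bool" where
  "minimal_dependent n H S \<longleftrightarrow>
     dependent_hyperplanes n H S \<and> (\<forall>T. T \<subset> S \<longrightarrow> \<not> dependent_hyperplanes n H T)"

section \<open>The exterior algebra\<close>

text \<open>The exterior algebra on generators \<open>e\<^sub>i\<close>, \<open>i \<in> I\<close>, with \<open>I\<close> finite and linearly ordered: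
  the element \<open>x\<close> is \<open>\<Sum>S\<subseteq>I. x S \<cdot> e\<^sub>S\<close>, where
  \<open>e\<^sub>S = e\<^bsub>i_1\<^esub> \<and> \<dots> \<and> e\<^bsub>i_t\<^esub>\<close> for \<open>S = {i_1 < \<dots> < i_t}\<close>. For disjoint \<open>S\<close>, \<open>T\<close> one has
  \<open>e\<^sub>S \<and> e\<^sub>T = \<plusminus> e\<^bsub>S \<union> T\<^esub>\<close>, with the sign of the permutation that sorts \<open>S\<close> followed by \<open>T\<close>.\<close>

definition ext_sign :: "'i::linorder set \<Rightarrow> 'i set \<Rightarrow> 'k::field" where
  "ext_sign S T = (-1) ^ card {(s, t). s \<in> S \<and> t \<in> T \<and> t < s}"

definition ext_mult :: "('i::linorder set \<Rightarrow> 'k::field) \<Rightarrow> ('i set \<Rightarrow> 'k) \<Rightarrow> ('i set \<Rightarrow> 'k)" where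
  "ext_mult x y = (\<lambda>U. \<Sum>S\<in>Pow U. ext_sign S (U - S) * x S * y (U - S))"

definition ext_mono :: "'i set \<Rightarrow> ('i set \<Rightarrow> 'k::field)" where
  "ext_mono S = (\<lambda>T. if T = S then 1 else 0)"

definition ext_scale :: "'k::field \<Rightarrow> ('i set \<Rightarrow> 'k) \<Rightarrow> ('i set \<Rightarrow> 'k)" where
  "ext_scale c x = (\<lambda>S. c * x S)"

definition ext_alg :: "'i::linorder set \<Rightarrow> ('i set \<Rightarrow> 'k::field) ring" where
  "ext_alg I = \<lparr>carrier = {x. \<forall>S. x S \<noteq> 0 \<longrightarrow> S \<subseteq> I}, mult = ext_mult, one = ext_mono {},
     zero = 0, add = (+)\<rparr>"

definition ext_degree :: "'i::linorder set \<Rightarrow> nat \<Rightarrow> ('i set \<Rightarrow> 'k::field) set" where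
  "ext_degree I d = {x \<in> carrier (ext_alg I). \<forall>S. x S \<noteq> 0 \<longrightarrow> card S = d}"

definition ext_gen :: "'i \<Rightarrow> ('i set \<Rightarrow> 'k::field)" where
  "ext_gen i = ext_mono {i}"

text \<open>\<open>\<partial> e\<^sub>S\<close>; the position of \<open>i\<close> in \<open>S\<close>, counted from 1, is the number of \<open>k \<in> S\<close> with \<open>k \<le> i\<close>.\<close>

definition ext_boundary :: "'i::linorder set \<Rightarrow> ('i set \<Rightarrow> 'k::field)" where
  "ext_boundary S = (\<Sum>i\<in>S. ext_scale ((-1) ^ card {k \<in> S. k \<le> i}) (ext_mono (S - {i})))"

section \<open>The Orlik--Solomon algebra\<close>

definition os_ideal ::
  "nat \<Rightarrow> 'i::linorder set \<Rightarrow> ('i \<Rightarrow> complex vec set) \<Rightarrow> ('i set \<Rightarrow> 'k::field) set" where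
  "os_ideal n I H = genideal (ext_alg I)
     ({ext_boundary S | S. S \<subseteq> I \<and> minimal_dependent n H S} \<union>
      {ext_mono S | S. S \<subseteq> I \<and> flat n (H ` S) = {}})"

definition os_algebra ::
  "nat \<Rightarrow> 'i::linorder set \<Rightarrow> ('i \<Rightarrow> complex vec set) \<Rightarrow> ('i set \<Rightarrow> 'k::field) set ring" where
  "os_algebra n I H = ext_alg I Quot os_ideal n I H"

text \<open>The Orlik--Solomon algebra as a module over the exterior algebra, which acts through the
  quotient map. The locale \<^locale>\<open>module\<close> requires commutative scalars, so only the record type is
  used.\<close>

definition os_module ::
  "nat \<Rightarrow> 'i::linorder set \<Rightarrow> ('i \<Rightarrow> complex vec set) \<Rightarrow>
     ('i set \<Rightarrow> 'k::field, ('i set \<Rightarrow> 'k) set) module" where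
  "os_module n I H = ring.extend (os_algebra n I H)
     \<lparr>smult = (\<lambda>x a. (os_ideal n I H +>\<^bsub>ext_alg I\<^esub> x) \<otimes>\<^bsub>os_algebra n I H\<^esub> a)\<rparr>"

section \<open>Singular varieties\<close>

definition singular_on :: "('a, 'm, 'z) module_scheme \<Rightarrow> 'a \<Rightarrow> bool" where
  "singular_on M x \<longleftrightarrow>
     {m \<in> carrier M. x \<odot>\<^bsub>M\<^esub> m = \<zero>\<^bsub>M\<^esub>} \<noteq> {x \<odot>\<^bsub>M\<^esub> m | m. m \<in> carrier M}"

definition singular_variety ::
  "'i::linorder set \<Rightarrow> ('i set \<Rightarrow> 'k::field, 'm, 'z) module_scheme \<Rightarrow> ('i set \<Rightarrow> 'k) set" where
  "singular_variety I M = {x \<in> ext_degree I 1. singular_on M x}"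

definition linear_hyperplane :: "('i set \<Rightarrow> 'k::field) set \<Rightarrow> ('i set \<Rightarrow> 'k) set \<Rightarrow> bool" where
  "linear_hyperplane V W \<longleftrightarrow> Modules.module.subspace ext_scale W \<and> W \<subseteq> V \<and>
     Vector_Spaces.vector_space.dim ext_scale W + 1 = Vector_Spaces.vector_space.dim ext_scale V"

section \<open>The exterior algebra is a ring\<close>

lemma ext_sign_Un_left:
  assumes "finite S" "finite T" "finite R" "S \<inter> T = {}"
  shows "ext_sign (S \<union> T) R = (ext_sign S R * ext_sign T R :: 'k::field)"
proof -
  have "{(s, t). s \<in> S \<union> T \<and> t \<in> R \<and> t < s} =
      {(s, t). s \<in> S \<and> t \<in> R \<and> t < s} \<union> {(s, t). s \<in> T \<and> t \<in> R \<and> t < s}" by auto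
  moreover have "finite {(s, t). s \<in> S \<and> t \<in> R \<and> t < s}"
    by (rule finite_subset[of _ "S \<times> R"]) (use assms in auto)
  moreover have "finite {(s, t). s \<in> T \<and> t \<in> R \<and> t < s}"
    by (rule finite_subset[of _ "T \<times> R"]) (use assms in auto)
  ultimately show ?thesis unfolding ext_sign_def power_add[symmetric]
    using assms(4) by (subst card_Un_disjoint[symmetric]) auto
qed

lemma ext_sign_Un_right:
  assumes "finite S" "finite T" "finite R" "S \<inter> T = {}"
  shows "ext_sign R (S \<union> T) = (ext_sign R S * ext_sign R T :: 'k::field)"
proof -
  have "{(s, t). s \<in> R \<and> t \<in> S \<union> T \<and> t < s} =
      {(s, t). s \<in> R \<and> t \<in> S \<and> t < s} \<union> {(s, t). s \<in> R \<and> t \<in> T \<and> t < s}" by auto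
  moreover have "finite {(s, t). s \<in> R \<and> t \<in> S \<and> t < s}"
    by (rule finite_subset[of _ "R \<times> S"]) (use assms in auto)
  moreover have "finite {(s, t). s \<in> R \<and> t \<in> T \<and> t < s}"
    by (rule finite_subset[of _ "R \<times> T"]) (use assms in auto)
  ultimately show ?thesis unfolding ext_sign_def power_add[symmetric]
    using assms(4) by (subst card_Un_disjoint[symmetric]) auto
qed

lemma ext_sign_empty [simp]: "ext_sign {} T = 1" "ext_sign S {} = 1"
  by (simp_all add: ext_sign_def)

lemma ext_mult_assoc: "ext_mult (ext_mult x y) z = ext_mult x (ext_mult y z)"
proof
  fix U :: "'a set"
  show "ext_mult (ext_mult x y) z U = ext_mult x (ext_mult y z) U"
  proof (cases "finite U")
    case False
    then show ?thesis by (simp add: ext_mult_def finite_Pow_iff)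
  next
    case True
    have L: "ext_mult (ext_mult x y) z U = (\<Sum>(W, S)\<in>Sigma (Pow U) Pow.
        ext_sign W (U - W) * (ext_sign S (W - S) * x S * y (W - S)) * z (U - W))"
      unfolding ext_mult_def sum_distrib_left sum_distrib_right
      using True by (subst sum.Sigma) (auto intro: finite_subset)
    have R: "ext_mult x (ext_mult y z) U = (\<Sum>(S, T)\<in>Sigma (Pow U) (\<lambda>S. Pow (U - S)).
        ext_sign S (U - S) * x S * (ext_sign T (U - S - T) * y T * z (U - S - T)))"
      unfolding ext_mult_def sum_distrib_left sum_distrib_right
      using True by (subst sum.Sigma) auto
    show ?thesis unfolding L R
    proof (rule sum.reindex_bij_witness[where i = "\<lambda>(S, T). (S \<union> T, S)"
          and j = "\<lambda>(W, S). (S, W - S)"], goal_cases)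
      case (5 p)
      obtain W S where p: "p = (W, S)" by force
      with 5 have WS: "W \<subseteq> U" "S \<subseteq> W" by auto
      note fin = finite_subset[OF WS(1) True] finite_subset[OF order_trans[OF WS(2,1)] True]
      have eq: "U - S = (W - S) \<union> (U - W)" "U - S - (W - S) = U - W" "W = S \<union> (W - S)"
        using WS by auto
      have 1: "ext_sign S (U - S) = (ext_sign S (W - S) * ext_sign S (U - W) :: 'b)"
        unfolding eq(1) by (rule ext_sign_Un_right) (use fin True in auto)
      have 2: "ext_sign W (U - W) = (ext_sign S (U - W) * ext_sign (W - S) (U - W) :: 'b)"
        using ext_sign_Un_left[of S "W - S" "U - W"] eq(3) fin True by auto
      show ?case unfolding p prod.case eq(2) 1 2 by (simp add: mult_ac)
    qed auto
  qed
qed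

lemma ring_ext_alg:
  assumes "finite I"
  shows "ring (ext_alg I :: ('i::linorder set \<Rightarrow> 'k::field) ring)"
proof (rule ringI)
  show "abelian_group (ext_alg I :: ('i set \<Rightarrow> 'k) ring)"
  proof (rule abelian_groupI)
    fix x :: "'i set \<Rightarrow> 'k" assume "x \<in> carrier (ext_alg I)"
    then show "\<exists>y\<in>carrier (ext_alg I). y \<oplus>\<^bsub>ext_alg I\<^esub> x = \<zero>\<^bsub>ext_alg I\<^esub>"
      by (intro bexI[of _ "- x"]) (auto simp: ext_alg_def)
  next
    fix x y :: "'i set \<Rightarrow> 'k"
    assume "x \<in> carrier (ext_alg I)" "y \<in> carrier (ext_alg I)"
    then show "x \<oplus>\<^bsub>ext_alg I\<^esub> y \<in> carrier (ext_alg I)"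
      by (simp add: ext_alg_def) (metis add_0)
  qed (auto simp: ext_alg_def add_ac)
  show "Group.monoid (ext_alg I :: ('i set \<Rightarrow> 'k) ring)"
  proof (rule monoidI)
    fix x y :: "'i set \<Rightarrow> 'k"
    assume x: "x \<in> carrier (ext_alg I)"
    have fin: "finite U" if "x U \<noteq> 0" for U using that x assms
      by (auto simp: ext_alg_def dest: finite_subset)
    have "ext_mult (ext_mono {}) x U = x U" for U
    proof (cases "finite U")
      case True
      then show ?thesis unfolding ext_mult_def
        by (subst sum.remove[of _ "{}"]) (auto simp: ext_mono_def intro: sum.neutral)
    qed (use fin in \<open>auto simp: ext_mult_def finite_Pow_iff\<close>)
    then show "\<one>\<^bsub>ext_alg I\<^esub> \<otimes>\<^bsub>ext_alg I\<^esub> x = x" by (auto simp: ext_alg_def)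
    have "ext_mult x (ext_mono {}) U = x U" for U
    proof (cases "finite U")
      case True
      have U: "ext_mono {} (U - S) = (0::'k)" if "S \<in> Pow U - {U}" for S
        using that by (auto simp: ext_mono_def)
      have "ext_mult x (ext_mono {}) U = ext_sign U (U - U) * x U * ext_mono {} (U - U)"
      proof -
        have "(\<Sum>S\<in>Pow U - {U}. ext_sign S (U - S) * x S * ext_mono {} (U - S)) = 0"
          by (intro sum.neutral ballI) (simp only: U mult_zero_right)
        moreover have "finite (Pow U)" "U \<in> Pow U" using True by simp_all
        ultimately show ?thesis unfolding ext_mult_def
          by (simp only: sum.remove[of "Pow U" U] add_0_right)
      qed
      then show ?thesis by (simp add: ext_mono_def)
    qed (use fin in \<open>auto simp: ext_mult_def finite_Pow_iff\<close>)
    then show "x \<otimes>\<^bsub>ext_alg I\<^esub> \<one>\<^bsub>ext_alg I\<^esub> = x" by (auto simp: ext_alg_def)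
    assume y: "y \<in> carrier (ext_alg I)"
    have "U \<subseteq> I" if nz: "ext_mult x y U \<noteq> 0" for U
    proof -
      obtain S where S: "S \<in> Pow U" "ext_sign S (U - S) * x S * y (U - S) \<noteq> 0"
        using sum.not_neutral_contains_not_neutral[OF nz[unfolded ext_mult_def]] by blast
      then have "x S \<noteq> 0" "y (U - S) \<noteq> 0" by auto
      with x y have "S \<subseteq> I" "U - S \<subseteq> I" by (simp_all add: ext_alg_def)
      then show ?thesis by blast
    qed
    then show "x \<otimes>\<^bsub>ext_alg I\<^esub> y \<in> carrier (ext_alg I)" by (auto simp: ext_alg_def)
  next
    show "\<one>\<^bsub>ext_alg I\<^esub> \<in> carrier (ext_alg I :: ('i set \<Rightarrow> 'k) ring)"
      by (simp add: ext_alg_def ext_mono_def)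
  qed (simp add: ext_alg_def ext_mult_assoc)
next
  have "ext_mult (x + y) z = ext_mult x z + (ext_mult y z :: 'i set \<Rightarrow> 'k)" for x y z
    by (rule ext) (simp add: ext_mult_def distrib_left distrib_right sum.distrib)
  then show "(x \<oplus>\<^bsub>ext_alg I\<^esub> y) \<otimes>\<^bsub>ext_alg I\<^esub> z =
      x \<otimes>\<^bsub>ext_alg I\<^esub> z \<oplus>\<^bsub>ext_alg I\<^esub> y \<otimes>\<^bsub>ext_alg I\<^esub> z"
    for x y z :: "'i set \<Rightarrow> 'k" by (simp add: ext_alg_def)
  have "ext_mult z (x + y) = ext_mult z x + (ext_mult z y :: 'i set \<Rightarrow> 'k)" for x y z
    by (rule ext) (simp add: ext_mult_def distrib_left distrib_right sum.distrib)
  then show "z \<otimes>\<^bsub>ext_alg I\<^esub> (x \<oplus>\<^bsub>ext_alg I\<^esub> y) =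
      z \<otimes>\<^bsub>ext_alg I\<^esub> x \<oplus>\<^bsub>ext_alg I\<^esub> z \<otimes>\<^bsub>ext_alg I\<^esub> y"
    for x y z :: "'i set \<Rightarrow> 'k" by (simp add: ext_alg_def)
qed

lemma ext_mult_mono:
  assumes "finite S" "finite T"
  shows "ext_mult (ext_mono S) (ext_mono T) =
    (if S \<inter> T = {} then ext_scale (ext_sign S T) (ext_mono (S \<union> T))
     else (0 :: 'i::linorder set \<Rightarrow> 'k::field))"
proof
  fix U :: "'i set"
  have *: "ext_mult (ext_mono S) (ext_mono T) U =
     (\<Sum>R\<in>Pow U. if R = S \<and> U - R = T then ext_sign S T else (0::'k))"
    unfolding ext_mult_def ext_mono_def by (rule sum.cong) auto
  show "ext_mult (ext_mono S) (ext_mono T) U =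
    (if S \<inter> T = {} then ext_scale (ext_sign S T) (ext_mono (S \<union> T)) else (0 :: 'i set \<Rightarrow> 'k)) U"
  proof (cases "U = S \<union> T \<and> S \<inter> T = {}")
    case True
    then have "(if R = S \<and> U - R = T then ext_sign S T else (0::'k)) =
        (if R = S then ext_sign S T else 0)" for R by auto
    then show ?thesis unfolding * using True assms
      by (simp add: ext_mono_def ext_scale_def sum.delta)
  next
    case False
    have "\<not> (R = S \<and> U - R = T)" if "R \<in> Pow U" for R using that False by blast
    then have "ext_mult (ext_mono S) (ext_mono T) U = (0::'k)"
      unfolding * by (intro sum.neutral ballI if_not_P)
    moreover have "ext_mono (S \<union> T) U = (0::'k)" if "S \<inter> T = {}"
      using False that by (simp add: ext_mono_def)
    ultimately show ?thesis by (simp add: ext_scale_def)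
  qed
qed

lemma ext_gen_square: "ext_mult (ext_gen i) (ext_gen i) = (0 :: 'i::linorder set \<Rightarrow> 'k::field)"
  by (simp add: ext_gen_def ext_mult_mono)

lemma ext_gen_anticommute:
  "ext_mult (ext_gen i) (ext_gen j) = - ext_mult (ext_gen j) (ext_gen i :: 'i::linorder set \<Rightarrow> 'k::field)"
proof (cases i j rule: linorder_cases)
  case less
  then have s: "{(s, t). s \<in> {i} \<and> t \<in> {j} \<and> t < s} = {}"
    "{(s, t). s \<in> {j} \<and> t \<in> {i} \<and> t < s} = {(j, i)}" by auto
  have "ext_sign {i} {j} = (1::'k)" "ext_sign {j} {i} = (- 1::'k)"
    unfolding ext_sign_def s by simp_all
  then show ?thesis using less
    by (auto simp: ext_gen_def ext_mult_mono ext_scale_def fun_eq_iff insert_commute)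
next
  case greater
  then have s: "{(s, t). s \<in> {i} \<and> t \<in> {j} \<and> t < s} = {(i, j)}"
    "{(s, t). s \<in> {j} \<and> t \<in> {i} \<and> t < s} = {}" by auto
  have "ext_sign {i} {j} = (- 1::'k)" "ext_sign {j} {i} = (1::'k)"
    unfolding ext_sign_def s by simp_all
  then show ?thesis using greater
    by (auto simp: ext_gen_def ext_mult_mono ext_scale_def fun_eq_iff insert_commute)
qed (simp add: ext_gen_square)

lemma vector_space_ext_scale: "vector_space (ext_scale :: 'k::field \<Rightarrow> ('i set \<Rightarrow> 'k) \<Rightarrow> _)"
  by unfold_locales (auto simp: ext_scale_def fun_eq_iff algebra_simps)

end

theory Submission
  imports Defs
begin

text \<open>
  Let \<open>J\<close> be the Orlik--Solomon ideal in the exterior algebra \<open>E\<close>. The dual space of \<open>E/J\<close>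
  consists of the functions \<open>f\<close> on the subsets of \<open>I\<close> that, as linear forms \<open>e\<^sub>S \<mapsto> f S\<close>, vanish on
  \<open>J\<close>. It depends only on the matroid of the cone over the arrangement, whose ground set is \<open>I\<close>
  together with the hyperplane at infinity \<open>\<infinity>\<close>: the condition on \<open>f\<close> is that \<open>f S = 0\<close> if
  \<open>S \<union> {\<infinity>}\<close> is dependent, and that \<open>\<Sum>i\<in>S. \<plusminus> f (S - {i}) = 0\<close> if \<open>S\<close> is dependent
  (\<open>os_ideal_eq_annihilator\<close>).

  An element \<open>x\<close> of degree 1 has square zero, and it is nonsingular iff multiplication by \<open>x\<close> is
  exact on \<open>E/J\<close>. Then the transpose, contraction by \<open>x\<close>, is exact on the dual. Contraction
  exchanges the even and the odd part, so these have the same dimension, and the Euler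
  characteristic of the dual vanishes (\<open>exact_on_dual\<close>, \<open>euler_char_exact\<close>).

  On the other hand the Euler characteristic satisfies a deletion--contraction recursion; the
  point that takes work is that every element of the dual of a deletion extends
  (\<open>os_dual_extend_homogeneous\<close>). So it is, up to the sign \<open>(-1)\<^sup>r\<^sup>-\<^sup>1\<close> for a matroid of rank \<open>r\<close>,
  Crapo's beta invariant, and the recursion adds numbers of the same sign. By Tutte's theorem that
  a deletion or a contraction of a connected matroid is connected, it is nonzero for connected
  matroids (\<open>connected_delete_or_contract\<close>, \<open>euler_char_affine_dual\<close>).

  Irreducibility enters through connectedness. A separation of the matroid gives subfamilies \<open>S\<close>
  and \<open>T\<close> whose direction spaces are complementary, and in coordinates adapted to these spaces the
  arrangement is a product (\<open>reducible_if_directions_split\<close>). Hence the cone matroid of an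
  irreducible noncentral arrangement is connected, and every \<open>x\<close> is singular.

  For a nonempty central arrangement \<open>\<infinity>\<close> is a coloop and the Euler characteristic is zero. Here
  \<open>\<partial>\<close>, normalized by \<open>\<partial>e\<^sub>i = 1\<close>, acts on \<open>E/J\<close> with \<open>\<partial>(x m) = c m - x \<partial>m\<close>, where \<open>c\<close> is the sum of the coefficients of \<open>x\<close>. If \<open>c \<noteq> 0\<close>
  this is a contracting homotopy for multiplication by \<open>x\<close>, and \<open>x\<close> is nonsingular
  (\<open>not_singular_if_sum_nonzero\<close>). If \<open>c = 0\<close>, exactness on the dual passes to the part supported on
  sets that avoid a chosen hyperplane \<open>z\<close> (\<open>exact_on_kernel\<close>). This part is the dual for the affine
  arrangement with \<open>z\<close> moved to infinity, the cone matroid is now the connected matroid on \<open>I\<close>, and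
  the Euler characteristic shows again that \<open>x\<close> is singular. The elements with \<open>c = 0\<close> are those
  spanned by the differences \<open>e\<^sub>i - e\<^sub>j\<close>.
\<close>

section \<open>Matroids given by a rank function\<close>

text \<open>The last axiom says that an element in the closure of a set lies in the closure of every
  larger set. In this local form submodularity is easy to check for systems of linear equations.\<close>

locale rank_matroid =
  fixes E :: "'a set" and r :: "'a set \<Rightarrow> nat"
  assumes finite_ground: "finite E"
    and rank_empty: "r {} = 0"
    and rank_insert: "S \<subseteq> E \<Longrightarrow> x \<in> E \<Longrightarrow> r (insert x S) = r S \<or> r (insert x S) = Suc (r S)"
    and rank_insert_eq_mono:
      "S \<subseteq> T \<Longrightarrow> T \<subseteq> E \<Longrightarrow> x \<in> E \<Longrightarrow> r (insert x S) = r S \<Longrightarrow> r (insert x T) = r T"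
begin

text \<open>The rank gained by adding \<open>X\<close> can only drop when the set grows, since this holds for the
  elements of \<open>X\<close> one at a time. Monotonicity and submodularity are special cases.\<close>

lemma rank_Un_diff_antimono:
  assumes "S \<subseteq> T" "T \<subseteq> E" "X \<subseteq> E"
  shows "r (T \<union> X) + r S \<le> r (S \<union> X) + r T \<and> r S \<le> r (S \<union> X)"
proof -
  have "finite X" using assms(3) finite_ground finite_subset by auto
  then show ?thesis using assms(3)
  proof (induction X)
    case (insert x X)
    have "r (insert x (S \<union> X)) = r (S \<union> X) \<or> r (insert x (S \<union> X)) = Suc (r (S \<union> X))"
      "r (insert x (T \<union> X)) = r (T \<union> X) \<or> r (insert x (T \<union> X)) = Suc (r (T \<union> X))"
      using insert.prems assms rank_insert[of "S \<union> X" x] rank_insert[of "T \<union> X" x] by auto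
    moreover have "r (insert x (S \<union> X)) = r (S \<union> X) \<Longrightarrow> r (insert x (T \<union> X)) = r (T \<union> X)"
      using insert.prems assms by (intro rank_insert_eq_mono[of "S \<union> X" "T \<union> X" x]) auto
    ultimately show ?case using insert.IH insert.prems by auto
  qed auto
qed

lemma rank_mono: "S \<subseteq> T \<Longrightarrow> T \<subseteq> E \<Longrightarrow> r S \<le> r T"
  using rank_Un_diff_antimono[of S S T] by (simp add: Un_absorb1)

lemma rank_submodular:
  assumes "S \<subseteq> E" "T \<subseteq> E"
  shows "r (S \<union> T) + r (S \<inter> T) \<le> r S + r T"
  using rank_Un_diff_antimono[of "S \<inter> T" S T] assms by (simp add: Un_absorb1)

lemma rank_le_card:
  assumes "S \<subseteq> E" shows "r S \<le> card S"
proof -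
  have "finite S" using assms finite_ground finite_subset by auto
  then show ?thesis using assms
  proof (induction S)
    case (insert x S)
    then show ?case using rank_insert[of S x] by auto
  qed (simp add: rank_empty)
qed

lemma independent_subset:
  assumes "r T = card T" "S \<subseteq> T" "T \<subseteq> E" shows "r S = card S"
proof -
  have fin: "finite T" using assms finite_ground finite_subset by auto
  have "r (S \<union> (T - S)) + r (S \<inter> (T - S)) \<le> r S + r (T - S)"
    using assms by (intro rank_submodular) auto
  moreover have "S \<union> (T - S) = T" "S \<inter> (T - S) = {}" using assms by auto
  moreover have "r (T - S) \<le> card T - card S" 
    using rank_le_card[of "T - S"] assms fin by (auto simp: card_Diff_subset finite_subset)
  moreover have "r S \<le> card S" "card S \<le> card T"
    using rank_le_card[of S] assms fin by (auto intro: card_mono)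
  ultimately show ?thesis using assms(1) rank_empty by simp
qed

lemma rank_restrict:
  assumes "X \<subseteq> E" shows "rank_matroid X r"
proof
  show "finite X" using assms finite_ground finite_subset by blast
  show "r (insert x S) = r S \<or> r (insert x S) = Suc (r S)" if "S \<subseteq> X" "x \<in> X" for S x
    using that assms rank_insert[of S x] by blast
  show "r (insert x T) = r T"
    if "S \<subseteq> T" "T \<subseteq> X" "x \<in> X" "r (insert x S) = r S" for S T x
    using that assms rank_insert_eq_mono[of S T x] by blast
qed (rule rank_empty)

lemma rank_contract:
  assumes i: "i \<in> E" "r {i} = 1"
  shows "rank_matroid (E - {i}) (\<lambda>S. r (insert i S) - 1)"
proof
  have pos: "r (insert i S) \<ge> 1" if "S \<subseteq> E" for S
    using rank_mono[of "{i}" "insert i S"] that i by auto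
  show "finite (E - {i})" using finite_ground by simp
  show "r (insert i {}) - 1 = 0" using i by simp
  fix S x assume S: "S \<subseteq> E - {i}" and x: "x \<in> E - {i}"
  then have "r (insert x (insert i S)) = r (insert i S) \<or> r (insert x (insert i S)) = Suc (r (insert i S))"
    using i by (intro rank_insert) auto
  then show "r (insert i (insert x S)) - 1 = r (insert i S) - 1 \<or>
      r (insert i (insert x S)) - 1 = Suc (r (insert i S) - 1)"
    using pos[of S] S by (auto simp: insert_commute)
next
  fix S T x assume *: "S \<subseteq> T" "T \<subseteq> E - {i}" "x \<in> E - {i}"
    and eq: "r (insert i (insert x S)) - 1 = r (insert i S) - 1"
  have "r (insert i (insert x S)) \<ge> 1" "r (insert i S) \<ge> 1"
    using rank_mono[of "{i}" "insert i S"] rank_mono[of "{i}" "insert i (insert x S)"] * i by auto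
  with eq have "r (insert x (insert i S)) = r (insert i S)" by (simp add: insert_commute)
  then have "r (insert x (insert i T)) = r (insert i T)"
    using * i by (intro rank_insert_eq_mono[of "insert i S" "insert i T" x]) auto
  then show "r (insert i (insert x T)) - 1 = r (insert i T) - 1" by (simp add: insert_commute)
qed

end

text \<open>As \<open>r E \<le> r S + r (E - S)\<close> always holds, the matroid is connected iff it is not the direct
  sum of its restrictions to \<open>S\<close> and \<open>E - S\<close>.\<close>

definition connected_matroid :: "'a set \<Rightarrow> ('a set \<Rightarrow> nat) \<Rightarrow> bool" where
  "connected_matroid E r \<longleftrightarrow> (\<forall>S\<subseteq>E. S \<noteq> {} \<longrightarrow> S \<noteq> E \<longrightarrow> r E < r S + r (E - S))"

context rank_matroid
begin

text \<open>Tutte's theorem. A separation of the deletion and one of the contraction divide \<open>E - {i}\<close> into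
  four corners, and submodularity shows that of two opposite corners one is empty. Then one of the
  four sides is empty as well.\<close>

lemma connected_delete_or_contract:
  assumes conn: "connected_matroid E r" and i: "i \<in> E" and ne: "E \<noteq> {i}"
  shows "connected_matroid (E - {i}) r \<or> connected_matroid (E - {i}) (\<lambda>S. r (insert i S) - 1)"
proof (rule ccontr)
  assume "\<not> ?thesis"
  then obtain S1 S2 where S1: "S1 \<subseteq> E - {i}" "S1 \<noteq> {}" "S1 \<noteq> E - {i}"
      "r S1 + r (E - {i} - S1) \<le> r (E - {i})"
    and S2: "S2 \<subseteq> E - {i}" "S2 \<noteq> {}" "S2 \<noteq> E - {i}"
      "(r (insert i S2) - 1) + (r (insert i (E - {i} - S2)) - 1) \<le> r (insert i (E - {i})) - 1"
    unfolding connected_matroid_def by (meson not_less)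
  have big: "r E < r S + r (E - S)" if "S \<subseteq> E" "S \<noteq> {}" "S \<noteq> E" for S
    using conn that unfolding connected_matroid_def by auto
  have "r E < r {i} + r (E - {i})" using i ne by (intro big) auto
  then have ri: "r {i} = 1" and rEi: "r (E - {i}) = r E"
    using rank_le_card[of "{i}"] i rank_mono[of "E - {i}" E] by auto
  define T1 T2 where "T1 = E - {i} - S1" and "T2 = E - {i} - S2"
  have T1: "T1 \<noteq> {}" "T1 \<subseteq> E - {i}" and T2: "T2 \<noteq> {}" "T2 \<subseteq> E - {i}"
    using S1 S2 by (auto simp: T1_def T2_def)
  have 1: "r S1 + r T1 \<le> r E" using S1 rEi by (simp add: T1_def)
  have "r (insert i S2) \<ge> 1" "r (insert i T2) \<ge> 1" "r E \<ge> 1"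
    using rank_mono[of "{i}" "insert i S2"] rank_mono[of "{i}" "insert i T2"] rank_mono[of "{i}" E]
      i ri S2 T2 by auto
  then have 2: "r (insert i S2) + r (insert i T2) \<le> r E + 1"
    using S2(4) i by (simp add: T2_def insert_absorb)
  \<comment> \<open>If both corners were nonempty, connectedness would make the left-hand sides of the two
    submodular inequalities sum up to at least \<open>2 (r E + 1)\<close>, but the right-hand sides sum up to
    at most \<open>2 r E + 1\<close>.\<close>
  have key: "A \<inter> C = {} \<or> B \<inter> D = {}"
    if "A \<union> B = E - {i}" "A \<inter> B = {}" "C \<union> D = E - {i}" "C \<inter> D = {}"
      "r A + r B \<le> r E" "r (insert i C) + r (insert i D) \<le> r E + 1" for A B C D
  proof (rule ccontr)
    assume neg: "\<not> ?thesis"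
    have "r (A \<union> insert i C) + r (A \<inter> insert i C) \<le> r A + r (insert i C)"
      "r (B \<union> insert i D) + r (B \<inter> insert i D) \<le> r B + r (insert i D)"
      using rank_submodular[of A "insert i C"] rank_submodular[of B "insert i D"] that(1,3) i
      by blast+
    moreover have "A \<inter> insert i C = A \<inter> C" "B \<inter> insert i D = B \<inter> D" using that by auto
    moreover have "E - (A \<inter> C) = B \<union> insert i D" "E - (B \<inter> D) = A \<union> insert i C"
      using that i by auto
    moreover have "r E < r (A \<inter> C) + r (E - (A \<inter> C))" "r E < r (B \<inter> D) + r (E - (B \<inter> D))"
      using neg that(1,3) i big[of "A \<inter> C"] big[of "B \<inter> D"] by blast+
    ultimately show False using that by simp
  qed
  have part: "S1 \<union> T1 = E - {i}" "S1 \<inter> T1 = {}" "S2 \<union> T2 = E - {i}" "S2 \<inter> T2 = {}"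
    "T2 \<union> S2 = E - {i}" "T2 \<inter> S2 = {}" "r (insert i T2) + r (insert i S2) \<le> r E + 1"
    using S1 S2 2 by (auto simp: T1_def T2_def)
  have "S1 \<inter> S2 = {} \<or> T1 \<inter> T2 = {}" "S1 \<inter> T2 = {} \<or> T1 \<inter> S2 = {}"
    using key[OF part(1-4) 1 2] key[OF part(1,2,5,6) 1 part(7)] by auto
  moreover have "S1 \<inter> S2 \<noteq> {} \<or> S1 \<inter> T2 \<noteq> {}" using S1(1,2) part(3) by blast
  moreover have "T1 \<inter> S2 \<noteq> {} \<or> T1 \<inter> T2 \<noteq> {}" using T1 part(3) by blast
  moreover have "S1 \<inter> S2 \<noteq> {} \<or> T1 \<inter> S2 \<noteq> {}" using S2(1,2) part(1) by blast
  moreover have "S1 \<inter> T2 \<noteq> {} \<or> T1 \<inter> T2 \<noteq> {}" using T2 part(1) by blast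
  ultimately show False by argo
qed

end

section \<open>Linear algebra\<close>

lemma (in vector_space) span_Int_independent:
  assumes C: "independent C" and "B \<subseteq> C" "x \<in> span B" "x \<in> span (C - B)"
  shows "x = 0"
proof -
  have "representation C x = representation B x" "representation C x = representation (C - B) x"
    using assms by (auto intro!: representation_extend)
  then have "representation C x b = 0" for b
    using representation_ne_zero[of B x b] representation_ne_zero[of "C - B" x b] by auto
  moreover have "x \<in> span C" using assms span_mono by blast
  ultimately show ?thesis using sum_nonzero_representation_eq[OF C, of x] by simp
qed

text \<open>Rank--nullity for a finite-dimensional subspace of a space that may have infinite dimension,
  as the space of all functions on sets of indices has.\<close>

lemma (in vector_space) dim_kernel_image:
  assumes lin: "Vector_Spaces.linear scale scale f"
    and V: "subspace V" "V \<subseteq> span F" "finite F"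
  shows "dim V = dim {x \<in> V. f x = 0} + dim (f ` V)"
proof -
  interpret f: Vector_Spaces.linear scale scale f by (rule lin)
  interpret vector_space_pair scale scale by unfold_locales
  let ?N = "{x \<in> V. f x = 0}"
  obtain B where B: "B \<subseteq> ?N" "independent B" "?N \<subseteq> span B" "card B = dim ?N"
    by (rule basis_exists)
  obtain C where C: "B \<subseteq> C" "C \<subseteq> V" "independent C" "V \<subseteq> span C"
    using maximal_independent_subset_extend[of B V] B by blast
  have finC: "finite C" using independent_span_bound[of F C] C V by auto
  have "inj_on f (span (C - B))"
  proof (subst f.inj_on_iff_eq_0[OF subspace_span], safe)
    fix x assume x: "x \<in> span (C - B)" "f x = 0"
    then have "x \<in> V" using C V span_minimal[of "C - B" V] by auto
    with x B(3) have "x \<in> span B" by blast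
    then show "x = 0" using span_Int_independent[OF C(3,1)] x by simp
  qed
  moreover have ind: "independent (C - B)" using C(3) independent_mono by blast
  ultimately have fi: "independent (f ` (C - B))" and inj: "inj_on f (C - B)"
    using f.independent_injective_image inj_on_subset span_superset by blast+
  have "f ` V \<subseteq> span (f ` (C - B))"
  proof -
    have "f ` C \<subseteq> insert 0 (f ` (C - B))" using B by auto
    then have "span (f ` C) \<subseteq> span (insert 0 (f ` (C - B)))" by (rule span_mono)
    then show ?thesis using C f.spans_image[of V C] by (auto simp: span_insert_0)
  qed
  then have "dim (f ` V) = card (f ` (C - B))"
    using fi C by (intro dim_unique[of "f ` (C - B)"]) auto
  also have "\<dots> = card C - card B"
    using inj finC C by (simp add: card_image card_Diff_subset finite_subset)
  finally show ?thesis
    using dim_unique[OF C(2,4,3) refl] B C finC card_mono[of C B] by simp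
qed

interpretation ext: vector_space "ext_scale :: 'k::field \<Rightarrow> ('i set \<Rightarrow> 'k) \<Rightarrow> _"
  by (rule vector_space_ext_scale)

abbreviation ext_space :: "'i::linorder set \<Rightarrow> ('i set \<Rightarrow> 'k::field) set" where
  "ext_space I \<equiv> carrier (ext_alg I)"

lemma ext_space_iff: "x \<in> ext_space I \<longleftrightarrow> (\<forall>S. x S \<noteq> 0 \<longrightarrow> S \<subseteq> I)"
  by (simp add: ext_alg_def)

lemma subspace_ext_iff:
  "ext.subspace W \<longleftrightarrow> 0 \<in> W \<and> (\<forall>x\<in>W. \<forall>y\<in>W. x + y \<in> W) \<and> (\<forall>c. \<forall>x\<in>W. ext_scale c x \<in> W)"
  by (simp add: ext.subspace_def)

lemma subspace_ext_space:
  "ext.subspace (ext_space I :: ('i::linorder set \<Rightarrow> 'k::field) set)"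
  unfolding subspace_ext_iff
proof (intro conjI ballI allI)
  fix x y :: "'i set \<Rightarrow> 'k" assume "x \<in> ext_space I" "y \<in> ext_space I"
  then have "x S = 0 \<and> y S = 0" if "\<not> S \<subseteq> I" for S using that by (auto simp: ext_space_iff)
  then show "x + y \<in> ext_space I" by (fastforce simp: ext_space_iff)
qed (auto simp: ext_space_iff ext_scale_def)

lemma sum_fun_apply: "sum f A S = (\<Sum>a\<in>A. f a S)"
  by (induction A rule: infinite_finite_induct) auto

lemma ext_space_expand:
  assumes "finite I" "x \<in> ext_space I"
  shows "x = (\<Sum>S\<in>Pow I. ext_scale (x S) (ext_mono S))"
proof
  fix T
  have "(\<Sum>S\<in>Pow I. ext_scale (x S) (ext_mono S)) T = (\<Sum>S\<in>Pow I. if S = T then x S else 0)"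
    unfolding sum_fun_apply by (rule sum.cong) (auto simp: ext_scale_def ext_mono_def)
  also have "\<dots> = x T" using assms by (auto simp: ext_space_iff)
  finally show "x T = (\<Sum>S\<in>Pow I. ext_scale (x S) (ext_mono S)) T" by simp
qed

lemma ext_space_span:
  fixes I :: "'i::linorder set"
  assumes "finite I"
  shows "(ext_space I :: ('i set \<Rightarrow> 'k::field) set) \<subseteq> ext.span (ext_mono ` Pow I)"
proof
  fix x :: "'i set \<Rightarrow> 'k" assume "x \<in> ext_space I"
  then have x: "x = (\<Sum>S\<in>Pow I. ext_scale (x S) (ext_mono S))"
    by (rule ext_space_expand[OF assms])
  show "x \<in> ext.span (ext_mono ` Pow I)"
    by (subst x) (intro ext.span_sum ext.span_scale ext.span_base; auto)
qed

text \<open>A function \<open>f\<close> stands for the linear form with value \<open>f S\<close> on \<open>e\<^sub>S\<close>, so that the exterior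
  algebra and its dual live on the same type.\<close>

definition pairing :: "'i set \<Rightarrow> ('i set \<Rightarrow> 'k::field) \<Rightarrow> ('i set \<Rightarrow> 'k) \<Rightarrow> 'k" where
  "pairing I f m = (\<Sum>S\<in>Pow I. f S * m S)"

lemma pairing_add: "pairing I (f + g) m = pairing I f m + pairing I g m"
  "pairing I f (m + m') = pairing I f m + pairing I f m'"
  by (simp_all add: pairing_def algebra_simps sum.distrib)

lemma pairing_scale: "pairing I (ext_scale c f) m = c * pairing I f m"
  "pairing I f (ext_scale c m) = c * pairing I f m"
  by (simp_all add: pairing_def ext_scale_def sum_distrib_left mult_ac)

lemma pairing_diff: "pairing I f (m - m') = pairing I f m - pairing I f m'"
  by (simp add: pairing_def algebra_simps sum_subtractf)

lemma pairing_zero [simp]: "pairing I 0 m = 0" "pairing I f 0 = 0"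
  by (simp_all add: pairing_def)

lemma pairing_mono:
  assumes "finite I" "S \<subseteq> I" shows "pairing I f (ext_mono S) = f S"
proof -
  have "pairing I f (ext_mono S) = (\<Sum>T\<in>Pow I. if T = S then f T else 0)"
    unfolding pairing_def ext_mono_def by (rule sum.cong) auto
  then show ?thesis using assms by simp
qed

lemma pairing_commute: "pairing I f m = pairing I m f"
  by (simp add: pairing_def mult.commute)

text \<open>Extending a basis of \<open>W\<close> by \<open>f\<close> gives a linear form that vanishes on \<open>W\<close> but not at \<open>f\<close>; its
  values on the monomials are the coefficients of \<open>m\<close>. So a subspace is determined by its
  orthogonal complement.\<close>

lemma pairing_separates:
  fixes W :: "('i::linorder set \<Rightarrow> 'k::field) set"
  assumes I: "finite I" and W: "ext.subspace W" "W \<subseteq> ext_space I"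
    and f: "f \<in> ext_space I" "f \<notin> W"
  obtains m where "m \<in> ext_space I" "\<And>w. w \<in> W \<Longrightarrow> pairing I w m = 0" "pairing I f m \<noteq> 0"
proof -
  interpret K: vector_space "(*) :: 'k \<Rightarrow> 'k \<Rightarrow> 'k" by unfold_locales (auto simp: algebra_simps)
  interpret P: vector_space_pair "ext_scale :: 'k \<Rightarrow> ('i set \<Rightarrow> 'k) \<Rightarrow> _" "(*) :: 'k \<Rightarrow> 'k \<Rightarrow> 'k"
    by unfold_locales
  obtain B where B: "B \<subseteq> W" "ext.independent B" "W \<subseteq> ext.span B"
    using ext.maximal_independent_subset[of W] by blast
  have "f \<notin> ext.span B" using f(2) W(1) B(1) ext.span_minimal by blast
  then have ind: "ext.independent (insert f B)" using B(2) ext.independent_insertI by blast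
  define \<phi> where "\<phi> = P.construct (insert f B) (\<lambda>b. if b = f then 1 else 0)"
  interpret \<phi>: Vector_Spaces.linear "ext_scale :: 'k \<Rightarrow> ('i set \<Rightarrow> 'k) \<Rightarrow> _" "(*)" \<phi>
    unfolding \<phi>_def by (rule P.linear_construct[OF ind])
  have "\<phi> b = 0" if "b \<in> B" for b
    using that f B unfolding \<phi>_def by (subst P.construct_basis[OF ind]) auto
  then have W0: "\<phi> w = 0" if "w \<in> W" for w
    using that B \<phi>.eq_0_on_span[of B w] by blast
  have f1: "\<phi> f = 1" unfolding \<phi>_def by (subst P.construct_basis[OF ind]) auto
  define m where "m = (\<lambda>S. if S \<subseteq> I then \<phi> (ext_mono S) else 0)"
  have \<phi>_pairing: "\<phi> x = pairing I x m" if "x \<in> ext_space I" for x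
  proof -
    have "\<phi> x = \<phi> (\<Sum>S\<in>Pow I. ext_scale (x S) (ext_mono S))"
      by (rule arg_cong[OF ext_space_expand[OF I that]])
    also have "\<dots> = pairing I x m"
      unfolding \<phi>.sum \<phi>.scale pairing_def by (rule sum.cong) (auto simp: m_def)
    finally show ?thesis .
  qed
  show thesis
  proof (rule that)
    show "m \<in> ext_space I" by (simp add: ext_space_iff m_def)
    show "pairing I w m = 0" if "w \<in> W" for w
      using W0[OF that] \<phi>_pairing[OF subsetD[OF W(2) that]] by simp
    show "pairing I f m \<noteq> 0" using f1 \<phi>_pairing[OF f(1)] by simp
  qed
qed

section \<open>Exterior multiplication and contraction by linear forms\<close>

text \<open>The sign in \<open>e\<^sub>i \<and> e\<^sub>S = \<plusminus> e\<^bsub>S \<union> {i}\<^esub>\<close>. It is the same for \<open>S\<close> and \<open>S - {i}\<close>, so it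
  serves multiplication and contraction alike.\<close>

definition gen_sign :: "'i::linorder \<Rightarrow> 'i set \<Rightarrow> 'k::field" where
  "gen_sign i S = (-1) ^ card {t \<in> S. t < i}"

lemma gen_sign_square [simp]: "gen_sign i S * gen_sign i S = (1::'k::field)"
  by (simp add: gen_sign_def flip: power_add)

lemma gen_sign_insert:
  assumes "finite S" "j \<notin> S"
  shows "gen_sign i (insert j S) = (if j < i then - 1 else 1) * (gen_sign i S :: 'k::field)"
proof -
  have "{t \<in> insert j S. t < i} = (if j < i then insert j {t \<in> S. t < i} else {t \<in> S. t < i})"
    by auto
  then show ?thesis using assms by (simp add: gen_sign_def)
qed

lemma gen_sign_insert_same [simp]: "gen_sign i (insert i S) = gen_sign i S"
proof -
  have "{t \<in> insert i S. t < i} = {t \<in> S. t < i}" by auto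
  then show ?thesis by (simp add: gen_sign_def)
qed

lemma gen_sign_remove_same [simp]: "gen_sign i (S - {i}) = gen_sign i S"
proof -
  have "{t \<in> S - {i}. t < i} = {t \<in> S. t < i}" by auto
  then show ?thesis by (simp add: gen_sign_def)
qed

lemma gen_sign_swap:
  assumes "finite S" "i \<notin> S" "j \<notin> S" "i \<noteq> j"
  shows "gen_sign i S * gen_sign j (insert i S) = - (gen_sign j S * gen_sign i (insert j S) :: 'k::field)"
  using assms by (cases i j rule: linorder_cases) (auto simp: gen_sign_insert)

lemma gen_sign_swap':
  assumes "finite S" "j \<in> S" "i \<notin> S"
  shows "gen_sign i S * gen_sign j (insert i S) = - (gen_sign j S * gen_sign i (S - {j}) :: 'k::field)"
proof -
  obtain T where T: "S = insert j T" "j \<notin> T" using assms by (meson mk_disjoint_insert)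
  have "i \<noteq> j" "finite T" "i \<notin> T" using assms T by auto
  then show ?thesis using T
    by (cases i j rule: linorder_cases) (auto simp: gen_sign_insert insert_commute[of i j])
qed

text \<open>The terms cancel in pairs; dividing by 2 is avoided because the field may have
  characteristic 2.\<close>

lemma sum_antisymmetric:
  fixes c :: "'a \<Rightarrow> 'a \<Rightarrow> 'k::field"
  assumes "finite J" "\<And>i j. i \<in> J \<Longrightarrow> j \<in> J \<Longrightarrow> c i j = - c j i" "\<And>i. i \<in> J \<Longrightarrow> c i i = 0"
  shows "(\<Sum>i\<in>J. \<Sum>j\<in>J. c i j) = 0"
  using assms
proof (induction J)
  case (insert a J)
  have "(\<Sum>i\<in>J. c i a) = - (\<Sum>i\<in>J. c a i)"
    unfolding sum_negf[symmetric] by (rule sum.cong) (auto intro: insert.prems)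
  moreover have "(\<Sum>i\<in>J. \<Sum>j\<in>J. c i j) = 0" by (rule insert.IH) (auto intro: insert.prems)
  moreover have "c a a = 0" by (rule insert.prems) simp
  ultimately show ?case using insert.hyps by (simp add: sum.distrib)
qed simp

text \<open>Multiplication by the linear form \<open>\<Sum>i. a i \<cdot> e\<^sub>i\<close>, and its transpose, the antiderivation with
  \<open>e\<^sub>i \<mapsto> a i\<close>. Both act on the exterior algebra as well as on its dual.\<close>

definition wedge :: "'i::linorder set \<Rightarrow> ('i \<Rightarrow> 'k::field) \<Rightarrow> ('i set \<Rightarrow> 'k) \<Rightarrow> ('i set \<Rightarrow> 'k)" where
  "wedge I a f = (\<lambda>S. if S \<subseteq> I then \<Sum>i\<in>S. a i * gen_sign i S * f (S - {i}) else 0)"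

definition contract :: "'i::linorder set \<Rightarrow> ('i \<Rightarrow> 'k::field) \<Rightarrow> ('i set \<Rightarrow> 'k) \<Rightarrow> ('i set \<Rightarrow> 'k)" where
  "contract I a f = (\<lambda>S. if S \<subseteq> I then \<Sum>i\<in>I - S. a i * gen_sign i S * f (insert i S) else 0)"

lemma wedge_in_ext_space [simp]: "wedge I a f \<in> ext_space I"
  by (simp add: ext_space_iff wedge_def)

lemma contract_in_ext_space [simp]: "contract I a f \<in> ext_space I"
  by (simp add: ext_space_iff contract_def)

lemma wedge_add: "wedge I a (f + g) = wedge I a f + wedge I a g"
  by (auto simp: wedge_def fun_eq_iff algebra_simps sum.distrib)

lemma wedge_scale: "wedge I a (ext_scale c f) = ext_scale c (wedge I a f)"
  by (auto simp: wedge_def ext_scale_def fun_eq_iff sum_distrib_left mult_ac)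

lemma contract_add: "contract I a (f + g) = contract I a f + contract I a g"
  by (auto simp: contract_def fun_eq_iff algebra_simps sum.distrib)

lemma contract_diff: "contract I a (f - g) = contract I a f - contract I a g"
  by (auto simp: contract_def fun_eq_iff algebra_simps sum_subtractf)

lemma contract_scale: "contract I a (ext_scale c f) = ext_scale c (contract I a f)"
  by (auto simp: contract_def ext_scale_def fun_eq_iff sum_distrib_left mult_ac)

lemma wedge_zero [simp]: "wedge I a 0 = 0"
  by (simp add: wedge_def fun_eq_iff)

lemma contract_zero [simp]: "contract I a 0 = 0"
  by (simp add: contract_def fun_eq_iff)

lemma linear_contract: "Vector_Spaces.linear ext_scale ext_scale (contract I a)"
  by (simp add: Vector_Spaces.linear_iff vector_space_ext_scale contract_add contract_scale)

lemma contract_contract_expand: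
  fixes a b :: "'i::linorder \<Rightarrow> 'k::field"
  assumes I: "finite I" and S: "S \<subseteq> I"
  shows "contract I a (contract I b f) S = (\<Sum>i\<in>I - S. \<Sum>j\<in>I - S. if i = j then 0 else
    a i * b j * (gen_sign i S * gen_sign j (insert i S)) * f (insert j (insert i S)))"
    (is "_ = (\<Sum>i\<in>_. \<Sum>j\<in>_. ?c i j)")
proof -
  have "contract I a (contract I b f) S =
      (\<Sum>i\<in>I - S. a i * gen_sign i S * (\<Sum>j\<in>I - insert i S. b j * gen_sign j (insert i S) * f (insert j (insert i S))))"
    using S by (simp add: contract_def)
  also have "\<dots> = (\<Sum>i\<in>I - S. \<Sum>j\<in>I - S. ?c i j)"
  proof (rule sum.cong[OF refl])
    fix i assume i: "i \<in> I - S"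
    have "(\<Sum>j\<in>I - S. ?c i j) = (\<Sum>j\<in>I - insert i S. ?c i j)"
      using I by (intro sum.mono_neutral_right) auto
    also have "\<dots> = a i * gen_sign i S * (\<Sum>j\<in>I - insert i S. b j * gen_sign j (insert i S) * f (insert j (insert i S)))"
      unfolding sum_distrib_left by (rule sum.cong) (auto simp: mult_ac)
    finally show "a i * gen_sign i S * (\<Sum>j\<in>I - insert i S. b j * gen_sign j (insert i S) * f (insert j (insert i S)))
        = (\<Sum>j\<in>I - S. ?c i j)" by simp
  qed
  finally show ?thesis .
qed

lemma contract_anticommute:
  fixes a b :: "'i::linorder \<Rightarrow> 'k::field"
  assumes I: "finite I"
  shows "contract I a (contract I b f) = - contract I b (contract I a f)"
proof
  fix S
  define c where "c a b i j = (if i = j then 0 else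
    a i * b j * (gen_sign i S * gen_sign j (insert i S)) * f (insert j (insert i S)))"
    for a b :: "'i \<Rightarrow> 'k" and i j
  show "contract I a (contract I b f) S = (- contract I b (contract I a f)) S"
  proof (cases "S \<subseteq> I")
    case True
    then have fin: "finite S" using I finite_subset by blast
    have "(\<Sum>i\<in>I - S. \<Sum>j\<in>I - S. c b a i j) = (\<Sum>j\<in>I - S. \<Sum>i\<in>I - S. c b a i j)"
      by (rule sum.swap)
    also have "\<dots> = (\<Sum>j\<in>I - S. \<Sum>i\<in>I - S. - c a b j i)"
    proof (intro sum.cong refl)
      fix i j assume "i \<in> I - S" "j \<in> I - S"
      then show "c b a i j = - c a b j i"
        using gen_sign_swap[of S i j, where 'k = 'k] fin
        by (auto simp: c_def insert_commute[of i j] mult_ac)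
    qed
    finally show ?thesis using True
      by (simp add: contract_contract_expand[OF I] c_def[symmetric] sum_negf)
  qed (simp add: contract_def)
qed

text \<open>Anticommutation of the contraction with itself yields only twice this identity, which is
  void in characteristic 2.\<close>

lemma contract_contract:
  fixes a :: "'i::linorder \<Rightarrow> 'k::field"
  assumes I: "finite I"
  shows "contract I a (contract I a f) = 0"
proof
  fix S
  show "contract I a (contract I a f) S = 0 S"
  proof (cases "S \<subseteq> I")
    case True
    then have fin: "finite S" using I finite_subset by blast
    have "contract I a (contract I a f) S = 0"
      unfolding contract_contract_expand[OF I True]
    proof (rule sum_antisymmetric)
      fix i j assume "i \<in> I - S" "j \<in> I - S"
      then show "(if i = j then 0 else a i * a j * (gen_sign i S * gen_sign j (insert i S)) * f (insert j (insert i S)))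
        = - (if j = i then 0 else a j * a i * (gen_sign j S * gen_sign i (insert j S)) * f (insert i (insert j S)))"
        using gen_sign_swap[of S i j, where 'k = 'k] fin
        by (auto simp: insert_commute[of i j] mult_ac)
    qed (use I in auto)
    then show ?thesis by simp
  qed (simp add: contract_def)
qed

lemma pairing_contract:
  assumes I: "finite I"
  shows "pairing I (contract I a f) m = pairing I f (wedge I a m)"
proof -
  have "pairing I (contract I a f) m =
      (\<Sum>(S, i)\<in>Sigma (Pow I) (\<lambda>S. I - S). a i * gen_sign i S * f (insert i S) * m S)"
    unfolding pairing_def contract_def using I
    by (subst sum.Sigma[symmetric]) (auto simp: sum_distrib_right intro!: sum.cong)
  also have "\<dots> = (\<Sum>(S, i)\<in>Sigma (Pow I) (\<lambda>S. S). f S * (a i * gen_sign i S * m (S - {i})))"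
    by (rule sum.reindex_bij_witness[where j = "\<lambda>(S, i). (insert i S, i)"
          and i = "\<lambda>(S, i). (S - {i}, i)"]) (auto simp: insert_absorb)
  also have "\<dots> = pairing I f (wedge I a m)"
  proof -
    have "\<forall>S\<in>Pow I. finite S" using I finite_subset by blast
    then show ?thesis unfolding pairing_def wedge_def using I
      by (subst sum.Sigma[symmetric]) (simp_all add: sum_distrib_left)
  qed
  finally show ?thesis .
qed

lemma ext_space_eqI:
  assumes "finite I" "x \<in> ext_space I" "y \<in> ext_space I" "\<And>f. f \<in> ext_space I \<Longrightarrow> pairing I f x = pairing I f y"
  shows "x = y"
proof
  fix S show "x S = y S"
  proof (cases "S \<subseteq> I")
    case True
    then have "ext_mono S \<in> ext_space I" by (simp add: ext_space_iff ext_mono_def)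
    then have "pairing I (ext_mono S) x = pairing I (ext_mono S) y" by (rule assms(4))
    then show ?thesis
      unfolding pairing_commute[of I "ext_mono S"] pairing_mono[OF assms(1) True] .
  next
    case False
    then have "x S = 0" "y S = 0" using assms(2,3) unfolding ext_space_iff by blast+
    then show ?thesis by simp
  qed
qed

lemma wedge_wedge: "finite I \<Longrightarrow> wedge I a (wedge I a f) = 0"
  by (rule ext_space_eqI[of I])
    (simp_all add: contract_contract pairing_contract[symmetric] ext.subspace_0[OF subspace_ext_space])

text \<open>The terms that remove the generator just multiplied by add up to \<open>\<Sum>i\<in>I. a i * b i\<close>; in the
  others the two operations anticommute. If the sum is 1, contraction by \<open>a\<close> is a contracting
  homotopy for multiplication by \<open>b\<close>, and conversely.\<close>

lemma contract_wedge:
  fixes a b :: "'i::linorder \<Rightarrow> 'k::field"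
  assumes I: "finite I" and f: "f \<in> ext_space I"
  shows "contract I a (wedge I b f) = ext_scale (\<Sum>i\<in>I. a i * b i) f - wedge I b (contract I a f)"
proof
  fix S
  show "contract I a (wedge I b f) S = (ext_scale (\<Sum>i\<in>I. a i * b i) f - wedge I b (contract I a f)) S"
  proof (cases "S \<subseteq> I")
    case True
    have finS: "finite S" using I True finite_subset by blast
    define d where "d i j = a i * b j * (gen_sign i S * gen_sign j (insert i S)) * f (insert i S - {j})" for i j
    have "contract I a (wedge I b f) S = (\<Sum>i\<in>I - S. a i * gen_sign i S *
        (\<Sum>j\<in>insert i S. b j * gen_sign j (insert i S) * f (insert i S - {j})))"
      using True by (simp add: contract_def wedge_def)
    also have "\<dots> = (\<Sum>i\<in>I - S. a i * b i * f S + (\<Sum>j\<in>S. d i j))"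
    proof (rule sum.cong[OF refl])
      fix i assume i: "i \<in> I - S"
      have "a i * gen_sign i S * (b i * gen_sign i S * f S) = a i * b i * f S * (gen_sign i S * gen_sign i S)"
        by (simp only: mult_ac)
      then show "a i * gen_sign i S * (\<Sum>j\<in>insert i S. b j * gen_sign j (insert i S) * f (insert i S - {j}))
         = a i * b i * f S + (\<Sum>j\<in>S. d i j)"
        using i finS by (simp add: distrib_left sum_distrib_left d_def mult_ac)
    qed
    finally have L: "contract I a (wedge I b f) S =
        (\<Sum>i\<in>I - S. a i * b i * f S) + (\<Sum>i\<in>I - S. \<Sum>j\<in>S. d i j)" by (simp add: sum.distrib)
    have "wedge I b (contract I a f) S = (\<Sum>j\<in>S. b j * gen_sign j S *
        (\<Sum>i\<in>I - (S - {j}). a i * gen_sign i (S - {j}) * f (insert i (S - {j}))))"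
      using True by (auto simp: contract_def wedge_def intro!: sum.cong)
    also have "\<dots> = (\<Sum>j\<in>S. a j * b j * f S - (\<Sum>i\<in>I - S. d i j))"
    proof (rule sum.cong[OF refl])
      fix j assume j: "j \<in> S"
      have "I - (S - {j}) = insert j (I - S)" using j True by auto
      moreover have "j \<notin> I - S" using j by simp
      ultimately have "(\<Sum>i\<in>I - (S - {j}). a i * gen_sign i (S - {j}) * f (insert i (S - {j})))
        = a j * gen_sign j S * f S + (\<Sum>i\<in>I - S. a i * gen_sign i (S - {j}) * f (insert i (S - {j})))"
        using I j by (simp add: insert_absorb)
      moreover have "b j * gen_sign j S * (a j * gen_sign j S * f S) = a j * b j * f S * (gen_sign j S * gen_sign j S)"
        by (simp only: mult_ac)
      moreover have "b j * gen_sign j S * (\<Sum>i\<in>I - S. a i * gen_sign i (S - {j}) * f (insert i (S - {j})))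
          = (\<Sum>i\<in>I - S. - d i j)"
        unfolding sum_distrib_left
      proof (rule sum.cong[OF refl])
        fix i assume i: "i \<in> I - S"
        then have "insert i S - {j} = insert i (S - {j})" using j by auto
        then show "b j * gen_sign j S * (a i * gen_sign i (S - {j}) * f (insert i (S - {j}))) = - d i j"
          using gen_sign_swap'[OF finS j, of i, where 'k = 'k] i
          by (simp add: d_def mult_ac)
      qed
      ultimately show "b j * gen_sign j S * (\<Sum>i\<in>I - (S - {j}). a i * gen_sign i (S - {j}) * f (insert i (S - {j})))
         = a j * b j * f S - (\<Sum>i\<in>I - S. d i j)"
        by (simp only: distrib_left sum_negf diff_conv_add_uminus gen_sign_square mult_1_right)
    qed
    also have "\<dots> = (\<Sum>j\<in>S. a j * b j * f S) - (\<Sum>i\<in>I - S. \<Sum>j\<in>S. d i j)"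
      unfolding sum_subtractf by (rule arg_cong[OF sum.swap])
    finally have R: "wedge I b (contract I a f) S = \<dots>" .
    have "(\<Sum>i\<in>I. a i * b i) * f S = (\<Sum>i\<in>I - S. a i * b i * f S) + (\<Sum>j\<in>S. a j * b j * f S)"
      unfolding sum_distrib_right by (rule sum.subset_diff[OF True I])
    moreover have "(ext_scale (\<Sum>i\<in>I. a i * b i) f - wedge I b (contract I a f)) S
        = (\<Sum>i\<in>I. a i * b i) * f S - wedge I b (contract I a f) S"
      by (simp only: ext_scale_def fun_diff_def)
    ultimately show ?thesis unfolding L R by simp
  next
    case False
    then have "f S = 0" using f unfolding ext_space_iff by blast
    then show ?thesis using False by (simp add: contract_def wedge_def ext_scale_def)
  qed
qed

section \<open>The dual of the Orlik--Solomon algebra\<close>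

context rank_matroid
begin

lemma dependent_superset:
  assumes "r S < card S" "S \<subseteq> T" "T \<subseteq> E" shows "r T < card T"
  using independent_subset[OF _ assms(2,3)] rank_le_card[OF assms(3)] assms(1) by linarith

lemma rank_Un_eq:
  assumes "S \<subseteq> E" "X \<subseteq> E" "\<And>x. x \<in> X \<Longrightarrow> r (insert x S) = r S"
  shows "r (S \<union> X) = r S"
proof -
  have "finite X" using assms finite_ground finite_subset by blast
  then show ?thesis using assms(2,3)
  proof (induction X)
    case (insert x X)
    have "r (insert x (S \<union> X)) = r (S \<union> X)"
      using insert.prems assms(1) by (intro rank_insert_eq_mono[of S "S \<union> X"]) auto
    then show ?case using insert by simp
  qed simp
qed

definition mclosure :: "'a set \<Rightarrow> 'a set" where
  "mclosure S = {x \<in> E. r (insert x S) = r S}"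

lemma mclosure_superset: "S \<subseteq> E \<Longrightarrow> S \<subseteq> mclosure S"
  by (auto simp: mclosure_def insert_absorb)

lemma mclosure_subset: "mclosure S \<subseteq> E"
  by (auto simp: mclosure_def)

lemma rank_mclosure:
  assumes "S \<subseteq> E" shows "r (mclosure S) = r S"
proof -
  have "r (S \<union> mclosure S) = r S"
    by (rule rank_Un_eq[OF assms mclosure_subset]) (simp add: mclosure_def)
  then show ?thesis using mclosure_superset[OF assms] by (simp add: Un_absorb1)
qed

lemma mclosure_eq:
  assumes "S \<subseteq> T" "T \<subseteq> E" "r S = r T" shows "mclosure S = mclosure T"
proof -
  have "r (insert x S) = r S \<longleftrightarrow> r (insert x T) = r T" if x: "x \<in> E" for x
  proof
    show "r (insert x S) = r S \<Longrightarrow> r (insert x T) = r T"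
      using rank_insert_eq_mono[of S T x] assms x by blast
    have "r (insert x S) \<le> r (insert x T)" "r S \<le> r (insert x S)"
      using assms x rank_mono[of "insert x S" "insert x T"] rank_mono[of S "insert x S"] by auto
    then show "r (insert x T) = r T \<Longrightarrow> r (insert x S) = r S" using assms by simp
  qed
  then show ?thesis by (auto simp: mclosure_def)
qed

end

text \<open>The simplicial coboundary \<open>S \<mapsto> \<Sum>i\<in>S. \<plusminus> f (S - {i})\<close>, up to sign the transpose of \<open>\<partial>\<close>.\<close>

abbreviation coboundary :: "'i::linorder set \<Rightarrow> ('i set \<Rightarrow> 'k::field) \<Rightarrow> ('i set \<Rightarrow> 'k)" where
  "coboundary I \<equiv> wedge I (\<lambda>_. 1)"

lemma coboundary_cong:
  assumes "S \<subseteq> I" "S \<subseteq> J" "\<And>j. j \<in> S \<Longrightarrow> f (S - {j}) = g (S - {j})"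
  shows "coboundary I f S = coboundary J g S"
  using assms by (simp add: wedge_def)

lemma coboundary_eq_0:
  assumes "\<And>j. j \<in> S \<Longrightarrow> f (S - {j}) = 0"
  shows "coboundary I f S = 0"
  using assms by (simp add: wedge_def)

text \<open>The linear forms that vanish on \<open>e\<^sub>S\<close> and \<open>\<partial> e\<^sub>S\<close> for all dependent \<open>S\<close>: the dual of the
  Orlik--Solomon algebra of a central arrangement with this matroid.\<close>

definition os_dual :: "'i::linorder set \<Rightarrow> ('i set \<Rightarrow> nat) \<Rightarrow> ('i set \<Rightarrow> 'k::field) set" where
  "os_dual I r = {f \<in> ext_space I. \<forall>S\<subseteq>I. r S < card S \<longrightarrow> f S = 0 \<and> coboundary I f S = 0}"

lemma os_dualD:
  assumes "f \<in> os_dual I r"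
  shows "f \<in> ext_space I" "\<And>S. f S \<noteq> 0 \<Longrightarrow> S \<subseteq> I"
    "\<And>S. S \<subseteq> I \<Longrightarrow> r S < card S \<Longrightarrow> f S = 0"
    "\<And>S. S \<subseteq> I \<Longrightarrow> r S < card S \<Longrightarrow> coboundary I f S = 0"
  using assms unfolding os_dual_def ext_space_iff by blast+

lemma os_dualI:
  assumes "\<And>S. \<not> S \<subseteq> I \<Longrightarrow> f S = 0" "\<And>S. S \<subseteq> I \<Longrightarrow> r S < card S \<Longrightarrow> f S = 0"
    "\<And>S. S \<subseteq> I \<Longrightarrow> r S < card S \<Longrightarrow> coboundary I f S = 0"
  shows "f \<in> os_dual I r"
  using assms unfolding os_dual_def ext_space_iff by blast

text \<open>Contraction is transposed to multiplication by a linear form, and the span of the \<open>e\<^sub>S\<close> and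
  \<open>\<partial> e\<^sub>S\<close> for dependent \<open>S\<close> is closed under it because \<open>\<partial>\<close> is an antiderivation and dependence passes to supersets.\<close>

lemma contract_os_dual:
  assumes M: "rank_matroid I r" and f: "f \<in> os_dual I r"
  shows "contract I a f \<in> os_dual I r"
proof -
  interpret rank_matroid I r by (rule M)
  have van: "contract I a g S = 0"
    if "\<And>S. S \<subseteq> I \<Longrightarrow> r S < card S \<Longrightarrow> g S = 0" "S \<subseteq> I" "r S < card S" for g S
  proof -
    have "g (insert i S) = 0" if "i \<in> I - S" for i
      using dependent_superset[of S "insert i S"] \<open>S \<subseteq> I\<close> \<open>r S < card S\<close> that
      by (intro \<open>\<And>S. S \<subseteq> I \<Longrightarrow> r S < card S \<Longrightarrow> g S = 0\<close>) auto
    then show ?thesis by (simp add: contract_def)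
  qed
  have eq: "coboundary I (contract I a f)
      = ext_scale (\<Sum>i\<in>I. a i * 1) f - contract I a (coboundary I f)"
    using contract_wedge[OF finite_ground os_dualD(1)[OF f], of a "\<lambda>_. 1"] by simp
  have "contract I a f S = 0 \<and> coboundary I (contract I a f) S = 0" if "S \<subseteq> I" "r S < card S" for S
    using van[OF os_dualD(3)[OF f] that] van[OF os_dualD(4)[OF f] that] os_dualD(3)[OF f that]
    unfolding eq by (simp add: ext_scale_def)
  then show ?thesis by (simp add: os_dual_def)
qed

lemma coboundary_os_dual:
  assumes "finite I" "f \<in> os_dual I r"
  shows "coboundary I f \<in> os_dual I r"
  using os_dualD(4)[OF assms(2)] by (simp add: os_dual_def wedge_wedge[OF assms(1)])

lemma os_dual_restrict:
  assumes f: "f \<in> os_dual I r" and X: "X \<subseteq> I"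
  shows "(\<lambda>S. if S \<subseteq> X then f S else 0) \<in> os_dual X r" (is "?g \<in> _")
proof -
  have "coboundary X ?g S = coboundary I f S" if "S \<subseteq> X" for S
    using that X by (intro coboundary_cong) auto
  then show ?thesis using os_dualD(3,4)[OF f] X by (intro os_dualI) auto
qed

text \<open>Induction on the degree. On a set \<open>X\<close> of rank at most \<open>p + 1\<close> a homogeneous \<open>f\<close> of degree
  \<open>p + 1\<close> is a cocycle of the full simplex on \<open>X - {i}\<close>, thus the coboundary of some \<open>h\<close> of degree
  \<open>p\<close>, which again lies in the dual. The coboundary of an extension of \<open>h\<close> extends \<open>f\<close> on \<open>X\<close>.

  These local extensions are glued over the flats \<open>X\<close> of rank \<open>p + 1\<close>. Nothing has to match: the
  value at an independent set of \<open>p + 1\<close> elements is taken from the flat that it spans, and a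
  coboundary condition that is not void involves the bases of a single flat.

  In degree 0 the assumption that \<open>i\<close> is not a loop is needed, as \<open>f {}\<close> is the coboundary of \<open>f\<close>
  at \<open>{i}\<close>.\<close>

lemma os_dual_extend_homogeneous:
  fixes f :: "'i::linorder set \<Rightarrow> 'k::field"
  assumes "rank_matroid I r" "i \<in> I" "r {i} = 1" "f \<in> os_dual (I - {i}) r"
    and "\<And>S. f S \<noteq> 0 \<Longrightarrow> card S = p"
  shows "\<exists>f'\<in>os_dual I r. (\<forall>S. f' S \<noteq> 0 \<longrightarrow> card S = p) \<and> (\<forall>S\<subseteq>I - {i}. f' S = f S)"
  using assms
proof (induction p arbitrary: I f)
  case 0
  interpret rank_matroid I r by (rule 0)
  have sub: "S \<subseteq> I - {i}" if "f S \<noteq> 0" for S using os_dualD(2)[OF 0(4)] that by blast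
  have "f S = 0 \<and> coboundary I f S = 0" if S: "S \<subseteq> I" "r S < card S" for S
  proof (cases "i \<in> S")
    case False
    then have "S \<subseteq> I - {i}" using S by auto
    moreover have "coboundary I f S = coboundary (I - {i}) f S"
      using S \<open>S \<subseteq> I - {i}\<close> by (intro coboundary_cong) auto
    ultimately show ?thesis using os_dualD(3,4)[OF 0(4), of S] S by simp
  next
    case True
    have "f (S - {j}) = 0" if "j \<in> S" for j
    proof (rule ccontr)
      assume "f (S - {j}) \<noteq> 0"
      then have "card (S - {j}) = 0" using 0(5) by blast
      moreover have "finite S" using S finite_ground finite_subset by blast
      ultimately have "card S = 1" using card_Suc_Diff1[of S j] that by (simp only: One_nat_def)
      then obtain x where "S = {x}" by (rule card_1_singletonE)
      then have "S = {i}" using True by simp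
      then show False using S 0(3) by simp
    qed
    then show ?thesis using sub True coboundary_eq_0[of S f I] by blast
  qed
  moreover have "f S = 0" if "\<not> S \<subseteq> I" for S using sub that by blast
  ultimately have "f \<in> os_dual I r" by (intro os_dualI) blast+
  then show ?case using 0(5) by blast
next
  case (Suc p)
  interpret rank_matroid I r by (rule Suc)
  note f = Suc.prems(4) and hom = Suc.prems(5)
  \<comment> \<open>The extension over a set of rank at most \<open>p + 1\<close>.\<close>
  have loc: "\<exists>g\<in>os_dual X r. \<forall>S\<subseteq>X - {i}. g S = f S"
    if X: "X \<subseteq> I" and rX: "r X \<le> Suc p" for X
  proof -
    have finX: "finite X" using X finite_ground finite_subset by blast
    interpret X: rank_matroid X r by (rule rank_restrict[OF X])
    define g where "g = (\<lambda>S. if S \<subseteq> X - {i} then f S else 0)"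
    have g: "g \<in> os_dual (X - {i}) r" unfolding g_def using f X by (intro os_dual_restrict) auto
    have ghom: "card S = Suc p" if "g S \<noteq> 0" for S using that hom by (auto simp: g_def split: if_splits)
    show ?thesis
    proof (cases "i \<in> X \<and> X \<noteq> {i}")
      case False
      show ?thesis
      proof (cases "i \<in> X")
        case True
        then have "X = {i}" using False by auto
        have "f {} = 0" using hom[of "{}"] by auto
        moreover have "0 \<in> os_dual X r" by (simp add: os_dual_def ext_space_iff)
        ultimately show ?thesis using \<open>X = {i}\<close> by (intro bexI[of _ 0]) auto
      next
        case iX: False
        then have "X - {i} = X" by auto
        then show ?thesis using g ghom by (intro bexI[of _ g]) (auto simp: g_def)
      qed
    next
      case True
      then obtain z where z: "z \<in> X" "z \<noteq> i" by auto
      define \<epsilon> where "\<epsilon> = (\<lambda>j. if j = z then 1 else 0 :: 'k)"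
      \<comment> \<open>Contraction at a vertex \<open>z\<close> is the cone construction, a contracting homotopy for the
        coboundary.\<close>
      define h where "h = contract (X - {i}) \<epsilon> g"
      have "r S \<le> Suc p" if "S \<subseteq> X - {i}" for S
        using X.rank_mono[of S X] that rX by fastforce
      \<comment> \<open>All subsets of \<open>X\<close> with \<open>p + 2\<close> elements are dependent, so the cocycle condition is part of
        the definition of the dual.\<close>
      then have cg: "coboundary (X - {i}) g = 0"
      proof (intro ext)
        fix S
        show "coboundary (X - {i}) g S = 0 S"
        proof (cases "S \<subseteq> X - {i}")
          case S: True
          then have "finite S" using finX finite_subset by blast
          show ?thesis
          proof (cases "card S = Suc (Suc p)")
            case True
            then show ?thesis
              using os_dualD(4)[OF g S] \<open>\<And>S. S \<subseteq> X - {i} \<Longrightarrow> r S \<le> Suc p\<close>[OF S] by simp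
          next
            case False
            then have "g (S - {j}) = 0" if "j \<in> S" for j
              using ghom[of "S - {j}"] \<open>finite S\<close> that card_Suc_Diff1[of S j] by force
            then show ?thesis using coboundary_eq_0[of S g "X - {i}"] by simp
          qed
        qed (simp add: wedge_def)
      qed
      have "(\<Sum>j\<in>X - {i}. \<epsilon> j * 1) = 1" using z finX by (simp add: \<epsilon>_def)
      then have ch: "coboundary (X - {i}) h = g"
        using contract_wedge[of "X - {i}" g \<epsilon> "\<lambda>_. 1"] finX os_dualD(1)[OF g]
        unfolding cg h_def by (simp add: ext_scale_def)
      have h: "h \<in> os_dual (X - {i}) r"
        unfolding h_def using g X.rank_restrict by (intro contract_os_dual) auto
      have hhom: "card S = p" if "h S \<noteq> 0" for S
      proof -
        have "S \<subseteq> X - {i}" using that by (simp add: h_def contract_def split: if_splits)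
        then have "finite S" using finX finite_subset by blast
        have "\<exists>j\<in>X - {i} - S. g (insert j S) \<noteq> 0"
        proof (rule ccontr)
          assume "\<not> ?thesis"
          then have "\<forall>j\<in>X - {i} - S. g (insert j S) = 0" by blast
          then have "h S = 0" by (simp add: h_def contract_def)
          then show False using that by simp
        qed
        then obtain j where j: "j \<in> X - {i} - S" "g (insert j S) \<noteq> 0" by blast
        then have "card (insert j S) = Suc p" by (intro ghom)
        then show ?thesis using j \<open>finite S\<close> by simp
      qed
      obtain h' where h': "h' \<in> os_dual X r" "\<And>S. h' S \<noteq> 0 \<Longrightarrow> card S = p"
          "\<And>S. S \<subseteq> X - {i} \<Longrightarrow> h' S = h S"
        using Suc.IH[OF X.rank_matroid_axioms _ Suc.prems(3) h hhom] True by blast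
      show ?thesis
      proof (intro bexI allI impI)
        show "coboundary X h' \<in> os_dual X r" by (rule coboundary_os_dual[OF finX h'(1)])
        fix S
        assume S: "S \<subseteq> X - {i}"
        have "coboundary X h' S = coboundary (X - {i}) h S"
          using S by (intro coboundary_cong h'(3)) auto
        then show "coboundary X h' S = f S" using ch S by (simp add: g_def)
      qed
    qed
  qed
  define F where "F X = (SOME g. g \<in> os_dual X r \<and> (\<forall>S\<subseteq>X - {i}. g S = f S))" for X
  have "F X \<in> os_dual X r \<and> (\<forall>S\<subseteq>X - {i}. F X S = f S)" if "X \<subseteq> I" "r X \<le> Suc p" for X
    unfolding F_def by (rule someI_ex[OF loc[OF that, unfolded Bex_def]])
  then have F: "\<And>X. X \<subseteq> I \<Longrightarrow> r X \<le> Suc p \<Longrightarrow> F X \<in> os_dual X r"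
      "\<And>X S. X \<subseteq> I \<Longrightarrow> r X \<le> Suc p \<Longrightarrow> S \<subseteq> X - {i} \<Longrightarrow> F X S = f S"
    by blast+
  \<comment> \<open>The value at an independent set is taken from the flat that it spans.\<close>
  define f' where "f' = (\<lambda>S. if S \<subseteq> I \<and> card S = Suc p \<and> r S = Suc p then F (mclosure S) S else 0)"
  have "coboundary I f' S = 0" if S: "S \<subseteq> I" "r S < card S" for S
  proof -
    have finS: "finite S" using S finite_ground finite_subset by blast
    show ?thesis
    proof (cases "card S = Suc (Suc p) \<and> r S = Suc p")
      case False
      have "f' (S - {j}) = 0" if "j \<in> S" for j
      proof -
        have "r (S - {j}) \<le> r S" using S by (intro rank_mono) auto
        then show ?thesis using False S finS that
          by (auto simp: f'_def card_Diff_singleton_if)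
      qed
      then show ?thesis by (rule coboundary_eq_0)
    next
      case True
      define X where "X = mclosure S"
      have X: "X \<subseteq> I" "r X \<le> Suc p" "S \<subseteq> X"
        using True S mclosure_superset mclosure_subset rank_mclosure by (auto simp: X_def)
      have "coboundary I f' S = coboundary X (F X) S"
      proof (rule coboundary_cong[OF S(1) X(3)])
        fix j assume j: "j \<in> S"
        have card: "card (S - {j}) = Suc p" using True finS j by simp
        \<comment> \<open>An independent facet of \<open>S\<close> spans the same flat as \<open>S\<close>; at the dependent facets both
          functions vanish.\<close>
        show "f' (S - {j}) = F X (S - {j})"
        proof (cases "r (S - {j}) = Suc p")
          case r: True
          then have "mclosure (S - {j}) = X"
            unfolding X_def using S True by (intro mclosure_eq) auto
          then show ?thesis using r card S by (auto simp: f'_def)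
        next
          case False
          moreover have "r (S - {j}) \<le> card (S - {j})" using S by (intro rank_le_card) auto
          ultimately have "F X (S - {j}) = 0"
            using card X by (intro os_dualD(3)[OF F(1)]) auto
          then show ?thesis using False by (simp add: f'_def)
        qed
      qed
      also have "\<dots> = 0" using X True by (intro os_dualD(4)[OF F(1)]) auto
      finally show ?thesis .
    qed
  qed
  moreover have "f' S = 0" if "r S < card S" for S using that by (auto simp: f'_def)
  moreover have "f' S = 0" if "\<not> S \<subseteq> I" for S using that by (simp add: f'_def)
  ultimately have "f' \<in> os_dual I r" by (intro os_dualI)
  moreover have "f' S = f S" if S: "S \<subseteq> I - {i}" for S
  proof (cases "card S = Suc p \<and> r S = Suc p")
    case True
    have S': "S \<subseteq> I" using S by auto
    have "S \<subseteq> mclosure S - {i}" using S mclosure_superset[of S] by blast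
    then have "F (mclosure S) S = f S"
      using True S' mclosure_subset rank_mclosure[OF S'] by (intro F(2)) auto
    then show ?thesis using True S by (auto simp: f'_def)
  next
    case False
    have "f S = 0"
    proof (rule ccontr)
      assume "f S \<noteq> 0"
      moreover from this have "card S = Suc p" by (rule hom)
      moreover have "r S \<le> card S" using S by (intro rank_le_card) auto
      ultimately show False using os_dualD(3)[OF f S] False by auto
    qed
    then show ?thesis using False by (auto simp: f'_def)
  qed
  moreover have "f' S \<noteq> 0 \<Longrightarrow> card S = Suc p" for S by (auto simp: f'_def split: if_splits)
  ultimately show ?case by blast
qed

text \<open>The version for affine arrangements: \<open>None\<close> is the hyperplane at infinity in the cone matroid
  \<open>r\<close>, and \<open>S\<close> is dependent together with \<open>None\<close> iff its hyperplanes are dependent or have empty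
  intersection.\<close>

definition affine_dual :: "'i::linorder set \<Rightarrow> ('i option set \<Rightarrow> nat) \<Rightarrow> ('i set \<Rightarrow> 'k::field) set" where
  "affine_dual I r = {f \<in> ext_space I. \<forall>S\<subseteq>I.
     (r (insert None (Some ` S)) \<le> card S \<longrightarrow> f S = 0) \<and>
     (r (Some ` S) < card S \<longrightarrow> coboundary I f S = 0)}"

abbreviation cone_ground :: "'i set \<Rightarrow> 'i option set" where
  "cone_ground I \<equiv> insert None (Some ` I)"

lemma affine_dualD:
  assumes "f \<in> affine_dual I r"
  shows "f \<in> ext_space I" "\<And>S. \<not> S \<subseteq> I \<Longrightarrow> f S = 0"
    "\<And>S. S \<subseteq> I \<Longrightarrow> r (insert None (Some ` S)) \<le> card S \<Longrightarrow> f S = 0"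
    "\<And>S. S \<subseteq> I \<Longrightarrow> r (Some ` S) < card S \<Longrightarrow> coboundary I f S = 0"
  using assms unfolding affine_dual_def ext_space_iff by blast+

lemma affine_dualI:
  assumes "\<And>S. \<not> S \<subseteq> I \<Longrightarrow> f S = 0"
    "\<And>S. S \<subseteq> I \<Longrightarrow> r (insert None (Some ` S)) \<le> card S \<Longrightarrow> f S = 0"
    "\<And>S. S \<subseteq> I \<Longrightarrow> r (Some ` S) < card S \<Longrightarrow> coboundary I f S = 0"
  shows "f \<in> affine_dual I r"
  using assms unfolding affine_dual_def ext_space_iff by blast

lemma subspace_affine_dual: "ext.subspace (affine_dual I r)"
  unfolding subspace_ext_iff
proof (intro conjI ballI allI)
  show "0 \<in> affine_dual I r" by (rule affine_dualI) auto
  fix x assume x: "x \<in> affine_dual I r"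
  show "x + y \<in> affine_dual I r" if "y \<in> affine_dual I r" for y
    using affine_dualD(2-4)[OF x] affine_dualD(2-4)[OF that] by (intro affine_dualI) (auto simp: wedge_add)
  show "ext_scale c x \<in> affine_dual I r" for c
  proof (rule affine_dualI)
    show "coboundary I (ext_scale c x) S = 0" if "S \<subseteq> I" "r (Some ` S) < card S" for S
      unfolding wedge_scale using affine_dualD(4)[OF x that] by (simp add: ext_scale_def)
  qed (use affine_dualD(2,3)[OF x] in \<open>simp_all add: ext_scale_def\<close>)
qed

lemma affine_dual_cong:
  assumes "\<And>T. T \<subseteq> cone_ground I \<Longrightarrow> r T = r' T"
  shows "affine_dual I r = affine_dual I r'"
proof -
  have "r (insert None (Some ` S)) = r' (insert None (Some ` S))" "r (Some ` S) = r' (Some ` S)"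
    if "S \<subseteq> I" for S
    using that by (auto intro!: assms)
  then show ?thesis unfolding affine_dual_def by auto
qed

lemma finite_cone_ground:
  assumes "rank_matroid (cone_ground I) r" shows "finite I"
  using rank_matroid.finite_ground[OF assms] by (auto dest: finite_imageD)

lemma rank_matroid_Some:
  assumes "rank_matroid (cone_ground I) r"
  shows "rank_matroid I (\<lambda>S. r (Some ` S))"
proof -
  interpret rank_matroid "cone_ground I" r by (rule assms)
  show ?thesis
  proof
    show "finite I" by (rule finite_cone_ground[OF assms])
    show "r (Some ` {}) = 0" by (simp add: rank_empty)
    show "r (Some ` insert x S) = r (Some ` S) \<or> r (Some ` insert x S) = Suc (r (Some ` S))"
      if "S \<subseteq> I" "x \<in> I" for S x
      unfolding image_insert using that by (intro rank_insert) auto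
    show "r (Some ` insert x T) = r (Some ` T)"
      if "S \<subseteq> T" "T \<subseteq> I" "x \<in> I" "r (Some ` insert x S) = r (Some ` S)" for S T x
      using that rank_insert_eq_mono[of "Some ` S" "Some ` T" "Some x"] unfolding image_insert by blast
  qed
qed

lemma card_Some_image [simp]: "card (Some ` S) = card S"
  by (simp add: card_image)

lemma cone_rank_cases:
  assumes "rank_matroid (cone_ground I) r" "S \<subseteq> I"
  shows "r (insert None (Some ` S)) = r (Some ` S) \<or> r (insert None (Some ` S)) = Suc (r (Some ` S))"
    and "r (Some ` S) \<le> card S"
proof -
  interpret rank_matroid "cone_ground I" r by (rule assms)
  have sub: "Some ` S \<subseteq> cone_ground I" using assms(2) by auto
  show "r (insert None (Some ` S)) = r (Some ` S) \<or> r (insert None (Some ` S)) = Suc (r (Some ` S))"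
    by (rule rank_insert[OF sub]) simp
  show "r (Some ` S) \<le> card S" using rank_le_card[OF sub] by simp
qed

lemma affine_dual_subset_os_dual:
  assumes M: "rank_matroid (cone_ground I) r" and f: "f \<in> affine_dual I r"
  shows "f \<in> os_dual I (\<lambda>S. r (Some ` S))"
proof (rule os_dualI)
  fix S assume S: "S \<subseteq> I" "r (Some ` S) < card S"
  then have "r (insert None (Some ` S)) \<le> card S" using cone_rank_cases(1)[OF M S(1)] by linarith
  then show "f S = 0" by (rule affine_dualD(3)[OF f S(1)])
  show "coboundary I f S = 0" by (rule affine_dualD(4)[OF f S])
qed (rule affine_dualD(2)[OF f])

text \<open>The conditions on \<open>f\<close> relate only values in the same degree.\<close>

lemma affine_dual_project:
  assumes I: "finite I" and f: "f \<in> affine_dual I r"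
  shows "(\<lambda>S. if P (card S) then f S else 0) \<in> affine_dual I r" (is "?g \<in> _")
proof (rule affine_dualI)
  fix S assume S: "S \<subseteq> I" "r (Some ` S) < card S"
  have fin: "finite S" using S I finite_subset by blast
  show "coboundary I ?g S = 0"
  proof (cases "P (card S - 1)")
    case True
    have "coboundary I ?g S = coboundary I f S"
      using fin True S(1) by (intro coboundary_cong) simp_all
    then show ?thesis using affine_dualD(4)[OF f S] by simp
  next
    case False
    then show ?thesis using fin by (intro coboundary_eq_0) simp
  qed
qed (use affine_dualD(2,3)[OF f] in auto)

text \<open>The homogeneous components are extended in \<^const>\<open>os_dual\<close>, and then the values at the sets
  that are dependent together with \<open>None\<close> are replaced by 0. The coboundary conditions survive: a
  condition that is not void is at a set whose rank is one less than its cardinality, all its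
  independent facets span the same flat, and so \<open>None\<close> lies in the closure of all of them or of
  none.\<close>

lemma affine_dual_extend:
  fixes f :: "'i::linorder set \<Rightarrow> 'k::field"
  assumes M: "rank_matroid (cone_ground I) r" and i: "i \<in> I" "r {Some i} = 1"
    and f: "f \<in> affine_dual (I - {i}) r"
  obtains f' where "f' \<in> affine_dual I r" "\<And>S. S \<subseteq> I - {i} \<Longrightarrow> f' S = f S"
proof -
  interpret cone: rank_matroid "cone_ground I" r by (rule M)
  let ?r0 = "\<lambda>S. r (Some ` S)" and ?r1 = "\<lambda>S. r (insert None (Some ` S))"
  interpret rank_matroid I ?r0 by (rule rank_matroid_Some[OF M])
  have finI: "finite I" by (rule finite_ground)
  have M': "rank_matroid (cone_ground (I - {i})) r" by (rule cone.rank_restrict) auto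
  have "\<exists>g\<in>os_dual I ?r0. \<forall>S\<subseteq>I - {i}. g S = (if card S = p then f S else 0)" for p
  proof -
    have "(\<lambda>S. if card S = p then f S else 0) \<in> os_dual (I - {i}) ?r0"
      using finI f by (intro affine_dual_subset_os_dual[OF M'] affine_dual_project) auto
    moreover have "?r0 {i} = 1" using i by simp
    moreover have "card S = p" if "(if card S = p then f S else 0) \<noteq> 0" for S
      using that by (simp split: if_splits)
    ultimately show ?thesis
      using os_dual_extend_homogeneous[OF rank_matroid_axioms i(1),
          of "\<lambda>S. if card S = p then f S else 0" p] by blast
  qed
  then have "\<forall>p. \<exists>g. g \<in> os_dual I ?r0 \<and> (\<forall>S\<subseteq>I - {i}. g S = (if card S = p then f S else 0))"
    by blast
  then have "\<exists>G. \<forall>p. G p \<in> os_dual I ?r0 \<and> (\<forall>S\<subseteq>I - {i}. G p S = (if card S = p then f S else 0))"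
    by (rule choice)
  then obtain G where
    "\<forall>p. G p \<in> os_dual I ?r0 \<and> (\<forall>S\<subseteq>I - {i}. G p S = (if card S = p then f S else 0))" ..
  then have G: "\<And>p. G p \<in> os_dual I ?r0"
      "\<And>p S. S \<subseteq> I - {i} \<Longrightarrow> G p S = (if card S = p then f S else 0)"
    by simp_all
  define f' where "f' = (\<lambda>S. if S \<subseteq> I \<and> ?r1 S = Suc (card S) then G (card S) S else 0)"
  have small: "f' S = 0" if "S \<subseteq> I" "?r0 S < card S" for S
    using cone_rank_cases(1)[OF M that(1)] that(2) by (auto simp: f'_def)
  have "f' \<in> affine_dual I r"
  proof (rule affine_dualI)
    fix S assume S: "S \<subseteq> I" "?r0 S < card S"
    have fin: "finite S" using S finI finite_subset by blast
    define p where "p = card S - 1"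
    have card: "card (S - {j}) = p" if "j \<in> S" for j using fin that by (simp add: p_def)
    have r0le: "?r0 (S - {j}) \<le> ?r0 S" for j using S by (intro rank_mono) auto
    \<comment> \<open>Either all facets have value 0 under \<open>f'\<close>, or \<open>f'\<close> agrees on them with the component of
      degree \<open>p\<close>.\<close>
    show "coboundary I f' S = 0"
    proof (cases "?r1 S = Suc p \<and> ?r0 S = p")
      case False
      have "f' (S - {j}) = 0" if j: "j \<in> S" for j
      proof (rule ccontr)
        assume neg: "f' (S - {j}) \<noteq> 0"
        then have "?r1 (S - {j}) = Suc (card (S - {j}))" unfolding f'_def by argo
        then have r1: "?r1 (S - {j}) = Suc p" unfolding card[OF j] .
        have subj: "S - {j} \<subseteq> I" using S by auto
        have "\<not> ?r0 (S - {j}) < card (S - {j})"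
        proof
          assume "?r0 (S - {j}) < card (S - {j})"
          from small[OF subj this] neg show False by simp
        qed
        then have "?r0 (S - {j}) = p" using cone_rank_cases(2)[OF M subj] card[OF j] by linarith
        moreover have "?r1 (S - {j}) \<le> ?r1 S" using S by (intro cone.rank_mono) auto
        ultimately show False
          using False r1 r0le[of j] S(2) cone_rank_cases(1)[OF M S(1)] by (auto simp: p_def)
      qed
      then show ?thesis by (rule coboundary_eq_0)
    next
      case True
      have "coboundary I f' S = coboundary I (G p) S"
      proof (rule coboundary_cong[OF S(1) S(1)])
        fix j assume j: "j \<in> S"
        have subj: "S - {j} \<subseteq> I" using S by auto
        show "f' (S - {j}) = G p (S - {j})"
        proof (cases "?r0 (S - {j}) < p")
          case True
          then show ?thesis using small[OF subj] os_dualD(3)[OF G(1) subj, of p] card[OF j] by simp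
        next
          case False
          then have r0: "?r0 (S - {j}) = p" using r0le[of j] True by simp
          have "?r1 (S - {j}) = Suc p"
          proof (rule ccontr)
            assume "?r1 (S - {j}) \<noteq> Suc p"
            then have eq: "?r1 (S - {j}) = ?r0 (S - {j})" using cone_rank_cases(1)[OF M subj] r0 by simp
            have "Some ` (S - {j}) \<subseteq> Some ` S" "Some ` S \<subseteq> cone_ground I" using S by auto
            from cone.rank_insert_eq_mono[OF this _ eq] have "?r1 S = ?r0 S" by simp
            then show False using True by simp
          qed
          then show ?thesis using subj card[OF j] by (simp add: f'_def)
        qed
      qed
      also have "\<dots> = 0" by (rule os_dualD(4)[OF G(1) S])
      finally show ?thesis .
    qed
  qed (auto simp: f'_def)
  moreover have "f' S = f S" if S: "S \<subseteq> I - {i}" for S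
  proof (cases "?r1 S = Suc (card S)")
    case True
    then show ?thesis using S G(2)[OF S] by (auto simp: f'_def)
  next
    case False
    have SI: "S \<subseteq> I" using S by auto
    have "?r1 S \<le> card S" using False cone_rank_cases[OF M SI] by linarith
    then show ?thesis using affine_dualD(3)[OF f S] False by (simp add: f'_def)
  qed
  ultimately show thesis by (rule that)
qed

section \<open>Deletion and contraction for the Euler characteristic\<close>

definition parity_part :: "bool \<Rightarrow> ('i set \<Rightarrow> 'k::field) set \<Rightarrow> ('i set \<Rightarrow> 'k) set" where
  "parity_part q W = {f \<in> W. \<forall>S. f S \<noteq> 0 \<longrightarrow> even (card S) = q}"

definition euler_char :: "('i set \<Rightarrow> 'k::field) set \<Rightarrow> int" where
  "euler_char W = int (ext.dim (parity_part True W)) - int (ext.dim (parity_part False W))"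

lemma subspace_parity_part:
  assumes W: "ext.subspace W" shows "ext.subspace (parity_part q W)"
proof -
  have sum: "even (card S) = q"
    if "x \<in> parity_part q W" "y \<in> parity_part q W" "x S + y S \<noteq> 0" for x y S
    using that unfolding parity_part_def by (cases "x S = 0") auto
  show ?thesis
    unfolding subspace_ext_iff
  proof (intro conjI ballI allI)
    show "0 \<in> parity_part q W" using ext.subspace_0[OF W] by (simp add: parity_part_def)
    fix x assume x: "x \<in> parity_part q W"
    show "x + y \<in> parity_part q W" if y: "y \<in> parity_part q W" for y
      using ext.subspace_add[OF W, of x y] sum[OF x y] x y by (simp add: parity_part_def)
    show "ext_scale c x \<in> parity_part q W" for c
      using ext.subspace_scale[OF W, of x c] x by (simp add: parity_part_def ext_scale_def)
  qed
qed

lemma affine_dual_span: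
  assumes "finite I"
  shows "parity_part q (affine_dual I r :: ('i::linorder set \<Rightarrow> 'k::field) set) \<subseteq> ext.span (ext_mono ` Pow I)"
  using ext_space_span[OF assms, where 'k = 'k] by (auto simp: parity_part_def affine_dual_def)

lemma dim_zero: "ext.dim {0} = 0"
  by (rule ext.dim_unique[of "{}"]) (auto simp: ext.independent_empty)

lemma dim_inj_image:
  fixes f :: "('i set \<Rightarrow> 'k::field) \<Rightarrow> ('i set \<Rightarrow> 'k)"
  assumes lin: "Vector_Spaces.linear ext_scale ext_scale f"
    and V: "ext.subspace V" "V \<subseteq> ext.span F" "finite F" and inj: "\<And>x. x \<in> V \<Longrightarrow> f x = 0 \<Longrightarrow> x = 0"
  shows "ext.dim (f ` V) = ext.dim V"
proof -
  interpret f: Vector_Spaces.linear ext_scale ext_scale f by (rule lin)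
  have "{x \<in> V. f x = 0} = {0}" using inj ext.subspace_0[OF V(1)] by (auto simp: f.zero)
  then show ?thesis using ext.dim_kernel_image[OF lin V] by (simp add: dim_zero)
qed

definition unit_form :: "'i \<Rightarrow> 'i \<Rightarrow> 'k::field" where
  "unit_form i = (\<lambda>j. if j = i then 1 else 0)"

lemma wedge_unit:
  assumes "finite I"
  shows "wedge I (unit_form i) f S = (if S \<subseteq> I \<and> i \<in> S then gen_sign i S * f (S - {i}) else 0)"
proof (cases "S \<subseteq> I")
  case True
  then have "finite S" using assms finite_subset by blast
  have "wedge I (unit_form i) f S = (\<Sum>j\<in>S. if j = i then gen_sign i S * f (S - {i}) else 0)"
    using True unfolding wedge_def unit_form_def by (simp cong: sum.cong_simp) (rule sum.cong; simp)
  then show ?thesis using True \<open>finite S\<close> by simp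
qed (simp add: wedge_def)

lemma contract_unit:
  assumes "finite I"
  shows "contract I (unit_form i) f S = (if S \<subseteq> I \<and> i \<in> I - S then gen_sign i S * f (insert i S) else 0)"
proof (cases "S \<subseteq> I")
  case True
  have "contract I (unit_form i) f S = (\<Sum>j\<in>I - S. if j = i then gen_sign i S * f (insert i S) else 0)"
    using True unfolding contract_def unit_form_def by simp (rule sum.cong; simp)
  then show ?thesis using True assms by simp
qed (simp add: contract_def)

lemma wedge_anticommute:
  assumes I: "finite I"
  shows "wedge I a (wedge I b f) = - wedge I b (wedge I a f)"
proof (rule ext_space_eqI[OF I])
  show "- wedge I b (wedge I a f) \<in> ext_space I"
    using ext.subspace_neg[OF subspace_ext_space] wedge_in_ext_space by blast
  fix g
  have "pairing I g (wedge I a (wedge I b f)) = pairing I (contract I b (contract I a g)) f"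
    by (simp add: pairing_contract[OF I, symmetric])
  also have "\<dots> = - pairing I (contract I a (contract I b g)) f"
    unfolding contract_anticommute[OF I, of b a] by (simp add: pairing_def sum_negf)
  also have "\<dots> = pairing I g (- wedge I b (wedge I a f))"
    by (simp add: pairing_contract[OF I]) (simp add: pairing_def sum_negf)
  finally show "pairing I g (wedge I a (wedge I b f)) = \<dots>" .
qed simp

lemma affine_dual_in_iff:
  "f \<in> affine_dual I r \<longleftrightarrow> (\<forall>S. \<not> S \<subseteq> I \<longrightarrow> f S = 0) \<and>
    (\<forall>S\<subseteq>I. r (insert None (Some ` S)) \<le> card S \<longrightarrow> f S = 0) \<and>
    (\<forall>S\<subseteq>I. r (Some ` S) < card S \<longrightarrow> coboundary I f S = 0)"
  unfolding affine_dual_def ext_space_iff by blast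

text \<open>Inserting \<open>i\<close> into a set without \<open>i\<close> raises its cardinality by one, and its rank in the
  contraction is one less than its rank with \<open>i\<close>. As the coboundary anticommutes with
  multiplication by \<open>e\<^sub>i\<close>, the conditions at the sets that contain \<open>i\<close> become those for the
  contraction.\<close>

lemma affine_dual_wedge_unit_iff:
  fixes g :: "'i::linorder set \<Rightarrow> 'k::field"
  assumes M: "rank_matroid (cone_ground I) r" and i: "i \<in> I" "r {Some i} = 1"
    and g: "g \<in> ext_space (I - {i})"
  shows "wedge I (unit_form i) g \<in> affine_dual I r \<longleftrightarrow>
    g \<in> affine_dual (I - {i}) (\<lambda>T. r (insert (Some i) T) - 1)"
proof -
  interpret rank_matroid "cone_ground I" r by (rule M)
  have finI: "finite I" by (rule finite_cone_ground[OF M])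
  let ?r' = "\<lambda>T. r (insert (Some i) T) - 1"
  let ?f = "wedge I (unit_form i) g"
  have g0: "g S = 0" if "\<not> S \<subseteq> I - {i}" for S using g that unfolding ext_space_iff by blast
  have pos: "r (insert (Some i) (Some ` S)) \<ge> 1" "r (insert (Some i) (insert None (Some ` S))) \<ge> 1"
    if "S \<subseteq> I" for S
  proof -
    have "{Some i} \<subseteq> insert (Some i) (Some ` S)" "insert (Some i) (Some ` S) \<subseteq> cone_ground I"
      "{Some i} \<subseteq> insert (Some i) (insert None (Some ` S))"
      "insert (Some i) (insert None (Some ` S)) \<subseteq> cone_ground I" using that i by auto
    then show "r (insert (Some i) (Some ` S)) \<ge> 1" "r (insert (Some i) (insert None (Some ` S))) \<ge> 1"
      using rank_mono i(2) by metis+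
  qed
  have nz: "(gen_sign i S :: 'k) \<noteq> 0" for S by (simp add: gen_sign_def)
  have rm: "S - {i} = S" if "S \<subseteq> I - {i}" for S using that by auto
  have f_ins: "?f (insert i S) = gen_sign i S * g S" if "S \<subseteq> I - {i}" for S
    using that i finI by (subst wedge_unit) (auto simp: rm)
  have f_out: "?f S = 0" if "i \<notin> S" for S
    using that finI by (simp add: wedge_unit)
  have "coboundary I ?f = - wedge I (unit_form i) (coboundary I g)"
    by (rule wedge_anticommute[OF finI])
  moreover have cg: "coboundary I g S = coboundary (I - {i}) g S" if "S \<subseteq> I - {i}" for S
    using that by (intro coboundary_cong) auto
  ultimately have cf_ins: "coboundary I ?f (insert i S) = - (gen_sign i S * coboundary (I - {i}) g S)"
    and cf_out: "coboundary I ?f S = 0" if "S \<subseteq> I - {i}" for S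
    using that i finI by (auto simp: wedge_unit rm)
  have split: "(\<forall>S\<subseteq>I. P S) \<longleftrightarrow> (\<forall>S\<subseteq>I - {i}. P S \<and> P (insert i S))" for P
  proof
    assume R: "\<forall>S\<subseteq>I - {i}. P S \<and> P (insert i S)"
    show "\<forall>S\<subseteq>I. P S"
    proof (intro allI impI)
      fix S assume S: "S \<subseteq> I"
      have "S - {i} \<subseteq> I - {i}" using S by auto
      with R have "P (S - {i})" "P (insert i (S - {i}))" by blast+
      then show "P S" by (cases "i \<in> S") (simp_all add: insert_absorb)
    qed
  next
    assume L: "\<forall>S\<subseteq>I. P S"
    show "\<forall>S\<subseteq>I - {i}. P S \<and> P (insert i S)"
    proof (intro allI impI)
      fix S assume "S \<subseteq> I - {i}"
      then have "S \<subseteq> I" "insert i S \<subseteq> I" using i by auto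
      then show "P S \<and> P (insert i S)" using L by blast
    qed
  qed
  have card: "card (insert i S) = Suc (card S)" if "S \<subseteq> I - {i}" for S
    using that finI finite_subset[of S I] by (subst card_insert_disjoint) auto
  have 1: "(r (insert None (Some ` insert i S)) \<le> card (insert i S) \<longrightarrow> ?f (insert i S) = 0) \<longleftrightarrow>
      (?r' (insert None (Some ` S)) \<le> card S \<longrightarrow> g S = 0)" if S: "S \<subseteq> I - {i}" for S
  proof -
    have "r (insert None (Some ` insert i S)) = r (insert (Some i) (insert None (Some ` S)))"
      by (simp add: insert_commute)
    moreover have "S \<subseteq> I" using S by auto
    ultimately show ?thesis using pos(2)[of S] unfolding f_ins[OF S] card[OF S] using nz by auto
  qed
  have 2: "(r (Some ` insert i S) < card (insert i S) \<longrightarrow> coboundary I ?f (insert i S) = 0) \<longleftrightarrow>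
      (?r' (Some ` S) < card S \<longrightarrow> coboundary (I - {i}) g S = 0)" if S: "S \<subseteq> I - {i}" for S
  proof -
    have "S \<subseteq> I" using S by auto
    from pos(1)[OF this] show ?thesis unfolding cf_ins[OF S] card[OF S] image_insert using nz by auto
  qed
  have "?f \<in> affine_dual I r \<longleftrightarrow>
    (\<forall>S\<subseteq>I. r (insert None (Some ` S)) \<le> card S \<longrightarrow> ?f S = 0) \<and>
    (\<forall>S\<subseteq>I. r (Some ` S) < card S \<longrightarrow> coboundary I ?f S = 0)"
    unfolding affine_dual_in_iff by (simp add: wedge_def)
  also have "\<dots> \<longleftrightarrow> (\<forall>S\<subseteq>I - {i}. ?r' (insert None (Some ` S)) \<le> card S \<longrightarrow> g S = 0) \<and>
    (\<forall>S\<subseteq>I - {i}. ?r' (Some ` S) < card S \<longrightarrow> coboundary (I - {i}) g S = 0)"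
  proof -
    have "(\<forall>S\<subseteq>I. r (insert None (Some ` S)) \<le> card S \<longrightarrow> ?f S = 0) \<longleftrightarrow>
        (\<forall>S\<subseteq>I - {i}. ?r' (insert None (Some ` S)) \<le> card S \<longrightarrow> g S = 0)"
      unfolding split
    proof (rule all_cong)
      fix S assume S: "S \<subseteq> I - {i}"
      then have "i \<notin> S" by auto
      then show "((r (insert None (Some ` S)) \<le> card S \<longrightarrow> ?f S = 0) \<and>
          (r (insert None (Some ` insert i S)) \<le> card (insert i S) \<longrightarrow> ?f (insert i S) = 0)) =
          (?r' (insert None (Some ` S)) \<le> card S \<longrightarrow> g S = 0)"
        unfolding 1[OF S] f_out[OF \<open>i \<notin> S\<close>] by simp
    qed
    moreover have "(\<forall>S\<subseteq>I. r (Some ` S) < card S \<longrightarrow> coboundary I ?f S = 0) \<longleftrightarrow>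
        (\<forall>S\<subseteq>I - {i}. ?r' (Some ` S) < card S \<longrightarrow> coboundary (I - {i}) g S = 0)"
      unfolding split
    proof (rule all_cong)
      fix S assume S: "S \<subseteq> I - {i}"
      show "((r (Some ` S) < card S \<longrightarrow> coboundary I ?f S = 0) \<and>
          (r (Some ` insert i S) < card (insert i S) \<longrightarrow> coboundary I ?f (insert i S) = 0)) =
          (?r' (Some ` S) < card S \<longrightarrow> coboundary (I - {i}) g S = 0)"
        unfolding 2[OF S] cf_out[OF S] by simp
    qed
    ultimately show ?thesis by (rule arg_cong2[of _ _ _ _ conj])
  qed
  also have "\<dots> \<longleftrightarrow> g \<in> affine_dual (I - {i}) ?r'"
    unfolding affine_dual_in_iff using g0 by auto
  finally show ?thesis .
qed

text \<open>Restriction to the sets that avoid \<open>i\<close> maps onto the dual of the deletion by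
  \<open>affine_dual_extend\<close>, and its kernel is the image of the dual of the contraction under
  multiplication by \<open>e\<^sub>i\<close>, which shifts the parity.\<close>

lemma dim_delete_contract:
  assumes M: "rank_matroid (cone_ground I) r" and i: "i \<in> I" "r {Some i} = 1"
  shows "ext.dim (parity_part q (affine_dual I r) :: ('i::linorder set \<Rightarrow> 'k::field) set) =
    ext.dim (parity_part q (affine_dual (I - {i}) r) :: ('i set \<Rightarrow> 'k) set) +
    ext.dim (parity_part (\<not> q) (affine_dual (I - {i}) (\<lambda>T. r (insert (Some i) T) - 1)) :: ('i set \<Rightarrow> 'k) set)"
proof -
  interpret rank_matroid "cone_ground I" r by (rule M)
  have finI: "finite I" by (rule finite_cone_ground[OF M])
  let ?r' = "\<lambda>T. r (insert (Some i) T) - 1"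
  let ?V = "parity_part q (affine_dual I r) :: ('i set \<Rightarrow> 'k) set"
  let ?D = "parity_part q (affine_dual (I - {i}) r) :: ('i set \<Rightarrow> 'k) set"
  let ?C = "parity_part (\<not> q) (affine_dual (I - {i}) ?r') :: ('i set \<Rightarrow> 'k) set"
  define \<rho> where "\<rho> f = (\<lambda>S. if i \<in> S then 0 else f S)" for f :: "'i set \<Rightarrow> 'k"
  let ?\<kappa> = "wedge I (unit_form i) :: ('i set \<Rightarrow> 'k) \<Rightarrow> _"
  have lin\<rho>: "Vector_Spaces.linear ext_scale ext_scale \<rho>"
    by (auto simp: Vector_Spaces.linear_iff vector_space_ext_scale \<rho>_def ext_scale_def)
  have lin\<kappa>: "Vector_Spaces.linear ext_scale ext_scale ?\<kappa>"
    by (simp add: Vector_Spaces.linear_iff vector_space_ext_scale wedge_add wedge_scale)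
  have "\<rho> ` ?V = ?D"
  proof (intro equalityI subsetI)
    fix h assume "h \<in> \<rho> ` ?V"
    then obtain f where f: "f \<in> affine_dual I r" "\<And>S. f S \<noteq> 0 \<Longrightarrow> even (card S) = q" and h: "h = \<rho> f"
      by (auto simp: parity_part_def)
    have "h \<in> affine_dual (I - {i}) r"
    proof (rule affine_dualI)
      fix S assume S: "S \<subseteq> I - {i}"
      have SI: "S \<subseteq> I" using S by auto
      show "h S = 0" if "r (cone_ground S) \<le> card S"
        using affine_dualD(3)[OF f(1) SI that] by (simp add: h \<rho>_def)
      show "coboundary (I - {i}) h S = 0" if "r (Some ` S) < card S"
      proof -
        have "coboundary (I - {i}) h S = coboundary I f S"
          using S SI by (intro coboundary_cong) (auto simp: h \<rho>_def)
        then show ?thesis using affine_dualD(4)[OF f(1) SI that] by simp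
      qed
    next
      fix S assume "\<not> S \<subseteq> I - {i}"
      then have "i \<in> S \<or> \<not> S \<subseteq> I" by auto
      then show "h S = 0" using affine_dualD(2)[OF f(1)] by (auto simp: h \<rho>_def)
    qed
    then show "h \<in> ?D" using f(2) by (auto simp: parity_part_def h \<rho>_def split: if_splits)
  next
    fix h assume h: "h \<in> ?D"
    then have hD: "h \<in> affine_dual (I - {i}) r" by (simp add: parity_part_def)
    obtain f where f: "f \<in> affine_dual I r" "\<And>S. S \<subseteq> I - {i} \<Longrightarrow> f S = h S"
      using affine_dual_extend[OF M i hD] by blast
    define g where "g = (\<lambda>S. if even (card S) = q then f S else 0)"
    have "g \<in> affine_dual I r"
      unfolding g_def by (rule affine_dual_project[OF finI f(1), of "\<lambda>c. even c = q"])
    then have "g \<in> ?V" by (simp add: parity_part_def g_def)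
    moreover have "\<rho> g = h"
    proof
      fix S
      show "\<rho> g S = h S"
      proof (cases "S \<subseteq> I - {i}")
        case True
        then have "i \<notin> S" by auto
        then show ?thesis using f(2)[OF True] h by (auto simp: \<rho>_def g_def parity_part_def)
      next
        case False
        then have "h S = 0" by (rule affine_dualD(2)[OF hD])
        moreover have "i \<in> S \<or> f S = 0" using False affine_dualD(2)[OF f(1), of S] by blast
        ultimately show ?thesis by (auto simp: \<rho>_def g_def)
      qed
    qed
    ultimately show "h \<in> \<rho> ` ?V" by blast
  qed
  moreover have "{f \<in> ?V. \<rho> f = 0} = ?\<kappa> ` ?C"
  proof (intro equalityI subsetI)
    fix f assume "f \<in> {f \<in> ?V. \<rho> f = 0}"
    then have f: "f \<in> affine_dual I r" "\<And>S. f S \<noteq> 0 \<Longrightarrow> even (card S) = q" and "\<rho> f = 0"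
      by (auto simp: parity_part_def)
    have f0: "f S = 0" if "i \<notin> S" for S using fun_cong[OF \<open>\<rho> f = 0\<close>, of S] that by (simp add: \<rho>_def)
    define g where "g = contract I (unit_form i) f"
    have gS: "g S = (if S \<subseteq> I \<and> i \<in> I - S then gen_sign i S * f (insert i S) else 0)" for S
      unfolding g_def by (rule contract_unit[OF finI])
    have "?\<kappa> f = 0" using f0 finI by (auto simp: wedge_unit fun_eq_iff)
    moreover have "(\<Sum>j\<in>I. unit_form i j * unit_form i j) = (1::'k)"
    proof -
      have "(\<Sum>j\<in>I. unit_form i j * unit_form i j) = (\<Sum>j\<in>I. if j = i then 1 else (0::'k))"
        by (rule sum.cong) (auto simp: unit_form_def)
      then show ?thesis using finI i by simp
    qed
    ultimately have fg: "f = ?\<kappa> g"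
      using contract_wedge[OF finI affine_dualD(1)[OF f(1)], of "unit_form i" "unit_form i"]
      by (simp add: g_def ext_scale_def)
    have gsub: "S \<subseteq> I - {i}" if "g S \<noteq> 0" for S using that unfolding gS by (auto split: if_splits)
    then have "g \<in> ext_space (I - {i})" unfolding ext_space_iff by blast
    then have "g \<in> affine_dual (I - {i}) ?r'"
      using affine_dual_wedge_unit_iff[OF M i] f(1) unfolding fg by blast
    moreover have "even (card S) = (\<not> q)" if "g S \<noteq> 0" for S
    proof -
      have "S \<subseteq> I - {i}" by (rule gsub[OF that])
      then have "finite S" "i \<notin> S" using finI finite_subset by blast+
      moreover have "f (insert i S) \<noteq> 0" using that unfolding gS by (auto split: if_splits)
      ultimately show ?thesis using f(2)[of "insert i S"] by auto
    qed
    ultimately show "f \<in> ?\<kappa> ` ?C" using fg by (auto simp: parity_part_def)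
  next
    fix f assume "f \<in> ?\<kappa> ` ?C"
    then obtain g where g: "g \<in> affine_dual (I - {i}) ?r'" "\<And>S. g S \<noteq> 0 \<Longrightarrow> even (card S) = (\<not> q)"
      and f: "f = ?\<kappa> g" by (auto simp: parity_part_def)
    have "f \<in> affine_dual I r"
      using affine_dual_wedge_unit_iff[OF M i affine_dualD(1)[OF g(1)]] g(1) f by blast
    moreover have "even (card S) = q" if "f S \<noteq> 0" for S
    proof -
      have S: "S \<subseteq> I" "i \<in> S" "g (S - {i}) \<noteq> 0"
        using that finI unfolding f by (auto simp: wedge_unit split: if_splits)
      then have "finite S" using finI finite_subset by blast
      then have "card S = Suc (card (S - {i}))" using S card_Suc_Diff1 by metis
      then show ?thesis using g(2)[OF S(3)] by auto
    qed
    moreover have "\<rho> f = 0" using finI by (auto simp: f wedge_unit \<rho>_def fun_eq_iff)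
    ultimately show "f \<in> {f \<in> ?V. \<rho> f = 0}" by (simp add: parity_part_def)
  qed
  moreover have "ext.dim (?\<kappa> ` ?C) = ext.dim ?C"
  proof (rule dim_inj_image[OF lin\<kappa>])
    show "ext.subspace ?C" by (intro subspace_parity_part subspace_affine_dual)
    show "?C \<subseteq> ext.span (ext_mono ` Pow (I - {i}))" using finI by (intro affine_dual_span) simp
    show "finite (ext_mono ` Pow (I - {i}))" using finI by simp
    fix g assume g: "g \<in> ?C" "?\<kappa> g = 0"
    show "g = 0"
    proof
      fix S
      show "g S = 0 S"
      proof (cases "S \<subseteq> I - {i}")
        case True
        then have "insert i S - {i} = S" "insert i S \<subseteq> I" using i by auto
        then have "gen_sign i S * g S = 0"
          using fun_cong[OF g(2), of "insert i S"] finI by (subst (asm) wedge_unit) (auto simp del: insert_Diff_single)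
        moreover have "(gen_sign i S :: 'k) \<noteq> 0" by (simp add: gen_sign_def)
        ultimately show ?thesis by simp
      next
        case False
        have "g \<in> affine_dual (I - {i}) ?r'" using g(1) by (simp add: parity_part_def)
        then show ?thesis using affine_dualD(2)[OF _ False] by simp
      qed
    qed
  qed
  moreover have "ext.dim ?V = ext.dim {f \<in> ?V. \<rho> f = 0} + ext.dim (\<rho> ` ?V)"
    using finI by (intro ext.dim_kernel_image[OF lin\<rho> subspace_parity_part[OF subspace_affine_dual] affine_dual_span])
      auto
  ultimately show ?thesis by simp
qed

lemma euler_char_delete_contract:
  assumes "rank_matroid (cone_ground I) r" and "i \<in> I" "r {Some i} = 1"
  shows "euler_char (affine_dual I r :: ('i::linorder set \<Rightarrow> 'k::field) set) =
    euler_char (affine_dual (I - {i}) r :: ('i set \<Rightarrow> 'k) set) -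
    euler_char (affine_dual (I - {i}) (\<lambda>T. r (insert (Some i) T) - 1) :: ('i set \<Rightarrow> 'k) set)"
  unfolding euler_char_def dim_delete_contract[OF assms] by simp

lemma euler_char_zero: "euler_char {0 :: 'i set \<Rightarrow> 'k::field} = 0"
proof -
  have "parity_part q {0 :: 'i set \<Rightarrow> 'k} = {0}" for q by (auto simp: parity_part_def)
  then show ?thesis by (simp add: euler_char_def)
qed

text \<open>All sets that contain the loop \<open>i\<close> are dependent, so for \<open>i \<notin> S\<close> the coboundary condition at
  \<open>S \<union> {i}\<close> has the single term \<open>\<plusminus> f S\<close>.\<close>

lemma affine_dual_loop:
  assumes M: "rank_matroid (cone_ground I) r" and i: "i \<in> I" "r {Some i} = 0"
  shows "affine_dual I r = {0 :: 'i::linorder set \<Rightarrow> 'k::field}"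
proof -
  interpret rank_matroid "cone_ground I" r by (rule M)
  have finI: "finite I" by (rule finite_cone_ground[OF M])
  interpret A: rank_matroid I "\<lambda>S. r (Some ` S)" by (rule rank_matroid_Some[OF M])
  have "f = 0" if f: "f \<in> affine_dual I r" for f :: "'i set \<Rightarrow> 'k"
  proof -
    have f': "f \<in> os_dual I (\<lambda>S. r (Some ` S))" by (rule affine_dual_subset_os_dual[OF M f])
    have dep: "r (Some ` S) < card S" if "i \<in> S" "S \<subseteq> I" for S
      using A.dependent_superset[of "{i}" S] that i by simp
    show ?thesis
    proof
      fix S
      show "f S = 0 S"
      proof (cases "S \<subseteq> I")
        case False
        then show ?thesis using affine_dualD(2)[OF f] by simp
      next
        case SI: True
        show ?thesis
        proof (cases "i \<in> S")
          case True
          then show ?thesis using os_dualD(3)[OF f' SI dep[OF True SI]] by simp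
        next
          case False
          let ?T = "insert i S"
          have T: "?T \<subseteq> I" using SI i by auto
          have fin: "finite S" using SI finI finite_subset by blast
          have "f (?T - {j}) = 0" if "j \<in> S" for j
          proof -
            have "i \<in> ?T - {j}" "?T - {j} \<subseteq> I" using that False T by auto
            then show ?thesis using dep[of "?T - {j}"] os_dualD(3)[OF f', of "?T - {j}"] by simp
          qed
          then have "coboundary I f ?T = gen_sign i ?T * f (?T - {i})"
            using T False fin by (simp add: wedge_def del: gen_sign_insert_same insert_Diff_single)
          moreover have "coboundary I f ?T = 0" by (rule affine_dualD(4)[OF f T dep]) (use T in auto)
          moreover have "?T - {i} = S" using False by auto
          moreover have "(gen_sign i ?T :: 'k) \<noteq> 0" by (simp add: gen_sign_def)
          ultimately show ?thesis by simp
        qed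
      qed
    qed
  qed
  then show ?thesis using ext.subspace_0[OF subspace_affine_dual] by blast
qed

lemma affine_dual_empty:
  assumes "rank_matroid (cone_ground {}) r"
  shows "euler_char (affine_dual {} r :: ('i::linorder set \<Rightarrow> 'k::field) set) = (if r {None} = 0 then 0 else 1)"
proof -
  interpret rank_matroid "cone_ground {}" r by (rule assms)
  have eq: "affine_dual {} r = {f :: 'i set \<Rightarrow> 'k. (\<forall>S. S \<noteq> {} \<longrightarrow> f S = 0) \<and> (r {None} = 0 \<longrightarrow> f {} = 0)}"
  proof (rule Set.set_eqI, unfold mem_Collect_eq)
    fix f :: "'i set \<Rightarrow> 'k"
    show "f \<in> affine_dual {} r \<longleftrightarrow> (\<forall>S. S \<noteq> {} \<longrightarrow> f S = 0) \<and> (r {None} = 0 \<longrightarrow> f {} = 0)"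
      unfolding affine_dual_in_iff by (simp add: rank_empty)
  qed
  show ?thesis
  proof (cases "r {None} = 0")
    case True
    have "affine_dual {} r = {0 :: 'i set \<Rightarrow> 'k}"
    proof (intro equalityI subsetI)
      fix f :: "'i set \<Rightarrow> 'k" assume "f \<in> affine_dual {} r"
      then have "f S = 0" for S unfolding eq using True by (cases "S = {}") simp_all
      then show "f \<in> {0}" by (auto simp: fun_eq_iff)
    qed (simp add: eq)
    then show ?thesis using True euler_char_zero by simp
  next
    case False
    let ?W = "affine_dual {} r :: ('i set \<Rightarrow> 'k) set"
    have scale: "f = ext_scale (f {}) (ext_mono {})" if "f \<in> ?W" for f
      using that False unfolding eq by (auto simp: ext_scale_def ext_mono_def)
    have m: "ext_mono {} \<in> ?W" unfolding eq using False by (simp add: ext_mono_def)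
    have "parity_part False ?W = {0}"
    proof -
      have "f = 0" if "f \<in> parity_part False ?W" for f
      proof
        fix S show "f S = 0 S" using that unfolding eq parity_part_def
          by (cases "S = {}") (auto dest: spec[of _ "{}"])
      qed
      moreover have "0 \<in> parity_part False ?W" unfolding eq by (simp add: parity_part_def)
      ultimately show ?thesis by blast
    qed
    moreover have "ext.dim (parity_part True ?W) = 1"
    proof (rule ext.dim_unique[of "{ext_mono {}}"])
      show "{ext_mono {}} \<subseteq> parity_part True ?W" using m by (auto simp: parity_part_def ext_mono_def)
      show "parity_part True ?W \<subseteq> ext.span {ext_mono {}}"
      proof
        fix f assume "f \<in> parity_part True ?W"
        then have "f = ext_scale (f {}) (ext_mono {})" by (intro scale) (simp add: parity_part_def)
        then show "f \<in> ext.span {ext_mono {}}"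
          by (metis ext.span_base ext.span_scale singletonI)
      qed
      have "ext_mono {} \<noteq> (0 :: 'i set \<Rightarrow> 'k)" by (auto simp: ext_mono_def fun_eq_iff)
      then show "ext.independent {ext_mono {} :: 'i set \<Rightarrow> 'k}"
        using ext.independent_insertI[of "ext_mono {}" "{}"] ext.independent_empty by auto
    qed simp
    ultimately show ?thesis using False by (simp add: euler_char_def dim_zero)
  qed
qed

lemma cone_ground_Diff: "i \<in> I \<Longrightarrow> cone_ground I - {Some i} = cone_ground (I - {i})"
  by auto

text \<open>Up to sign the Euler characteristic is Crapo's beta invariant. For a loop \<open>i\<close> the dual is zero.
  If \<open>i\<close> is a coloop, deletion and contraction have the same dual and cancel. Otherwise their ranks
  differ by one, the signs turn the difference in the recursion into a sum, and Tutte's theorem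
  provides a connected summand. A connected matroid with more than one element has no loops, so
  \<open>None\<close> is not a loop there.\<close>

lemma euler_char_affine_dual:
  assumes "rank_matroid (cone_ground I) r"
  shows "0 \<le> (-1) ^ Suc (r (cone_ground I)) * euler_char (affine_dual I r :: ('i::linorder set \<Rightarrow> 'k::field) set)"
    and "connected_matroid (cone_ground I) r \<Longrightarrow> r {None} = 1 \<Longrightarrow>
      euler_char (affine_dual I r :: ('i set \<Rightarrow> 'k) set) \<noteq> 0"
proof -
  let ?e = "\<lambda>I r. euler_char (affine_dual I r :: ('i set \<Rightarrow> 'k) set)"
  let ?Q = "\<lambda>I r. 0 \<le> (-1) ^ Suc (r (cone_ground I)) * ?e I r \<and>
    (connected_matroid (cone_ground I) r \<longrightarrow> r {None} = 1 \<longrightarrow> ?e I r \<noteq> 0)"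
  have "finite I" by (rule finite_cone_ground[OF assms])
  then have "?Q I r" using assms
  proof (induction I arbitrary: r rule: finite_psubset_induct)
    case (psubset I)
    interpret rank_matroid "cone_ground I" r by (rule psubset.prems)
    have le1: "r {x} \<le> 1" if "x \<in> cone_ground I" for x using rank_le_card[of "{x}"] that by simp
    show ?case
    proof (cases "I = {}")
      case True
      have "?e I r = (if r {None} = 0 then 0 else 1)"
        unfolding True by (rule affine_dual_empty) (use psubset.prems True in simp)
      moreover have "r {None} = 0 \<or> r {None} = 1" using le1[of None] by auto
      ultimately show ?thesis using True by auto
    next
      case False
      then obtain i where i: "i \<in> I" by auto
      let ?E' = "cone_ground (I - {i})" and ?r' = "\<lambda>T. r (insert (Some i) T) - 1"
      have E': "cone_ground I - {Some i} = ?E'" by (rule cone_ground_Diff[OF i])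
      have iE: "Some i \<in> cone_ground I" and E'E: "?E' \<subseteq> cone_ground I" using i by auto
      have ins: "insert (Some i) ?E' = cone_ground I" using i by auto
      have M1: "rank_matroid ?E' r" by (rule rank_restrict[OF E'E])
      have sep: "r (cone_ground I) < r {Some i} + r ?E'" if "connected_matroid (cone_ground I) r"
      proof -
        have "{Some i} \<subseteq> cone_ground I" "{Some i} \<noteq> {}" "{Some i} \<noteq> cone_ground I" using i by auto
        then show ?thesis using that E' unfolding connected_matroid_def by metis
      qed
      have mono: "r ?E' \<le> r (cone_ground I)" by (rule rank_mono[OF E'E]) simp
      show ?thesis
      proof (cases "r {Some i} = 0")
        case True
        have "affine_dual I r = {0 :: 'i set \<Rightarrow> 'k}"
          by (rule affine_dual_loop[OF psubset.prems i True])
        then have "?e I r = 0" by (simp add: euler_char_zero)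
        moreover have "\<not> connected_matroid (cone_ground I) r" using sep True mono by auto
        ultimately show ?thesis by simp
      next
        case False
        then have ri: "r {Some i} = 1" using le1[OF iE] by simp
        have M2: "rank_matroid ?E' ?r'" using rank_contract[OF iE ri] unfolding E' .
        have e: "?e I r = ?e (I - {i}) r - ?e (I - {i}) ?r'"
          by (rule euler_char_delete_contract[OF psubset.prems i ri])
        have sub: "I - {i} \<subset> I" using i by auto
        note IH1 = psubset.IH[OF sub M1] and IH2 = psubset.IH[OF sub M2]
        have rE: "r (cone_ground I) = r ?E' \<or> r (cone_ground I) = Suc (r ?E')"
          using rank_insert[OF E'E iE] unfolding ins .
        show ?thesis
        proof (cases "r (cone_ground I) = r ?E'")
          case False
          \<comment> \<open>Here \<open>i\<close> is a coloop.\<close>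
          have "r (insert (Some i) T) = Suc (r T)" if "T \<subseteq> ?E'" for T
          proof -
            have "T \<subseteq> cone_ground I" using that E'E by blast
            then have "r (insert (Some i) T) = r T \<or> r (insert (Some i) T) = Suc (r T)"
              using iE by (rule rank_insert)
            moreover have "r (insert (Some i) T) \<noteq> r T"
              using rank_insert_eq_mono[OF that E'E iE] False unfolding ins by auto
            ultimately show ?thesis by simp
          qed
          then have "affine_dual (I - {i}) ?r' = (affine_dual (I - {i}) r :: ('i set \<Rightarrow> 'k) set)"
            by (intro affine_dual_cong) simp
          then have "?e I r = 0" using e by simp
          moreover have "\<not> connected_matroid (cone_ground I) r" using sep ri rE False by auto
          ultimately show ?thesis by simp
        next
          case rE: True
          define s :: int where "s = (-1) ^ Suc (r (cone_ground I))"
          have "r {Some i} \<le> r (cone_ground I)" using iE by (intro rank_mono) auto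
          then obtain k where k: "r (cone_ground I) = Suc k" using ri by (cases "r (cone_ground I)") auto
          have "0 \<le> s * ?e (I - {i}) r" using IH1 rE by (simp add: s_def)
          moreover have "0 \<le> - s * ?e (I - {i}) ?r'" using IH2 k unfolding ins s_def by simp
          ultimately have pos: "0 \<le> s * ?e I r"
            and zero: "?e I r = 0 \<Longrightarrow> ?e (I - {i}) r = 0 \<and> ?e (I - {i}) ?r' = 0"
          proof -
            assume a: "0 \<le> s * ?e (I - {i}) r" "0 \<le> - s * ?e (I - {i}) ?r'"
            show "0 \<le> s * ?e I r" using a unfolding e by (simp add: right_diff_distrib)
            assume "?e I r = 0"
            then have "?e (I - {i}) r = ?e (I - {i}) ?r'" unfolding e by simp
            moreover from this a have "s * ?e (I - {i}) ?r' = 0" by simp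
            moreover have "s \<noteq> 0" by (simp add: s_def)
            ultimately show "?e (I - {i}) r = 0 \<and> ?e (I - {i}) ?r' = 0" by simp
          qed
          have "?e I r \<noteq> 0" if conn: "connected_matroid (cone_ground I) r" and none: "r {None} = 1"
          proof
            assume "?e I r = 0"
            then have "?e (I - {i}) r = 0" "?e (I - {i}) ?r' = 0" using zero by auto
            then have n1: "\<not> connected_matroid ?E' r" and n2: "\<not> (connected_matroid ?E' ?r' \<and> ?r' {None} = 1)"
              using IH1 IH2 none by auto
            have "cone_ground I \<noteq> {Some i}" by auto
            from connected_delete_or_contract[OF conn iE this] n1
            have c2: "connected_matroid ?E' ?r'" unfolding E' by simp
            interpret C: rank_matroid ?E' ?r' by (rule M2)
            show False
            proof (cases "?E' = {None}")
              case True
              have "connected_matroid ?E' r" unfolding True connected_matroid_def by blast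
              with n1 show False by simp
            next
              case False
              have "?r' ?E' < ?r' {None} + ?r' (?E' - {None})"
                using c2[unfolded connected_matroid_def, rule_format, of "{None}"] False by auto
              moreover have "?r' (?E' - {None}) \<le> ?r' ?E'" by (rule C.rank_mono) auto
              moreover have "?r' {None} \<le> 1" using C.rank_le_card[of "{None}"] by simp
              ultimately have "?r' {None} = 1" by linarith
              then show False using c2 n2 by simp
            qed
          qed
          then show ?thesis using pos by (simp add: s_def)
        qed
      qed
    qed
  qed
  then show "0 \<le> (-1) ^ Suc (r (cone_ground I)) * ?e I r"
    and "connected_matroid (cone_ground I) r \<Longrightarrow> r {None} = 1 \<Longrightarrow> ?e I r \<noteq> 0" by blast+
qed

section \<open>Exactness of multiplication by a linear form\<close>

lemma contract_affine_dual:
  assumes M: "rank_matroid (cone_ground I) r" and f: "f \<in> affine_dual I r"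
  shows "contract I a f \<in> affine_dual I r"
proof -
  interpret rank_matroid "cone_ground I" r by (rule M)
  have finI: "finite I" by (rule finite_cone_ground[OF M])
  have f': "f \<in> os_dual I (\<lambda>S. r (Some ` S))" by (rule affine_dual_subset_os_dual[OF M f])
  have c: "contract I a f \<in> os_dual I (\<lambda>S. r (Some ` S))"
    by (rule contract_os_dual[OF rank_matroid_Some[OF M] f'])
  show ?thesis
  proof (rule affine_dualI)
    show "contract I a f S = 0" if "\<not> S \<subseteq> I" for S using that by (simp add: contract_def)
    fix S assume S: "S \<subseteq> I"
    show "coboundary I (contract I a f) S = 0" if "r (Some ` S) < card S"
      using os_dualD(4)[OF c S that] .
    assume r1: "r (insert None (Some ` S)) \<le> card S"
    have "f (insert i S) = 0" if i: "i \<in> I - S" for i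
    proof (rule affine_dualD(3)[OF f])
      show "insert i S \<subseteq> I" using S i by auto
      have "insert None (Some ` S) \<subseteq> cone_ground I" "Some i \<in> cone_ground I" using S i by auto
      from rank_insert[OF this]
      have "r (insert None (Some ` insert i S)) \<le> Suc (r (insert None (Some ` S)))"
        by (auto simp: insert_commute)
      moreover have "card (insert i S) = Suc (card S)"
        using i S finI finite_subset by (intro card_insert_disjoint) auto
      ultimately show "r (insert None (Some ` insert i S)) \<le> card (insert i S)" using r1 by linarith
    qed
    then show "contract I a f S = 0" by (simp add: contract_def)
  qed
qed

definition exact_on :: "'i::linorder set \<Rightarrow> ('i \<Rightarrow> 'k::field) \<Rightarrow> ('i set \<Rightarrow> 'k) set \<Rightarrow> bool" where
  "exact_on I a Z \<longleftrightarrow> (\<forall>f\<in>Z. contract I a f = 0 \<longrightarrow> (\<exists>g\<in>Z. f = contract I a g))"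

text \<open>Contraction exchanges the parities. If \<open>K\<close> is its kernel, exactness makes both parts of \<open>Z\<close>
  have the dimension of the even part of \<open>K\<close> plus that of the odd part.\<close>

lemma euler_char_exact:
  fixes Z :: "('i::linorder set \<Rightarrow> 'k::field) set"
  assumes I: "finite I" and Z: "ext.subspace Z" "Z \<subseteq> ext_space I"
    and closed: "\<And>f. f \<in> Z \<Longrightarrow> contract I a f \<in> Z"
    and proj: "\<And>f q. f \<in> Z \<Longrightarrow> (\<lambda>S. if even (card S) = q then f S else 0) \<in> Z"
    and exact: "exact_on I a Z"
  shows "euler_char Z = 0"
proof -
  let ?Z = "\<lambda>q. parity_part q Z" and ?K = "\<lambda>q. {f \<in> parity_part q Z. contract I a f = 0}"
  have flip: "contract I a f \<in> ?Z (\<not> q)" if f: "f \<in> ?Z q" for f q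
  proof -
    have "even (card S) = (\<not> q)" if "contract I a f S \<noteq> 0" for S
    proof -
      have S: "S \<subseteq> I" "(\<Sum>i\<in>I - S. a i * gen_sign i S * f (insert i S)) \<noteq> 0"
        using that by (auto simp: contract_def split: if_splits)
      then obtain i where i: "i \<in> I - S" "f (insert i S) \<noteq> 0"
        using sum.not_neutral_contains_not_neutral[OF S(2)] by auto
      then have "even (card (insert i S)) = q" using f by (simp add: parity_part_def)
      moreover have "card (insert i S) = Suc (card S)"
        using i S I finite_subset by (intro card_insert_disjoint) auto
      ultimately show ?thesis by auto
    qed
    then show ?thesis using f closed by (simp add: parity_part_def)
  qed
  have im: "contract I a ` ?Z q = ?K (\<not> q)" for q
  proof (intro equalityI subsetI)
    fix f assume "f \<in> contract I a ` ?Z q"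
    then show "f \<in> ?K (\<not> q)" using flip contract_contract[OF I] by auto
  next
    fix f assume f: "f \<in> ?K (\<not> q)"
    then obtain g where g: "g \<in> Z" "f = contract I a g"
      using exact by (auto simp: exact_on_def parity_part_def)
    define h where "h q = (\<lambda>S. if even (card S) = q then g S else 0)" for q
    have h: "h q \<in> ?Z q" for q using proj[OF g(1)] by (simp add: h_def parity_part_def)
    have "g = h q + h (\<not> q)" by (auto simp: h_def fun_eq_iff)
    then have eq: "f = contract I a (h q) + contract I a (h (\<not> q))" using g(2) contract_add by metis
    have "f S = contract I a (h q) S" for S
    proof (cases "even (card S) = q")
      case True
      have "f S = 0" "contract I a (h q) S = 0" 
        using True f flip[OF h[of q]] by (auto simp: parity_part_def)
      then show ?thesis by simp
    next
      case False
      have "contract I a (h (\<not> q)) S = 0" using False flip[OF h[of "\<not> q"]] by (auto simp: parity_part_def)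
      then show ?thesis unfolding eq by simp
    qed
    then have "f = contract I a (h q)" by blast
    then show "f \<in> contract I a ` ?Z q" using h by blast
  qed
  have "ext.dim (?Z q) = ext.dim (?K q) + ext.dim (?K (\<not> q))" for q
  proof -
    have "?Z q \<subseteq> ext.span (ext_mono ` Pow I)"
      using ext_space_span[OF I, where 'k = 'k] Z(2) by (auto simp: parity_part_def)
    then show ?thesis
      using ext.dim_kernel_image[OF linear_contract subspace_parity_part[OF Z(1)], of q "ext_mono ` Pow I" I a]
        I im[of q] by simp
  qed
  from this[of True] this[of False] show ?thesis by (simp add: euler_char_def)
qed

definition annihilator :: "'i::linorder set \<Rightarrow> ('i set \<Rightarrow> 'k::field) set \<Rightarrow> ('i set \<Rightarrow> 'k) set" where
  "annihilator I Z = {m \<in> ext_space I. \<forall>f\<in>Z. pairing I f m = 0}"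

text \<open>The transpose of an exact endomorphism is exact. If \<open>f\<close> is in the kernel but not in the image of
  the contraction, some \<open>m\<close> is orthogonal to the image but not to \<open>f\<close>. Then \<open>a \<and> m\<close> is orthogonal to
  \<open>Z\<close>, so \<open>m\<close> agrees with some \<open>a \<and> y\<close> on \<open>Z\<close>, and \<open>f\<close> pairs with \<open>a \<and> y\<close> to zero.\<close>

lemma exact_on_dual:
  fixes Z :: "('i::linorder set \<Rightarrow> 'k::field) set"
  assumes I: "finite I" and Z: "ext.subspace Z" "Z \<subseteq> ext_space I"
    and exact: "\<And>m. m \<in> ext_space I \<Longrightarrow> wedge I a m \<in> annihilator I Z \<Longrightarrow>
      \<exists>y\<in>ext_space I. m - wedge I a y \<in> annihilator I Z"
  shows "exact_on I a Z"
  unfolding exact_on_def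
proof (intro ballI impI, rule ccontr)
  fix f assume f: "f \<in> Z" "contract I a f = 0" and no: "\<not> (\<exists>g\<in>Z. f = contract I a g)"
  interpret c: Vector_Spaces.linear ext_scale ext_scale "contract I a :: ('i set \<Rightarrow> 'k) \<Rightarrow> _"
    by (rule linear_contract)
  have "ext.subspace (contract I a ` Z)" by (rule c.subspace_image[OF Z(1)])
  moreover have "contract I a ` Z \<subseteq> ext_space I" by auto
  ultimately obtain m where m: "m \<in> ext_space I"
      "\<And>w. w \<in> contract I a ` Z \<Longrightarrow> pairing I w m = 0" "pairing I f m \<noteq> 0"
    using pairing_separates[OF I, of "contract I a ` Z" f] f no Z(2) by blast
  have "wedge I a m \<in> annihilator I Z"
    using m(2) by (auto simp: annihilator_def pairing_contract[OF I, symmetric])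
  then obtain y where y: "y \<in> ext_space I" "m - wedge I a y \<in> annihilator I Z"
    using exact m(1) by blast
  have "pairing I f m = pairing I f (m - wedge I a y) + pairing I f (wedge I a y)"
    by (simp add: pairing_diff)
  also have "pairing I f (wedge I a y) = 0" using f(2) by (simp flip: pairing_contract[OF I])
  also have "pairing I f (m - wedge I a y) = 0" using y(2) f(1) unfolding annihilator_def by blast
  finally show False using m(3) by simp
qed

text \<open>With \<open>K\<close> the kernel of the contraction at \<open>z\<close> and \<open>\<delta>\<close> the coboundary, \<open>Z\<close> is the direct sum of
  \<open>K\<close> and \<open>\<delta> K\<close>. As the coefficients of \<open>a\<close> sum up to zero, contraction by \<open>a\<close> anticommutes with
  both operations and preserves the decomposition, hence is exact on each summand.\<close>

lemma exact_on_kernel: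
  fixes Z :: "('i::linorder set \<Rightarrow> 'k::field) set"
  assumes I: "finite I" and z: "z \<in> I" and sum: "(\<Sum>i\<in>I. a i) = 0"
    and Z: "ext.subspace Z" "Z \<subseteq> ext_space I"
    and contract: "\<And>b f. f \<in> Z \<Longrightarrow> contract I b f \<in> Z" and cobound: "\<And>f. f \<in> Z \<Longrightarrow> coboundary I f \<in> Z"
    and exact: "exact_on I a Z"
  shows "exact_on I a {f \<in> Z. contract I (unit_form z) f = 0}"
  unfolding exact_on_def
proof (intro ballI impI)
  let ?d = "contract I (unit_form z)" and ?T = "contract I a"
  fix f assume f: "f \<in> {f \<in> Z. ?d f = 0}" "?T f = 0"
  then obtain g where g: "g \<in> Z" "f = ?T g" using exact by (auto simp: exact_on_def)
  have one: "(\<Sum>i\<in>I. unit_form z i * 1) = (1 :: 'k)" using I z by (simp add: unit_form_def)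
  have dc: "?d (coboundary I h) = h - coboundary I (?d h)" if "h \<in> Z" for h
    using contract_wedge[OF I, of h "unit_form z" "\<lambda>_. 1"] that Z(2) one by (auto simp: ext_scale_def)
  have Tc: "?T (coboundary I h) = - coboundary I (?T h)" if "h \<in> Z" for h
    using contract_wedge[OF I, of h a "\<lambda>_. 1"] that Z(2) sum by (auto simp: ext_scale_def fun_eq_iff)
  \<comment> \<open>The decomposition is \<open>g = b + \<delta> c\<close> with \<open>b\<close> and \<open>c\<close> in \<open>K\<close>.\<close>
  define c where "c = ?d g"
  define b where "b = g - coboundary I c"
  have c: "c \<in> Z" unfolding c_def by (rule contract[OF g(1)])
  have b: "b \<in> Z" unfolding b_def by (intro ext.subspace_diff[OF Z(1)] g(1) cobound c)
  have d0: "?d c = 0" unfolding c_def by (rule contract_contract[OF I])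
  have "?d b = c - ?d (coboundary I c)" by (simp add: b_def contract_diff c_def)
  also have "\<dots> = 0" by (simp add: dc[OF c] d0)
  finally have db: "?d b = 0" .
  have "g = b + coboundary I c" by (simp add: b_def)
  then have "f = ?T (b + coboundary I c)" using g(2) by simp
  then have f_eq: "f = ?T b - coboundary I (?T c)" by (simp add: contract_add Tc[OF c])
  have "?d (?T b) = 0" "?d (?T c) = 0"
    using contract_anticommute[OF I, of "unit_form z" a] db d0 by simp_all
  then have "?d f = - ?T c" unfolding f_eq contract_diff using dc[OF contract[OF c]] by simp
  then have "?T c = 0" using f(1) by simp
  then have "f = ?T b" using f_eq by simp
  then show "\<exists>g\<in>{f \<in> Z. ?d f = 0}. f = ?T g" using b db by blast
qed

lemma rank_matroid_map:
  assumes "rank_matroid E r" "finite E'" "\<phi> ` E' \<subseteq> E"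
  shows "rank_matroid E' (\<lambda>T. r (\<phi> ` T))"
proof -
  interpret rank_matroid E r by (rule assms)
  show ?thesis
  proof
    show "r (\<phi> ` {}) = 0" by (simp add: rank_empty)
    fix S x assume S: "S \<subseteq> E'" "x \<in> E'"
    then have "\<phi> ` S \<subseteq> E" "\<phi> x \<in> E" using assms(3) by auto
    from rank_insert[OF this]
    show "r (\<phi> ` insert x S) = r (\<phi> ` S) \<or> r (\<phi> ` insert x S) = Suc (r (\<phi> ` S))" by simp
  next
    fix S T x assume *: "S \<subseteq> T" "T \<subseteq> E'" "x \<in> E'" and eq: "r (\<phi> ` insert x S) = r (\<phi> ` S)"
    then have "\<phi> ` S \<subseteq> \<phi> ` T" "\<phi> ` T \<subseteq> E" "\<phi> x \<in> E" using assms(3) by auto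
    from rank_insert_eq_mono[OF this] eq show "r (\<phi> ` insert x T) = r (\<phi> ` T)" by simp
  qed (rule assms(2))
qed

text \<open>The matroid \<open>r\<close> itself, with \<open>z\<close> renamed to \<open>None\<close>: the hyperplane \<open>z\<close> is moved to infinity.\<close>

definition dehomogenize :: "'i \<Rightarrow> ('i set \<Rightarrow> nat) \<Rightarrow> 'i option set \<Rightarrow> nat" where
  "dehomogenize z r T = r (case_option z id ` T)"

lemma dehomogenize_simps:
  "dehomogenize z r (Some ` S) = r S"
  "dehomogenize z r (insert None (Some ` S)) = r (insert z S)"
  by (simp_all add: dehomogenize_def image_image)

lemma rank_matroid_dehomogenize:
  assumes "rank_matroid I r" "z \<in> I"
  shows "rank_matroid (cone_ground (I - {z})) (dehomogenize z r)"
proof -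
  have "finite I" using assms rank_matroid.finite_ground by blast
  then show ?thesis
    unfolding dehomogenize_def[abs_def] using assms by (intro rank_matroid_map[OF assms(1)]) auto
qed

text \<open>The kernel consists of the functions that vanish on the sets containing \<open>z\<close>. For these the
  coboundary at \<open>S \<union> {z}\<close> is \<open>\<plusminus> f S\<close>, so the conditions at dependent sets containing \<open>z\<close> become
  vanishing conditions.\<close>

lemma os_dual_kernel_eq_affine_dual:
  fixes r :: "'i::linorder set \<Rightarrow> nat"
  assumes M: "rank_matroid I r" and z: "z \<in> I"
  shows "{f \<in> os_dual I r. contract I (unit_form z) f = 0} =
    (affine_dual (I - {z}) (dehomogenize z r) :: ('i set \<Rightarrow> 'k::field) set)"
proof -
  interpret rank_matroid I r by (rule M)
  have nz: "(gen_sign i S :: 'k) \<noteq> 0" for i :: 'i and S by (simp add: gen_sign_def)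
  have ker: "contract I (unit_form z) f = 0 \<longleftrightarrow> (\<forall>S\<subseteq>I. z \<in> S \<longrightarrow> f S = 0)" for f :: "'i set \<Rightarrow> 'k"
  proof
    assume 0: "contract I (unit_form z) f = 0"
    show "\<forall>S\<subseteq>I. z \<in> S \<longrightarrow> f S = 0"
    proof (intro allI impI)
      fix S assume S: "S \<subseteq> I" "z \<in> S"
      then have "S - {z} \<subseteq> I" "z \<in> I - (S - {z})" "insert z (S - {z}) = S" using z by auto
      then have "gen_sign z (S - {z}) * f S = 0"
        using fun_cong[OF 0, of "S - {z}"] by (simp only: contract_unit[OF finite_ground] simp_thms if_True zero_fun_def)
      then show "f S = 0" using nz by simp
    qed
  next
    assume "\<forall>S\<subseteq>I. z \<in> S \<longrightarrow> f S = 0"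
    then show "contract I (unit_form z) f = 0"
      by (auto simp: contract_unit[OF finite_ground] fun_eq_iff)
  qed
  have cob: "coboundary I f (insert z S) = gen_sign z S * f S"
    if f: "\<And>S. S \<subseteq> I \<Longrightarrow> z \<in> S \<Longrightarrow> f S = 0" and S: "S \<subseteq> I - {z}" for f :: "'i set \<Rightarrow> 'k" and S
  proof -
    have fin: "finite S" and zS: "z \<notin> S" and zSI: "insert z S \<subseteq> I"
      using S z finite_ground finite_subset by auto
    have "f (insert z S - {j}) = 0" if "j \<in> S" for j
      by (rule f) (use S z that in auto)
    moreover have "insert z S - {z} = S" using zS by auto
    ultimately show ?thesis using fin zS zSI by (simp add: wedge_def del: insert_Diff_single insert_Diff1)
  qed
  have card: "card (insert z S) = Suc (card S)" if "S \<subseteq> I - {z}" for S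
    using that finite_ground finite_subset by (intro card_insert_disjoint) auto
  show ?thesis
  proof (intro equalityI subsetI)
    fix f :: "'i set \<Rightarrow> 'k" assume "f \<in> {f \<in> os_dual I r. contract I (unit_form z) f = 0}"
    then have f: "f \<in> os_dual I r" and fz: "\<And>S. S \<subseteq> I \<Longrightarrow> z \<in> S \<Longrightarrow> f S = 0" using ker by auto
    show "f \<in> affine_dual (I - {z}) (dehomogenize z r)"
    proof (rule affine_dualI; (unfold dehomogenize_simps)?)
      show "f S = 0" if "\<not> S \<subseteq> I - {z}" for S
      proof (cases "S \<subseteq> I")
        case True
        with that have "z \<in> S" by auto
        then show ?thesis by (rule fz[OF True])
      next
        case False
        then show ?thesis using os_dualD(2)[OF f] by blast
      qed
      fix S assume S: "S \<subseteq> I - {z}"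
      have SI: "S \<subseteq> I" and zSI: "insert z S \<subseteq> I" using S z by auto
      show "f S = 0" if "r (insert z S) \<le> card S"
      proof -
        have "coboundary I f (insert z S) = 0"
          using that by (intro os_dualD(4)[OF f zSI]) (simp add: card[OF S])
        then show ?thesis using cob[OF fz S] nz by simp
      qed
      show "coboundary (I - {z}) f S = 0" if "r S < card S"
      proof -
        have "coboundary (I - {z}) f S = coboundary I f S" using S SI by (intro coboundary_cong) auto
        then show ?thesis using os_dualD(4)[OF f SI that] by simp
      qed
    qed
  next
    fix f :: "'i set \<Rightarrow> 'k" assume f: "f \<in> affine_dual (I - {z}) (dehomogenize z r)"
    note f3 = affine_dualD(3)[OF f, unfolded dehomogenize_simps]
      and f4 = affine_dualD(4)[OF f, unfolded dehomogenize_simps]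
    have fz: "f S = 0" if "z \<in> S" for S using that affine_dualD(2)[OF f, of S] by auto
    have "f \<in> os_dual I r"
    proof (rule os_dualI)
      show "f S = 0" if "\<not> S \<subseteq> I" for S by (rule affine_dualD(2)[OF f]) (use that in auto)
      fix S assume S: "S \<subseteq> I" "r S < card S"
      show "f S = 0"
      proof (cases "z \<in> S")
        case False
        then have "S \<subseteq> I - {z}" using S by auto
        moreover have "r (insert z S) \<le> card S" using rank_insert[OF S(1) z] S(2) by auto
        ultimately show ?thesis by (rule f3)
      qed (rule fz)
      show "coboundary I f S = 0"
      proof (cases "z \<in> S")
        case False
        then have "S \<subseteq> I - {z}" using S by auto
        moreover have "coboundary I f S = coboundary (I - {z}) f S"
          using S calculation by (intro coboundary_cong) auto
        ultimately show ?thesis using f4 S(2) by simp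
      next
        case True
        define T where "T = S - {z}"
        have T: "T \<subseteq> I - {z}" "insert z T = S" using True S by (auto simp: T_def)
        have "r (insert z T) \<le> card T" using S(2) card[OF T(1)] T(2) by simp
        then have "f T = 0" by (rule f3[OF T(1)])
        then show ?thesis using cob[OF fz T(1)] T(2) by simp
      qed
    qed
    then show "f \<in> {f \<in> os_dual I r. contract I (unit_form z) f = 0}" using ker fz by auto
  qed
qed

section \<open>The Orlik--Solomon ideal as an annihilator\<close>

lemma ext_mult_in_ext_space:
  fixes x y :: "'i::linorder set \<Rightarrow> 'k::field"
  assumes "finite I" "x \<in> ext_space I" "y \<in> ext_space I"
  shows "ext_mult x y \<in> ext_space I"
proof -
  interpret ring "ext_alg I :: ('i set \<Rightarrow> 'k) ring" by (rule ring_ext_alg[OF assms(1)])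
  have "x \<otimes>\<^bsub>ext_alg I\<^esub> y \<in> ext_space I" by (rule m_closed[OF assms(2,3)])
  then show ?thesis by (simp add: ext_alg_def)
qed

lemma ext_mult_linear:
  "ext_mult (x + y) m = ext_mult x m + ext_mult y m"
  "ext_mult m (x + y) = ext_mult m x + ext_mult m y"
  "ext_mult (ext_scale c x) m = ext_scale c (ext_mult x m)"
  "ext_mult m (ext_scale c x) = ext_scale c (ext_mult m x)"
  "ext_mult 0 m = 0" "ext_mult m 0 = 0"
  by (auto simp: ext_mult_def ext_scale_def fun_eq_iff algebra_simps sum.distrib sum_distrib_left)

lemma ext_mult_sum:
  "ext_mult (\<Sum>a\<in>B. f a) m = (\<Sum>a\<in>B. ext_mult (f a) m)"
  "ext_mult m (\<Sum>a\<in>B. f a) = (\<Sum>a\<in>B. ext_mult m (f a))"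
  by (induction B rule: infinite_finite_induct) (auto simp: ext_mult_linear)

lemma ext_mult_one:
  fixes m :: "'i::linorder set \<Rightarrow> 'k::field"
  assumes "finite I" "m \<in> ext_space I"
  shows "ext_mult (ext_mono {}) m = m" "ext_mult m (ext_mono {}) = m"
proof -
  interpret ring "ext_alg I :: ('i set \<Rightarrow> 'k) ring" by (rule ring_ext_alg[OF assms(1)])
  show "ext_mult (ext_mono {}) m = m" "ext_mult m (ext_mono {}) = m"
    using l_one[OF assms(2)] r_one[OF assms(2)] by (simp_all add: ext_alg_def)
qed

lemma ext_sign_singleton_left:
  assumes "i \<in> U" shows "ext_sign {i} (U - {i}) = (gen_sign i U :: 'k::field)"
proof -
  have "{(s, t). s \<in> {i} \<and> t \<in> U - {i} \<and> t < s} = Pair i ` {t \<in> U. t < i}" by auto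
  then show ?thesis by (simp add: ext_sign_def gen_sign_def card_image inj_on_def)
qed

lemma ext_sign_singleton_right:
  assumes "finite U" "i \<in> U"
  shows "ext_sign (U - {i}) {i} = ((-1) ^ card (U - {i}) * gen_sign i U :: 'k::field)"
proof -
  have "{(s, t). s \<in> U - {i} \<and> t \<in> {i} \<and> t < s} = (\<lambda>s. (s, i)) ` {s \<in> U. i < s}" by auto
  then have 1: "ext_sign (U - {i}) {i} = ((-1) ^ card {s \<in> U. i < s} :: 'k)"
    by (simp add: ext_sign_def card_image inj_on_def)
  have U: "U - {i} = {t \<in> U. t < i} \<union> {s \<in> U. i < s}" by auto
  have "card (U - {i}) = card {t \<in> U. t < i} + card {s \<in> U. i < s}"
    unfolding U using assms(1) by (intro card_Un_disjoint) auto
  then have "(-1) ^ card (U - {i}) * gen_sign i U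
      = (gen_sign i U * gen_sign i U) * ((-1) ^ card {s \<in> U. i < s} :: 'k)"
    by (simp only: power_add gen_sign_def mult_ac)
  then show ?thesis unfolding 1 by simp
qed

lemma ext_mult_linear_form:
  assumes I: "finite I" and x: "x \<in> ext_degree I 1" and m: "m \<in> ext_space I"
  shows "ext_mult x m = wedge I (\<lambda>i. x {i}) m"
proof
  fix U
  have mult: "ext_mult x m \<in> ext_space I"
    using x by (intro ext_mult_in_ext_space[OF I _ m]) (simp add: ext_degree_def)
  show "ext_mult x m U = wedge I (\<lambda>i. x {i}) m U"
  proof (cases "U \<subseteq> I")
    case False
    have "ext_mult x m U = 0" using mult False unfolding ext_space_iff by blast
    then show ?thesis using False by (simp add: wedge_def)
  next
    case True
    have fin: "finite U" using True I finite_subset by blast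
    have "ext_mult x m U = (\<Sum>S\<in>(\<lambda>i. {i}) ` U. ext_sign S (U - S) * x S * m (U - S))"
      unfolding ext_mult_def
    proof (rule sum.mono_neutral_right)
      show "\<forall>S\<in>Pow U - (\<lambda>i. {i}) ` U. ext_sign S (U - S) * x S * m (U - S) = 0"
      proof
        fix S assume S: "S \<in> Pow U - (\<lambda>i. {i}) ` U"
        have "x S = 0"
        proof (rule ccontr)
          assume "x S \<noteq> 0"
          then have "card S = 1" using x by (simp add: ext_degree_def)
          then obtain i where "S = {i}" by (rule card_1_singletonE)
          then show False using S by auto
        qed
        then show "ext_sign S (U - S) * x S * m (U - S) = 0" by simp
      qed
    qed (use fin in auto)
    also have "\<dots> = (\<Sum>i\<in>U. ext_sign {i} (U - {i}) * x {i} * m (U - {i}))"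
      by (subst sum.reindex) (auto simp: inj_on_def)
    also have "\<dots> = wedge I (\<lambda>i. x {i}) m U"
      using True by (simp add: wedge_def ext_sign_singleton_left mult_ac cong: sum.cong_simp)
    finally show ?thesis .
  qed
qed

lemma ext_gen_degree: "i \<in> I \<Longrightarrow> ext_gen i \<in> ext_degree I 1"
  by (simp add: ext_degree_def ext_space_iff ext_gen_def ext_mono_def)

lemma ext_gen_coeffs: "(\<lambda>j. ext_gen i {j}) = unit_form i"
  by (auto simp: ext_gen_def ext_mono_def unit_form_def fun_eq_iff)

lemma ext_mult_gen:
  assumes "finite I" "i \<in> I" "m \<in> ext_space I"
  shows "ext_mult (ext_gen i) m = wedge I (unit_form i) m"
  using ext_mult_linear_form[OF assms(1) ext_gen_degree[OF assms(2)] assms(3)] by (simp add: ext_gen_coeffs)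

text \<open>Turns multiplication by a generator from the right into multiplication from the left.\<close>

definition degree_sign :: "('i set \<Rightarrow> 'k::field) \<Rightarrow> ('i set \<Rightarrow> 'k)" where
  "degree_sign m = (\<lambda>S. (-1) ^ card S * m S)"

lemma ext_mult_gen_right:
  fixes m :: "'i::linorder set \<Rightarrow> 'k::field"
  assumes I: "finite I" and i: "i \<in> I" and m: "m \<in> ext_space I"
  shows "ext_mult m (ext_gen i) = wedge I (unit_form i) (degree_sign m)"
proof
  fix U
  have "ext_gen i \<in> (ext_space I :: ('i set \<Rightarrow> 'k) set)"
    using i by (simp add: ext_gen_def ext_mono_def ext_space_iff)
  then have mult: "ext_mult m (ext_gen i) \<in> ext_space I" by (rule ext_mult_in_ext_space[OF I m])
  show "ext_mult m (ext_gen i) U = wedge I (unit_form i) (degree_sign m) U"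
  proof (cases "U \<subseteq> I")
    case False
    have "ext_mult m (ext_gen i) U = 0" using mult False unfolding ext_space_iff by blast
    then show ?thesis using False by (simp add: wedge_def)
  next
    case True
    have fin: "finite U" using True I finite_subset by blast
    have eq: "U - S = {i} \<longleftrightarrow> i \<in> U \<and> S = U - {i}" if "S \<in> Pow U" for S using that by auto
    have "ext_mult m (ext_gen i) U = (\<Sum>S\<in>Pow U. if S = U - {i} then
        (if i \<in> U then ext_sign (U - {i}) {i} * m (U - {i}) else 0) else 0)"
      unfolding ext_mult_def ext_gen_def ext_mono_def
    proof (rule sum.cong[OF refl])
      fix S assume S: "S \<in> Pow U"
      show "ext_sign S (U - S) * m S * (if U - S = {i} then 1 else 0)
        = (if S = U - {i} then (if i \<in> U then ext_sign (U - {i}) {i} * m (U - {i}) else 0) else 0)"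
      proof (cases "i \<in> U \<and> S = U - {i}")
        case True
        then have "U - S = {i}" by auto
        then show ?thesis using True by simp
      next
        case False
        then show ?thesis using eq[OF S] by auto
      qed
    qed
    also have "\<dots> = (if i \<in> U then ext_sign (U - {i}) {i} * m (U - {i}) else 0)"
      using fin by simp
    also have "\<dots> = wedge I (unit_form i) (degree_sign m) U"
      using True fin by (simp add: wedge_unit[OF I] ext_sign_singleton_right degree_sign_def)
    finally show ?thesis .
  qed
qed

lemma ext_mono_insert:
  fixes T :: "'i::linorder set"
  assumes "finite T" "i \<notin> T"
  obtains c :: "'k::field" where "ext_mono (insert i T) = ext_scale c (ext_mult (ext_gen i) (ext_mono T))"
proof
  have "ext_sign {i} T * ext_sign {i} T = (1::'k)"
    by (simp add: ext_sign_def flip: power_add)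
  then show "ext_mono (insert i T) = ext_scale (ext_sign {i} T :: 'k) (ext_mult (ext_gen i) (ext_mono T))"
    using assms by (simp add: ext_gen_def ext_mult_mono ext_scale_def fun_eq_iff mult.assoc[symmetric])
qed

text \<open>Every monomial is a product of generators, so products with the generators are enough.\<close>

lemma ext_ideal_criterion:
  fixes W :: "('i::linorder set \<Rightarrow> 'k::field) set"
  assumes I: "finite I" and W: "ext.subspace W" "W \<subseteq> ext_space I"
    and left: "\<And>i m. i \<in> I \<Longrightarrow> m \<in> W \<Longrightarrow> ext_mult (ext_gen i) m \<in> W"
    and right: "\<And>i m. i \<in> I \<Longrightarrow> m \<in> W \<Longrightarrow> ext_mult m (ext_gen i) \<in> W"
  shows "ideal W (ext_alg I)"
proof (rule idealI)
  let ?E = "ext_alg I :: ('i set \<Rightarrow> 'k) ring"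
  have mono: "ext_mult (ext_mono S) m \<in> W \<and> ext_mult m (ext_mono S) \<in> W"
    if "finite S" "S \<subseteq> I" "m \<in> W" for S m
    using that
  proof (induction S arbitrary: m)
    case empty
    then show ?case using ext_mult_one[OF I, of m] W(2) by auto
  next
    case (insert i S)
    obtain c :: 'k where c: "ext_mono (insert i S) = ext_scale c (ext_mult (ext_gen i) (ext_mono S))"
      using ext_mono_insert insert.hyps by blast
    have "ext_mult (ext_gen i) (ext_mult (ext_mono S) m) \<in> W"
      using insert by (intro left) auto
    moreover have "ext_mult (ext_mult m (ext_gen i)) (ext_mono S) \<in> W"
      using insert right by auto
    ultimately show ?case
      unfolding c by (simp add: ext_mult_linear ext_mult_assoc ext.subspace_scale[OF W(1)])
  qed
  have all: "ext_mult x m \<in> W \<and> ext_mult m x \<in> W" if x: "x \<in> ext_space I" and m: "m \<in> W" for x m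
  proof -
    have "ext_mult (\<Sum>S\<in>Pow I. ext_scale (x S) (ext_mono S)) m \<in> W \<and>
      ext_mult m (\<Sum>S\<in>Pow I. ext_scale (x S) (ext_mono S)) \<in> W"
      unfolding ext_mult_sum ext_mult_linear
      using mono m I finite_subset by (auto intro!: ext.subspace_sum[OF W(1)] ext.subspace_scale[OF W(1)])
    then show ?thesis using ext_space_expand[OF I x] by simp
  qed
  show "ring ?E" by (rule ring_ext_alg[OF I])
  then interpret ring ?E .
  show "subgroup W (add_monoid ?E)"
  proof (rule add.subgroupI)
    show "W \<subseteq> carrier ?E" by (rule W(2))
    show "W \<noteq> {}" using ext.subspace_0[OF W(1)] by auto
    fix x assume x: "x \<in> W"
    show "x \<oplus>\<^bsub>?E\<^esub> y \<in> W" if "y \<in> W" for y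
      using ext.subspace_add[OF W(1) x that] by (simp add: ext_alg_def)
    have "- x \<in> W" by (rule ext.subspace_neg[OF W(1) x])
    moreover have "\<ominus>\<^bsub>?E\<^esub> x = - x"
      using x W(2) \<open>- x \<in> W\<close> by (intro minus_equality) (auto simp: ext_alg_def)
    ultimately show "\<ominus>\<^bsub>?E\<^esub> x \<in> W" by simp
  qed
  show "x \<otimes>\<^bsub>?E\<^esub> a \<in> W" "a \<otimes>\<^bsub>?E\<^esub> x \<in> W" if "a \<in> W" "x \<in> carrier ?E" for a x
    using all[OF that(2,1)] by (simp_all add: ext_alg_def)
qed

lemma ideal_ext_alg:
  fixes J :: "('i::linorder set \<Rightarrow> 'k::field) set"
  assumes I: "finite I" and J: "ideal J (ext_alg I)"
  shows "ext.subspace J" "J \<subseteq> ext_space I"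
    "\<And>x m. x \<in> ext_space I \<Longrightarrow> m \<in> J \<Longrightarrow> ext_mult x m \<in> J"
proof -
  interpret J: ideal J "ext_alg I" by (rule J)
  show sub: "J \<subseteq> ext_space I" using J.a_subset .
  show mult: "ext_mult x m \<in> J" if "x \<in> ext_space I" "m \<in> J" for x m
    using J.I_l_closed[OF that(2,1)] by (simp add: ext_alg_def)
  show "ext.subspace J"
    unfolding subspace_ext_iff
  proof (intro conjI ballI allI)
    show "0 \<in> J" using additive_subgroup.zero_closed[OF J.additive_subgroup_axioms] by (simp add: ext_alg_def)
    fix x assume x: "x \<in> J"
    show "x + y \<in> J" if "y \<in> J" for y using additive_subgroup.a_closed[OF J.additive_subgroup_axioms x that] by (simp add: ext_alg_def)
    show "ext_scale c x \<in> J" for c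
    proof -
      have "ext_scale c (ext_mono {}) \<in> ext_space I" by (simp add: ext_space_iff ext_scale_def ext_mono_def)
      from mult[OF this x] show ?thesis
        using sub x by (simp add: ext_mult_linear ext_mult_one[OF I, of x] subsetD)
    qed
  qed
qed

lemma subspace_annihilator:
  fixes Z :: "('i::linorder set \<Rightarrow> 'k::field) set"
  shows "ext.subspace (annihilator I Z)"
  unfolding subspace_ext_iff
proof (intro conjI ballI allI)
  show "0 \<in> annihilator I Z"
    by (simp add: annihilator_def ext.subspace_0[OF subspace_ext_space])
  fix x assume x: "x \<in> annihilator I Z"
  show "ext_scale c x \<in> annihilator I Z" for c
    using x by (simp add: annihilator_def pairing_scale ext.subspace_scale[OF subspace_ext_space])
  fix y assume y: "y \<in> annihilator I Z"
  have "pairing I f (x + y) = 0" if "f \<in> Z" for f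
  proof -
    have "pairing I f x = 0" "pairing I f y = 0" using x y that unfolding annihilator_def by blast+
    then show ?thesis by (simp only: pairing_add add_0)
  qed
  then show "x + y \<in> annihilator I Z"
    using x y by (simp add: annihilator_def ext.subspace_add[OF subspace_ext_space])
qed

lemma annihilator_ideal:
  fixes Z :: "('i::linorder set \<Rightarrow> 'k::field) set"
  assumes I: "finite I"
    and contract: "\<And>a f. f \<in> Z \<Longrightarrow> contract I a f \<in> Z" and sign: "\<And>f. f \<in> Z \<Longrightarrow> degree_sign f \<in> Z"
  shows "ideal (annihilator I Z) (ext_alg I)"
proof (rule ext_ideal_criterion[OF I subspace_annihilator])
  show "annihilator I Z \<subseteq> ext_space I" by (auto simp: annihilator_def)
  have wedge: "wedge I a m \<in> annihilator I Z" if "m \<in> annihilator I Z" for a m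
    using that contract unfolding annihilator_def by (auto simp flip: pairing_contract[OF I])
  have sgn: "degree_sign m \<in> annihilator I Z" if m: "m \<in> annihilator I Z" for m
  proof -
    have "pairing I f (degree_sign m) = pairing I (degree_sign f) m" for f
      unfolding pairing_def degree_sign_def by (rule sum.cong) (simp_all add: mult_ac)
    moreover have "degree_sign m \<in> ext_space I"
      using m by (simp add: annihilator_def ext_space_iff degree_sign_def)
    ultimately show ?thesis using m sign unfolding annihilator_def by auto
  qed
  fix i m assume i: "i \<in> I" and m: "m \<in> annihilator I Z"
  then have mE: "m \<in> ext_space I" by (simp add: annihilator_def)
  show "ext_mult (ext_gen i) m \<in> annihilator I Z"
    unfolding ext_mult_gen[OF I i mE] by (rule wedge[OF m])
  show "ext_mult m (ext_gen i) \<in> annihilator I Z"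
    unfolding ext_mult_gen_right[OF I i mE] by (rule wedge[OF sgn[OF m]])
qed

lemma degree_sign_affine_dual:
  assumes I: "finite I" and f: "f \<in> affine_dual I r"
  shows "degree_sign f \<in> affine_dual I r"
proof -
  have "degree_sign f = (\<lambda>S. if even (card S) then f S else 0) - (\<lambda>S. if odd (card S) then f S else 0)"
    by (auto simp: degree_sign_def fun_eq_iff)
  then show ?thesis
    using ext.subspace_diff[OF subspace_affine_dual affine_dual_project[OF I f, of even]
        affine_dual_project[OF I f, of odd]] by simp
qed

text \<open>All that the algebra needs to know about the arrangement: the cone matroid determines the
  empty intersections and the codimensions of the others.\<close>

locale arrangement_rank =
  fixes n :: nat and I :: "'i::linorder set" and H :: "'i \<Rightarrow> complex vec set" and r :: "'i option set \<Rightarrow> nat"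
  assumes matroid: "rank_matroid (cone_ground I) r"
    and flat_empty_iff: "S \<subseteq> I \<Longrightarrow> flat n (H ` S) = {} \<longleftrightarrow> r (insert None (Some ` S)) = r (Some ` S)"
    and codim_flat: "S \<subseteq> I \<Longrightarrow> flat n (H ` S) \<noteq> {} \<Longrightarrow> codim n (flat n (H ` S)) = r (Some ` S)"
begin

sublocale rank_matroid "cone_ground I" r by (rule matroid)

lemma finite_index: "finite I" by (rule finite_cone_ground[OF matroid])

abbreviation gens :: "('i set \<Rightarrow> 'k::field) set" where
  "gens \<equiv> {ext_boundary S | S. S \<subseteq> I \<and> minimal_dependent n H S} \<union>
      {ext_mono S | S. S \<subseteq> I \<and> flat n (H ` S) = {}}"

abbreviation dual :: "('i set \<Rightarrow> 'k::field) set" where "dual \<equiv> affine_dual I r"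

text \<open>The sign is due to positions being counted from 1 in \<open>\<partial> e\<^sub>S\<close>.\<close>

lemma ext_boundary_contract:
  assumes S: "S \<subseteq> I"
  shows "ext_boundary S = - (contract I (\<lambda>_. 1) (ext_mono S) :: 'i set \<Rightarrow> 'k::field)"
proof
  fix T
  have fin: "finite S" using S finite_index finite_subset by blast
  have sgn: "(-1) ^ card {k \<in> S. k \<le> i} = (- gen_sign i S :: 'k)" if "i \<in> S" for i
  proof -
    have "{k \<in> S. k \<le> i} = insert i {k \<in> S. k < i}" using that by auto
    then show ?thesis using fin by (simp add: gen_sign_def)
  qed
  have "ext_boundary S T = (\<Sum>i\<in>S. if T = S - {i} then - gen_sign i S else (0::'k))"
    unfolding ext_boundary_def sum_fun_apply
    by (rule sum.cong) (auto simp: ext_scale_def ext_mono_def sgn)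
  also have "\<dots> = (\<Sum>i\<in>S \<inter> (I - T). if T = S - {i} then - gen_sign i S else 0)"
    using fin S by (intro sum.mono_neutral_right) auto
  also have "\<dots> = (\<Sum>i\<in>I - T. if i \<in> S \<and> T = S - {i} then - gen_sign i S else 0)"
    using finite_index by (intro sum.mono_neutral_cong_left) auto
  also have "\<dots> = (- contract I (\<lambda>_. 1 :: 'k) (ext_mono S)) T"
  proof (cases "T \<subseteq> I")
    case True
    have "(if i \<in> S \<and> T = S - {i} then - gen_sign i S else 0)
        = - (gen_sign i T * ext_mono S (insert i T) :: 'k)" if "i \<in> I - T" for i
    proof (cases "i \<in> S \<and> T = S - {i}")
      case True
      then have "insert i T = S" "gen_sign i T = (gen_sign i S :: 'k)" by auto
      then show ?thesis using True by (simp add: ext_mono_def)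
    next
      case False
      then have "insert i T \<noteq> S" using that by auto
      then show ?thesis using False by (auto simp: ext_mono_def)
    qed
    then show ?thesis using True by (simp add: contract_def sum_negf cong: sum.cong_simp)
  next
    case False
    have "(if i \<in> S \<and> T = S - {i} then - gen_sign i S else 0) = (0::'k)" for i using False S by auto
    then show ?thesis using False by (simp add: contract_def)
  qed
  finally show "ext_boundary S T = (- contract I (\<lambda>_. 1 :: 'k) (ext_mono S)) T" .
qed

lemma ext_mono_in: "S \<subseteq> I \<Longrightarrow> ext_mono S \<in> ext_space I"
  by (simp add: ext_mono_def ext_space_iff)

lemma dependent_iff:
  assumes "S \<subseteq> I"
  shows "dependent_hyperplanes n H S \<longleftrightarrow> flat n (H ` S) \<noteq> {} \<and> r (Some ` S) < card S"
  unfolding dependent_hyperplanes_def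
  using codim_flat[OF assms] by (cases "flat n (H ` S) = {}") simp_all

lemma pairing_boundary:
  assumes S: "S \<subseteq> I"
  shows "pairing I f (contract I (\<lambda>_. 1) (ext_mono S)) = coboundary I f S"
proof -
  have "pairing I f (contract I (\<lambda>_. 1) (ext_mono S)) = pairing I (contract I (\<lambda>_. 1) (ext_mono S)) f"
    by (rule pairing_commute)
  also have "\<dots> = pairing I (ext_mono S) (coboundary I f)" by (rule pairing_contract[OF finite_index])
  also have "\<dots> = pairing I (coboundary I f) (ext_mono S)" by (rule pairing_commute)
  also have "\<dots> = coboundary I f S" by (rule pairing_mono[OF finite_index S])
  finally show ?thesis .
qed

lemma gens_subset_annihilator: "(gens :: ('i set \<Rightarrow> 'k::field) set) \<subseteq> annihilator I dual"
proof
  fix m :: "'i set \<Rightarrow> 'k" assume "m \<in> gens"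
  then consider S where "S \<subseteq> I" "minimal_dependent n H S" "m = ext_boundary S"
    | S where "S \<subseteq> I" "flat n (H ` S) = {}" "m = ext_mono S" by blast
  then show "m \<in> annihilator I dual"
  proof cases
    case 1
    then have dep: "r (Some ` S) < card S"
      using dependent_iff[OF 1(1)] by (simp add: minimal_dependent_def)
    have "pairing I f (contract I (\<lambda>_. 1) (ext_mono S)) = 0" if "f \<in> dual" for f :: "'i set \<Rightarrow> 'k"
      unfolding pairing_boundary[OF 1(1)] by (rule affine_dualD(4)[OF that 1(1) dep])
    then have "contract I (\<lambda>_. 1 :: 'k) (ext_mono S) \<in> annihilator I dual"
      unfolding annihilator_def by auto
    then show ?thesis
      unfolding 1(3) ext_boundary_contract[OF 1(1)] by (rule ext.subspace_neg[OF subspace_annihilator])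
  next
    case 2
    have "r (insert None (Some ` S)) \<le> card S"
      using flat_empty_iff[OF 2(1)] 2(2) cone_rank_cases(2)[OF matroid 2(1)] by simp
    then have "pairing I f m = 0" if "f \<in> dual" for f :: "'i set \<Rightarrow> 'k"
      unfolding 2(3) pairing_mono[OF finite_index 2(1)] by (rule affine_dualD(3)[OF that 2(1)])
    moreover have "m \<in> ext_space I" unfolding 2(3) by (rule ext_mono_in[OF 2(1)])
    ultimately show ?thesis unfolding annihilator_def by blast
  qed
qed

lemma ideal_annihilator_dual: "ideal (annihilator I dual) (ext_alg I)"
  by (intro annihilator_ideal finite_index contract_affine_dual[OF matroid] degree_sign_affine_dual)

lemma gens_carrier: "gens \<subseteq> ext_space I"
  using gens_subset_annihilator by (auto simp: annihilator_def)

lemma ideal_os_ideal: "ideal (os_ideal n I H) (ext_alg I)"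
  unfolding os_ideal_def by (rule ring.genideal_ideal[OF ring_ext_alg[OF finite_index] gens_carrier])

lemma gens_os_ideal: "gens \<subseteq> os_ideal n I H"
  unfolding os_ideal_def by (rule ring.genideal_self[OF ring_ext_alg[OF finite_index] gens_carrier])

lemma os_ideal_subset_annihilator: "os_ideal n I H \<subseteq> annihilator I dual"
  unfolding os_ideal_def
  by (rule ring.genideal_minimal[OF ring_ext_alg[OF finite_index] ideal_annihilator_dual gens_subset_annihilator])

lemma wedge_unit_os_ideal:
  fixes m :: "'i set \<Rightarrow> 'k::field"
  assumes "i \<in> I" "m \<in> os_ideal n I H"
  shows "wedge I (unit_form i) m \<in> os_ideal n I H"
proof -
  note id = ideal_ext_alg[OF finite_index ideal_os_ideal]
  have "(ext_gen i :: 'i set \<Rightarrow> 'k) \<in> ext_space I"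
    using assms(1) unfolding ext_gen_def by (intro ext_mono_in) simp
  from id(3)[OF this assms(2)] show ?thesis
    using ext_mult_gen[OF finite_index assms(1)] assms(2) id(2) by (metis subsetD)
qed

text \<open>For \<open>i \<notin> U\<close> one has \<open>\<partial>(e\<^sub>i \<and> e\<^sub>U) = e\<^sub>U - e\<^sub>i \<and> \<partial> e\<^sub>U\<close> up to sign, so the boundary of \<open>U \<union> {i}\<close> is in
  the ideal if both \<open>e\<^sub>U\<close> and \<open>\<partial> e\<^sub>U\<close> are. This is why the two are carried along together.\<close>

lemma boundary_superset_os_ideal:
  assumes "S \<subseteq> T" "T \<subseteq> I"
    and S: "(ext_mono S :: 'i set \<Rightarrow> 'k::field) \<in> os_ideal n I H"
      "(contract I (\<lambda>_. 1) (ext_mono S) :: 'i set \<Rightarrow> 'k) \<in> os_ideal n I H"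
  shows "(ext_mono T :: 'i set \<Rightarrow> 'k) \<in> os_ideal n I H \<and>
    (contract I (\<lambda>_. 1) (ext_mono T) :: 'i set \<Rightarrow> 'k) \<in> os_ideal n I H"
proof -
  let ?J = "os_ideal n I H :: ('i set \<Rightarrow> 'k) set" and ?c = "contract I (\<lambda>_. 1 :: 'k)"
  note id = ideal_ext_alg[OF finite_index ideal_os_ideal]
  have step: "ext_mono (insert i U) \<in> ?J \<and> ?c (ext_mono (insert i U)) \<in> ?J"
    if i: "i \<in> I" "i \<notin> U" and U: "U \<subseteq> I" "ext_mono U \<in> ?J" "?c (ext_mono U) \<in> ?J" for i U
  proof -
    have fin: "finite U" using U(1) finite_index finite_subset by blast
    obtain a :: 'k where "ext_mono (insert i U) = ext_scale a (ext_mult (ext_gen i) (ext_mono U))"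
      by (rule ext_mono_insert[OF fin i(2)])
    then have a: "ext_mono (insert i U) = ext_scale a (wedge I (unit_form i) (ext_mono U))"
      unfolding ext_mult_gen[OF finite_index i(1) ext_mono_in[OF U(1)]] .
    have one: "sum (unit_form i) I = (1::'k)" using finite_index i(1) by (simp add: unit_form_def)
    have "?c (wedge I (unit_form i) (ext_mono U)) = ext_mono U - wedge I (unit_form i) (?c (ext_mono U))"
      using contract_wedge[OF finite_index ext_mono_in[OF U(1)], of "\<lambda>_. 1 :: 'k" "unit_form i"]
      by (simp add: ext_scale_def one)
    moreover have "wedge I (unit_form i) m \<in> ?J" if "m \<in> ?J" for m
      by (rule wedge_unit_os_ideal[OF i(1) that])
    ultimately show ?thesis
      unfolding a contract_scale using U by (simp add: ext.subspace_scale[OF id(1)] ext.subspace_diff[OF id(1)])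
  qed
  have "ext_mono (S \<union> X) \<in> ?J \<and> ?c (ext_mono (S \<union> X)) \<in> ?J" if "finite X" "X \<subseteq> T" for X
    using that
  proof (induction X)
    case (insert i X)
    show ?case
    proof (cases "i \<in> S \<union> X")
      case False
      have "ext_mono (insert i (S \<union> X)) \<in> ?J \<and> ?c (ext_mono (insert i (S \<union> X))) \<in> ?J"
        using insert assms(1,2) False by (intro step) auto
      then show ?thesis by simp
    next
      case True
      then have "S \<union> insert i X = S \<union> X" by auto
      then show ?thesis using insert by simp
    qed
  qed (use S in simp)
  moreover have "finite T" using assms(2) finite_index finite_subset by blast
  moreover have "S \<union> T = T" using assms(1) by auto
  ultimately show ?thesis by force
qed

text \<open>If the hyperplanes of the circuit \<open>C\<close> meet, then \<open>\<partial> e\<^sub>C\<close> is a generator of the ideal and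
  \<open>e\<^sub>C = \<plusminus> e\<^sub>i \<and> \<partial> e\<^sub>C\<close> for \<open>i \<in> C\<close>. Otherwise, as each \<open>C - {i}\<close> spans the same flat of the cone
  matroid as \<open>C\<close>, the hyperplanes of \<open>C - {i}\<close> already have empty intersection, and all terms of
  \<open>\<partial> e\<^sub>C\<close> are generators.\<close>

lemma minimal_dependent_os_ideal:
  assumes C: "C \<subseteq> I" and dep: "r (Some ` C) < card C"
    and min: "\<And>T. T \<subset> C \<Longrightarrow> r (Some ` T) = card T"
  shows "(ext_mono C :: 'i set \<Rightarrow> 'k::field) \<in> os_ideal n I H \<and>
    (contract I (\<lambda>_. 1) (ext_mono C) :: 'i set \<Rightarrow> 'k) \<in> os_ideal n I H"
proof -
  let ?J = "os_ideal n I H :: ('i set \<Rightarrow> 'k) set" and ?c = "contract I (\<lambda>_. 1 :: 'k)"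
  note id = ideal_ext_alg[OF finite_index ideal_os_ideal]
  have fin: "finite C" using C finite_index finite_subset by blast
  show ?thesis
  proof (cases "flat n (H ` C) = {}")
    case True
    have r1: "r (insert None (Some ` C)) = r (Some ` C)" using flat_empty_iff[OF C] True by simp
    have eC: "ext_mono C \<in> ?J" using gens_os_ideal C True by blast
    have "ext_mono (C - {i}) \<in> ?J" if i: "i \<in> C" for i
    proof -
      let ?D = "C - {i}"
      have D: "?D \<subseteq> I" "?D \<subset> C" using C i by auto
      have sub: "Some ` ?D \<subseteq> Some ` C" "Some ` C \<subseteq> cone_ground I" "Some ` ?D \<subseteq> cone_ground I"
        "insert None (Some ` ?D) \<subseteq> cone_ground I" "Some i \<in> cone_ground I"
        using C i by auto
      have ins: "insert (Some i) (Some ` ?D) = Some ` C" using i by auto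
      have "card C = Suc (card ?D)" using card_Suc_Diff1[OF fin i] by simp
      then have rD: "r (Some ` ?D) = r (Some ` C)"
        using rank_mono[OF sub(1,2)] min[OF D(2)] dep by linarith
      then have "r (insert (Some i) (Some ` ?D)) = r (Some ` ?D)" unfolding ins by simp
      from rank_insert_eq_mono[OF _ sub(4,5) this]
      have "r (insert (Some i) (insert None (Some ` ?D))) = r (insert None (Some ` ?D))" by blast
      then have "r (insert None (Some ` C)) = r (insert None (Some ` ?D))"
        unfolding insert_commute[of "Some i"] ins .
      then have "flat n (H ` ?D) = {}" using flat_empty_iff[OF D(1)] r1 rD by simp
      then show ?thesis using gens_os_ideal D(1) by blast
    qed
    then have "ext_boundary C \<in> ?J"
      unfolding ext_boundary_def by (intro ext.subspace_sum[OF id(1)] ext.subspace_scale[OF id(1)])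
    then have "- ?c (ext_mono C) \<in> ?J" unfolding ext_boundary_contract[OF C] .
    then have "?c (ext_mono C) \<in> ?J" using ext.subspace_neg[OF id(1)] by fastforce
    then show ?thesis using eC by blast
  next
    case False
    have "minimal_dependent n H C"
      unfolding minimal_dependent_def
    proof (intro conjI allI impI)
      show "dependent_hyperplanes n H C" using dependent_iff[OF C] False dep by simp
      show "\<not> dependent_hyperplanes n H T" if "T \<subset> C" for T
        using dependent_iff[of T] min[OF that] that C by auto
    qed
    then have "ext_boundary C \<in> ?J" using gens_os_ideal C by blast
    then have "- ?c (ext_mono C) \<in> ?J" unfolding ext_boundary_contract[OF C] .
    then have c: "?c (ext_mono C) \<in> ?J" using ext.subspace_neg[OF id(1)] by fastforce
    obtain i where i: "i \<in> C" using dep by fastforce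
    have iI: "i \<in> I" using i C by auto
    have one: "sum (unit_form i) I = (1::'k)" using finite_index iI by (simp add: unit_form_def)
    have "wedge I (unit_form i) (ext_mono C) = (0 :: 'i set \<Rightarrow> 'k)"
      using C i by (auto simp: wedge_unit[OF finite_index] ext_mono_def fun_eq_iff)
    then have "wedge I (unit_form i) (?c (ext_mono C)) = ext_mono C"
      using contract_wedge[OF finite_index ext_mono_in[OF C], of "\<lambda>_. 1 :: 'k" "unit_form i"]
      by (simp add: ext_scale_def one)
    then show ?thesis using c wedge_unit_os_ideal[OF iI c] by simp
  qed
qed

text \<open>A dependent set contains a circuit.\<close>

lemma dependent_os_ideal:
  assumes S: "S \<subseteq> I" and dep: "r (Some ` S) < card S"
  shows "(ext_mono S :: 'i set \<Rightarrow> 'k::field) \<in> os_ideal n I H \<and>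
    (contract I (\<lambda>_. 1) (ext_mono S) :: 'i set \<Rightarrow> 'k) \<in> os_ideal n I H"
proof -
  have "finite S" using S finite_index finite_subset by blast
  then show ?thesis using S dep
  proof (induction S rule: finite_psubset_induct)
    case (psubset S)
    show ?case
    proof (cases "\<exists>T. T \<subset> S \<and> r (Some ` T) < card T")
      case True
      then obtain T where T: "T \<subset> S" "r (Some ` T) < card T" by blast
      then have "T \<subseteq> I" using psubset.prems by auto
      then show ?thesis
        using boundary_superset_os_ideal[of T S] psubset.IH[OF T(1) _ T(2)] T(1) psubset.prems(1) by blast
    next
      case False
      have "r (Some ` T) = card T" if "T \<subset> S" for T
      proof -
        have "T \<subseteq> I" using that psubset.prems(1) by auto
        then have "r (Some ` T) \<le> card T" by (rule cone_rank_cases(2)[OF matroid])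
        then show ?thesis using False that by (meson le_neq_implies_less)
      qed
      then show ?thesis by (intro minimal_dependent_os_ideal psubset.prems)
    qed
  qed
qed

lemma os_ideal_orthogonal_dual:
  fixes f :: "'i set \<Rightarrow> 'k::field"
  assumes f: "f \<in> ext_space I" and orth: "\<And>m. m \<in> os_ideal n I H \<Longrightarrow> pairing I f m = 0"
  shows "f \<in> dual"
proof (rule affine_dualI)
  show "f S = 0" if "\<not> S \<subseteq> I" for S using f that unfolding ext_space_iff by blast
  fix S assume S: "S \<subseteq> I"
  show "coboundary I f S = 0" if "r (Some ` S) < card S"
    using orth dependent_os_ideal[OF S that] pairing_boundary[OF S, of f] by metis
  assume r1: "r (insert None (Some ` S)) \<le> card S"
  have "(ext_mono S :: 'i set \<Rightarrow> 'k) \<in> os_ideal n I H"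
  proof (cases "r (Some ` S) < card S")
    case True
    then show ?thesis using dependent_os_ideal[OF S] by blast
  next
    case False
    then have "r (insert None (Some ` S)) = r (Some ` S)"
      using cone_rank_cases[OF matroid S] r1 by linarith
    then have "flat n (H ` S) = {}" using flat_empty_iff[OF S] by simp
    then show ?thesis using gens_os_ideal S by blast
  qed
  then show "f S = 0" using orth pairing_mono[OF finite_index S, of f] by metis
qed

text \<open>In finite dimension a subspace is its own double orthogonal complement, and \<open>dual\<close> is the
  orthogonal complement of the ideal.\<close>

lemma os_ideal_eq_annihilator: "(os_ideal n I H :: ('i set \<Rightarrow> 'k::field) set) = annihilator I dual"
proof (rule equalityI[OF os_ideal_subset_annihilator], rule subsetI, rule ccontr)
  note id = ideal_ext_alg[OF finite_index ideal_os_ideal]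
  fix m :: "'i set \<Rightarrow> 'k" assume m: "m \<in> annihilator I dual" "m \<notin> os_ideal n I H"
  have "m \<in> ext_space I" using m(1) by (simp add: annihilator_def)
  from pairing_separates[OF finite_index id(1,2) this m(2)]
  obtain f where f: "f \<in> ext_space I" "\<And>w. w \<in> os_ideal n I H \<Longrightarrow> pairing I w f = 0" "pairing I m f \<noteq> 0"
    by blast
  have "pairing I f w = 0" if "w \<in> os_ideal n I H" for w
    using f(2)[OF that] pairing_commute[of I f w] by simp
  then have "f \<in> dual" by (rule os_ideal_orthogonal_dual[OF f(1)])
  then have "pairing I f m = 0" using m(1) unfolding annihilator_def by blast
  then show False using f(3) pairing_commute[of I f m] by simp
qed

text \<open>The condition on cosets, lifted to the exterior algebra. One of the two inclusions always holds
  because \<open>x \<and> x = 0\<close>.\<close>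

lemma singular_on_iff:
  fixes x :: "'i set \<Rightarrow> 'k::field"
  assumes x: "x \<in> ext_degree I 1"
  shows "singular_on (os_module n I H) x \<longleftrightarrow>
    \<not> (\<forall>m\<in>ext_space I. wedge I (\<lambda>i. x {i}) m \<in> os_ideal n I H \<longrightarrow>
        (\<exists>y\<in>ext_space I. m - wedge I (\<lambda>i. x {i}) y \<in> os_ideal n I H))"
proof -
  let ?J = "os_ideal n I H :: ('i set \<Rightarrow> 'k) set" and ?E = "ext_alg I :: ('i set \<Rightarrow> 'k) ring"
  let ?M = "os_module n I H :: ('i set \<Rightarrow> 'k, ('i set \<Rightarrow> 'k) set) module"
  let ?w = "wedge I (\<lambda>i. x {i})"
  note id = ideal_ext_alg[OF finite_index ideal_os_ideal]
  interpret J: ideal ?J ?E by (rule ideal_os_ideal)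
  have xE: "x \<in> ext_space I" using x by (simp add: ext_degree_def)
  have carrier: "carrier ?M = {?J +>\<^bsub>?E\<^esub> m | m. m \<in> ext_space I}"
    by (auto simp: os_module_def ring.extend_def os_algebra_def FactRing_def A_RCOSETS_def' )
  have zero: "\<zero>\<^bsub>?M\<^esub> = ?J"
    by (simp add: os_module_def ring.extend_def os_algebra_def FactRing_def)
  have act: "x \<odot>\<^bsub>?M\<^esub> (?J +>\<^bsub>?E\<^esub> m) = ?J +>\<^bsub>?E\<^esub> ?w m" if m: "m \<in> ext_space I" for m
  proof -
    have "x \<odot>\<^bsub>?M\<^esub> (?J +>\<^bsub>?E\<^esub> m) = ?J +>\<^bsub>?E\<^esub> (x \<otimes>\<^bsub>?E\<^esub> m)"
      using J.rcoset_mult_add[OF xE m]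
      by (simp add: os_module_def ring.extend_def os_algebra_def FactRing_def)
    also have "x \<otimes>\<^bsub>?E\<^esub> m = ext_mult x m" by (simp add: ext_alg_def)
    finally show ?thesis unfolding ext_mult_linear_form[OF finite_index x m] .
  qed
  have minus: "a \<ominus>\<^bsub>?E\<^esub> b = a - b" if ab: "a \<in> ext_space I" "b \<in> ext_space I" for a b
  proof -
    have "- b \<in> ext_space I" by (rule ext.subspace_neg[OF subspace_ext_space ab(2)])
    then have "\<ominus>\<^bsub>?E\<^esub> b = - b" using ab by (intro J.minus_equality) (auto simp: ext_alg_def)
    then show ?thesis by (simp add: a_minus_def) (simp add: ext_alg_def)
  qed
  have eq: "?J +>\<^bsub>?E\<^esub> a = ?J +>\<^bsub>?E\<^esub> b \<longleftrightarrow> a - b \<in> ?J" if "a \<in> ext_space I" "b \<in> ext_space I" for a b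
    using J.quotient_eq_iff_same_a_r_cos[OF ideal_os_ideal that] minus[OF that] by simp
  have eq0: "?J +>\<^bsub>?E\<^esub> a = ?J \<longleftrightarrow> a \<in> ?J" if "a \<in> ext_space I" for a
    using J.a_rcos_zero[OF ideal_os_ideal] J.rcos_const_imp_mem[OF that] by blast
  have L: "{m \<in> carrier ?M. x \<odot>\<^bsub>?M\<^esub> m = \<zero>\<^bsub>?M\<^esub>} = {?J +>\<^bsub>?E\<^esub> m | m. m \<in> ext_space I \<and> ?w m \<in> ?J}"
  proof -
    have "x \<odot>\<^bsub>?M\<^esub> (?J +>\<^bsub>?E\<^esub> m) = ?J \<longleftrightarrow> ?w m \<in> ?J" if "m \<in> ext_space I" for m
      unfolding act[OF that] by (rule eq0) simp
    then show ?thesis unfolding carrier zero by blast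
  qed
  have R: "{x \<odot>\<^bsub>?M\<^esub> m | m. m \<in> carrier ?M} = {?J +>\<^bsub>?E\<^esub> ?w y | y. y \<in> ext_space I}"
    unfolding carrier using act by auto
  have RL: "{?J +>\<^bsub>?E\<^esub> ?w y | y. y \<in> ext_space I} \<subseteq> {?J +>\<^bsub>?E\<^esub> m | m. m \<in> ext_space I \<and> ?w m \<in> ?J}"
  proof -
    have "?w (?w y) \<in> ?J" for y
      unfolding wedge_wedge[OF finite_index] by (rule ext.subspace_0[OF id(1)])
    then show ?thesis by auto
  qed
  have "{m \<in> carrier ?M. x \<odot>\<^bsub>?M\<^esub> m = \<zero>\<^bsub>?M\<^esub>} = {x \<odot>\<^bsub>?M\<^esub> m | m. m \<in> carrier ?M} \<longleftrightarrow>
      {?J +>\<^bsub>?E\<^esub> m | m. m \<in> ext_space I \<and> ?w m \<in> ?J} \<subseteq> {?J +>\<^bsub>?E\<^esub> ?w y | y. y \<in> ext_space I}"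
    unfolding L R using RL by blast
  also have "\<dots> \<longleftrightarrow> (\<forall>m\<in>ext_space I. ?w m \<in> ?J \<longrightarrow> (\<exists>y\<in>ext_space I. ?J +>\<^bsub>?E\<^esub> m = ?J +>\<^bsub>?E\<^esub> ?w y))"
    by blast
  also have "\<dots> \<longleftrightarrow> (\<forall>m\<in>ext_space I. ?w m \<in> ?J \<longrightarrow> (\<exists>y\<in>ext_space I. m - ?w y \<in> ?J))"
    using eq by simp
  finally show ?thesis unfolding singular_on_def by simp
qed

end

section \<open>Linear subspaces cut out by hyperplanes\<close>

definition injective_mat :: "complex mat \<Rightarrow> bool" where
  "injective_mat Q \<longleftrightarrow> (\<forall>y\<in>carrier_vec (dim_col Q). Q *\<^sub>v y = 0\<^sub>v (dim_row Q) \<longrightarrow> y = 0\<^sub>v (dim_col Q))"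

text \<open>A \<open>k\<close>-dimensional subspace together with linear coordinates on it, which the splitting of a
  reducible arrangement needs besides the dimension.\<close>

definition parametrized :: "nat \<Rightarrow> nat \<Rightarrow> complex vec set \<Rightarrow> bool" where
  "parametrized n k D \<longleftrightarrow>
     (\<exists>Q\<in>carrier_mat n k. injective_mat Q \<and> D = (\<lambda>y. Q *\<^sub>v y) ` carrier_vec k)"

definition subspace_dim :: "nat \<Rightarrow> complex vec set \<Rightarrow> nat" where
  "subspace_dim n D = vectorspace.dim class_ring ((module_vec TYPE(complex) n)\<lparr>carrier := D\<rparr>)"

lemma parametrizedE:
  assumes "parametrized n k D"
  obtains Q where "Q \<in> carrier_mat n k" "D = (\<lambda>y. Q *\<^sub>v y) ` carrier_vec k"
    "\<And>y. y \<in> carrier_vec k \<Longrightarrow> Q *\<^sub>v y = 0\<^sub>v n \<Longrightarrow> y = 0\<^sub>v k"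
  using assms unfolding parametrized_def injective_mat_def by auto

lemma parametrizedI:
  assumes "Q \<in> carrier_mat n k" "D = (\<lambda>y. Q *\<^sub>v y) ` carrier_vec k"
    "\<And>y. y \<in> carrier_vec k \<Longrightarrow> Q *\<^sub>v y = 0\<^sub>v n \<Longrightarrow> y = 0\<^sub>v k"
  shows "parametrized n k D"
  using assms unfolding parametrized_def injective_mat_def by auto

lemma subspace_dim_parametrized:
  assumes "parametrized n k D" shows "subspace_dim n D = k"
proof -
  obtain Q where Q: "Q \<in> carrier_mat n k" and D: "D = (\<lambda>y. Q *\<^sub>v y) ` carrier_vec k"
    and inj: "\<And>y. y \<in> carrier_vec k \<Longrightarrow> Q *\<^sub>v y = 0\<^sub>v n \<Longrightarrow> y = 0\<^sub>v k"
    by (rule parametrizedE[OF assms]) blast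
  interpret K: vec_space "TYPE(complex)" k .
  interpret N: vec_space "TYPE(complex)" n .
  interpret T: linear_map class_ring "module_vec TYPE(complex) k" "module_vec TYPE(complex) n" "\<lambda>y. Q *\<^sub>v y"
    by unfold_locales (use Q in \<open>auto simp: mult_add_distrib_mat_vec[OF Q] mult_mat_vec[OF Q] module_vec_simps LinearCombinations.module_hom_def\<close>)
  have im: "T.imT = D" unfolding T.im_def D by (simp add: module_vec_simps)
  have ker: "T.kerT = {0\<^sub>v k}" unfolding T.ker_def using inj Q by (auto simp: module_vec_simps)
  have "vectorspace.dim class_ring (K.V\<lparr>carrier := {0\<^sub>v k}\<rparr>) = 0"
  proof -
    have "K.span {} = {0\<^sub>v k}" by (simp add: K.span_empty)
    interpret S: vectorspace class_ring "K.V\<lparr>carrier := {0\<^sub>v k}\<rparr>"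
      using T.kerT_is_subspace K.subspace_is_vs unfolding ker by blast
    have "S.span {} = {0\<^sub>v k}" by (simp add: S.span_empty)
    then have "S.basis {}" by (simp add: S.basis_def S.lin_dep_def)
    then show ?thesis using S.dim_basis[of "{}"] by simp
  qed
  then show ?thesis
    using T.rank_nullity[OF K.fin_dim] unfolding im ker subspace_dim_def K.dim_is_n by simp
qed

lemma parametrized_carrier: "parametrized n n (carrier_vec n)"
proof (rule parametrizedI)
  show "1\<^sub>m n \<in> carrier_mat n n" by simp
  have "(\<lambda>y. 1\<^sub>m n *\<^sub>v y) ` carrier_vec n = (\<lambda>y. y) ` (carrier_vec n :: complex vec set)"
    by (rule image_cong) (auto intro: one_mult_mat_vec)
  then show "carrier_vec n = (\<lambda>y. 1\<^sub>m n *\<^sub>v y) ` (carrier_vec n :: complex vec set)" by simp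
qed simp

text \<open>The equation is solved for a coordinate \<open>m\<close> with \<open>b\<^sub>m \<noteq> 0\<close>; the function \<open>skip\<close> enumerates the
  remaining coordinates, which are free.\<close>

lemma parametrized_hyperplane:
  assumes b: "b \<in> carrier_vec (Suc k)" "b \<noteq> 0\<^sub>v (Suc k)"
  shows "parametrized (Suc k) k {y \<in> carrier_vec (Suc k). b \<bullet> y = 0}"
proof -
  obtain m where m: "m < Suc k" "b $ m \<noteq> 0"
    using b by (metis eq_vecI carrier_vecD index_zero_vec)
  define skip where "skip j = (if j < m then j else Suc j)" for j
  have skip: "skip ` {..<k} = {..<Suc k} - {m}" "inj_on skip {..<k}"
  proof -
    show "inj_on skip {..<k}" by (auto simp: inj_on_def skip_def split: if_splits)
    have "x \<in> skip ` {..<k}" if x: "x < Suc k" "x \<noteq> m" for x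
    proof (cases "x < m")
      case True
      then have "x = skip x" "x < k" using m x by (auto simp: skip_def)
      then show ?thesis by blast
    next
      case False
      then have "x = skip (x - 1)" "x - 1 < k" using m x by (auto simp: skip_def)
      then show ?thesis by blast
    qed
    moreover have "skip j < Suc k \<and> skip j \<noteq> m" if "j < k" for j using that by (auto simp: skip_def)
    ultimately show "skip ` {..<k} = {..<Suc k} - {m}" by blast
  qed
  have sum_skip: "(\<Sum>j<k. h (skip j)) = (\<Sum>l\<in>{..<Suc k} - {m}. h l)" for h :: "nat \<Rightarrow> complex"
    using sum.reindex[OF skip(2), of h] skip(1) by simp
  have split: "(\<Sum>l<Suc k. h l) = h m + (\<Sum>j<k. h (skip j))" for h :: "nat \<Rightarrow> complex"
    unfolding sum_skip using m by (intro sum.remove) auto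
  define R where "R = mat (Suc k) k (\<lambda>(i, j). if i = m then - (b $ skip j) / b $ m else if i = skip j then 1 else 0)"
  have R: "R \<in> carrier_mat (Suc k) k" by (simp add: R_def)
  have row: "(R *\<^sub>v z) $ skip j = z $ j" if z: "z \<in> carrier_vec k" and j: "j < k" for z j
  proof -
    have sj: "skip j < Suc k" "skip j \<noteq> m" using j by (auto simp: skip_def)
    have "(R *\<^sub>v z) $ skip j = (\<Sum>l<k. R $$ (skip j, l) * z $ l)"
      using R z sj by (simp add: scalar_prod_def lessThan_atLeast0)
    also have "\<dots> = (\<Sum>l<k. if l = j then z $ j else 0)"
      using sj j skip(2) by (intro sum.cong) (auto simp: R_def inj_on_def)
    finally show ?thesis using j by simp
  qed
  have rowm: "(R *\<^sub>v z) $ m = - (\<Sum>j<k. b $ skip j * z $ j) / b $ m" if z: "z \<in> carrier_vec k" for z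
  proof -
    have "(R *\<^sub>v z) $ m = (\<Sum>l<k. R $$ (m, l) * z $ l)"
      using R z m by (simp add: scalar_prod_def lessThan_atLeast0)
    also have "\<dots> = (\<Sum>l<k. - (b $ skip l * z $ l) / b $ m)"
      using m by (intro sum.cong) (auto simp: R_def)
    finally show ?thesis by (simp add: sum_negf sum_divide_distrib)
  qed
  have dot: "b \<bullet> y = b $ m * y $ m + (\<Sum>j<k. b $ skip j * y $ skip j)" if "y \<in> carrier_vec (Suc k)" for y
  proof -
    have "b \<bullet> y = (\<Sum>l<Suc k. b $ l * y $ l)"
      using that by (simp only: scalar_prod_def carrier_vecD lessThan_atLeast0)
    then show ?thesis unfolding split .
  qed
  show ?thesis
  proof (rule parametrizedI[OF R])
    show "{y \<in> carrier_vec (Suc k). b \<bullet> y = 0} = (\<lambda>y. R *\<^sub>v y) ` carrier_vec k"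
    proof (intro equalityI subsetI)
      fix y assume y: "y \<in> {y \<in> carrier_vec (Suc k). b \<bullet> y = 0}"
      define z where "z = vec k (\<lambda>j. y $ skip j)"
      have z: "z \<in> carrier_vec k" by (simp add: z_def)
      have "y = R *\<^sub>v z"
      proof (rule eq_vecI)
        show "dim_vec y = dim_vec (R *\<^sub>v z)" using y R by simp
        fix i assume "i < dim_vec (R *\<^sub>v z)"
        then have i: "i < Suc k" using R by simp
        show "y $ i = (R *\<^sub>v z) $ i"
        proof (cases "i = m")
          case True
          have "(\<Sum>j<k. b $ skip j * z $ j) = - (b $ m * y $ m)"
            using dot[of y] y by (simp add: z_def eq_neg_iff_add_eq_0 add.commute)
          then show ?thesis using rowm[OF z] m True by simp
        next
          case False
          then obtain j where "j < k" "i = skip j" using i skip(1) by (metis DiffI imageE lessThan_iff singletonD)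
          then show ?thesis using row[OF z] by (simp add: z_def)
        qed
      qed
      then show "y \<in> (\<lambda>y. R *\<^sub>v y) ` carrier_vec k" using z by blast
    next
      fix y assume "y \<in> (\<lambda>y. R *\<^sub>v y) ` carrier_vec k"
      then obtain z where z: "z \<in> carrier_vec k" "y = R *\<^sub>v z" by auto
      have y: "y \<in> carrier_vec (Suc k)" using z R by simp
      have "(\<Sum>j<k. b $ skip j * y $ skip j) = (\<Sum>j<k. b $ skip j * z $ j)"
        using row[OF z(1)] z(2) by (intro sum.cong) auto
      then have "b \<bullet> y = 0" using dot[OF y] rowm[OF z(1)] z(2) m by simp
      then show "y \<in> {y \<in> carrier_vec (Suc k). b \<bullet> y = 0}" using y by simp
    qed
    fix z assume z: "z \<in> carrier_vec k" "R *\<^sub>v z = 0\<^sub>v (Suc k)"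
    show "z = 0\<^sub>v k"
    proof (rule eq_vecI)
      fix j assume "j < dim_vec (0\<^sub>v k :: complex vec)"
      then have j: "j < k" by simp
      then have "skip j < Suc k" by (auto simp: skip_def)
      then show "z $ j = 0\<^sub>v k $ j" using row[OF z(1) j] z(2) j by simp
    qed (use z in simp)
  qed
qed

text \<open>In the coordinates \<open>y\<close> on \<open>D\<close> the functional \<open>a\<close> is given by a nonzero vector \<open>b\<close>, so the section
  is a hyperplane in the coordinate space.\<close>

lemma parametrized_section:
  assumes D: "parametrized n k D" and a: "a \<in> carrier_vec n" and nz: "\<exists>d\<in>D. a \<bullet> d \<noteq> 0"
  shows "0 < k" "parametrized n (k - 1) {d \<in> D. a \<bullet> d = 0}"
proof -
  obtain Q where Q: "Q \<in> carrier_mat n k" and DQ: "D = (\<lambda>y. Q *\<^sub>v y) ` carrier_vec k"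
    and inj: "\<And>y. y \<in> carrier_vec k \<Longrightarrow> Q *\<^sub>v y = 0\<^sub>v n \<Longrightarrow> y = 0\<^sub>v k"
    by (rule parametrizedE[OF D]) blast
  define b where "b = transpose_mat Q *\<^sub>v a"
  have b: "b \<in> carrier_vec k" unfolding b_def by (rule mult_mat_vec_carrier[OF _ a]) (use Q in simp)
  have dot: "a \<bullet> (Q *\<^sub>v y) = b \<bullet> y" if "y \<in> carrier_vec k" for y
    unfolding b_def using transpose_vec_mult_scalar[OF Q that a] by simp
  obtain d where "d \<in> D" "a \<bullet> d \<noteq> 0" using nz by blast
  then obtain y where y: "y \<in> carrier_vec k" "b \<bullet> y \<noteq> 0" unfolding DQ using dot by auto
  have b0: "b \<noteq> 0\<^sub>v k" using y by auto
  show "0 < k"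
  proof (rule ccontr)
    assume "\<not> 0 < k"
    then have "b = 0\<^sub>v k" using b by (intro eq_vecI) auto
    then show False using b0 by simp
  qed
  then obtain k' where k: "k = Suc k'" by (cases k) auto
  obtain R where R: "R \<in> carrier_mat k k'" "{y \<in> carrier_vec k. b \<bullet> y = 0} = (\<lambda>y. R *\<^sub>v y) ` carrier_vec k'"
    and injR: "\<And>z. z \<in> carrier_vec k' \<Longrightarrow> R *\<^sub>v z = 0\<^sub>v k \<Longrightarrow> z = 0\<^sub>v k'"
    using parametrizedE[OF parametrized_hyperplane[of b k']] b b0 unfolding k by blast
  have "parametrized n k' {d \<in> D. a \<bullet> d = 0}"
  proof (rule parametrizedI)
    show QR: "Q * R \<in> carrier_mat n k'" using Q R by simp
    have "{d \<in> D. a \<bullet> d = 0} = (\<lambda>y. Q *\<^sub>v y) ` {y \<in> carrier_vec k. b \<bullet> y = 0}"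
      unfolding DQ using dot by auto
    also have "\<dots> = (\<lambda>z. Q *\<^sub>v (R *\<^sub>v z)) ` carrier_vec k'" unfolding R(2) image_image ..
    also have "\<dots> = (\<lambda>z. (Q * R) *\<^sub>v z) ` carrier_vec k'"
      using Q R(1) by (intro image_cong) auto
    finally show "{d \<in> D. a \<bullet> d = 0} = (\<lambda>z. (Q * R) *\<^sub>v z) ` carrier_vec k'" .
    fix z assume z: "z \<in> carrier_vec k'" "(Q * R) *\<^sub>v z = 0\<^sub>v n"
    have "Q *\<^sub>v (R *\<^sub>v z) = 0\<^sub>v n" using z Q R(1) by simp
    then have "R *\<^sub>v z = 0\<^sub>v k" using R(1) z(1) by (intro inj) auto
    then show "z = 0\<^sub>v k'" by (rule injR[OF z(1)])
  qed
  then show "parametrized n (k - 1) {d \<in> D. a \<bullet> d = 0}" using k by simp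
qed

section \<open>The rank function of a hyperplane arrangement\<close>

locale hyperplane_family =
  fixes n :: nat and I :: "'i set" and \<alpha> :: "'i \<Rightarrow> complex vec" and \<beta> :: "'i \<Rightarrow> complex"
  assumes finite_family: "finite I" and normal_carrier: "i \<in> I \<Longrightarrow> \<alpha> i \<in> carrier_vec n"
begin

definition hyp :: "'i \<Rightarrow> complex vec set" where
  "hyp i = {x \<in> carrier_vec n. \<alpha> i \<bullet> x = \<beta> i}"

definition directions :: "'i set \<Rightarrow> complex vec set" where
  "directions S = {d \<in> carrier_vec n. \<forall>i\<in>S. \<alpha> i \<bullet> d = 0}"

definition meet :: "'i set \<Rightarrow> complex vec set" where
  "meet S = flat n (hyp ` S)"

abbreviation direction_dim :: "'i set \<Rightarrow> nat" where
  "direction_dim S \<equiv> subspace_dim n (directions S)"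

lemma meet_iff: "x \<in> meet S \<longleftrightarrow> x \<in> carrier_vec n \<and> (\<forall>i\<in>S. \<alpha> i \<bullet> x = \<beta> i)"
  by (auto simp: meet_def flat_def hyp_def)

lemma meet_empty: "meet {} = carrier_vec n"
  by (auto simp: meet_iff)

lemma meet_antimono: "S \<subseteq> T \<Longrightarrow> meet T \<subseteq> meet S"
  by (rule subsetI) (unfold meet_iff, blast)

lemma meet_Un: "meet (S \<union> T) = meet S \<inter> meet T"
  by (auto simp: meet_iff)

lemma directions_antimono: "S \<subseteq> T \<Longrightarrow> directions T \<subseteq> directions S"
  by (auto simp: directions_def)

lemma directions_insert: "directions (insert i S) = {d \<in> directions S. \<alpha> i \<bullet> d = 0}"
  by (auto simp: directions_def)

lemma parametrized_directions:
  assumes "S \<subseteq> I" shows "parametrized n (direction_dim S) (directions S)"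
proof -
  have "finite S" using assms finite_family finite_subset by blast
  then have "\<exists>k. parametrized n k (directions S)" using assms
  proof (induction S)
    case empty
    have "directions {} = carrier_vec n" by (simp add: directions_def)
    then show ?case using parametrized_carrier by metis
  next
    case (insert i S)
    then obtain k where k: "parametrized n k (directions S)" by auto
    show ?case
    proof (cases "\<exists>d\<in>directions S. \<alpha> i \<bullet> d \<noteq> 0")
      case True
      then show ?thesis
        using parametrized_section(2)[OF k normal_carrier] insert.prems unfolding directions_insert by auto
    next
      case False
      then have "directions (insert i S) = directions S" unfolding directions_insert by auto
      then show ?thesis using k by auto
    qed
  qed
  then show ?thesis using subspace_dim_parametrized by metis
qed

lemma direction_dim_empty: "direction_dim {} = n"
proof -
  have "directions {} = carrier_vec n" by (simp add: directions_def)
  then show ?thesis using subspace_dim_parametrized[OF parametrized_carrier] by simp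
qed

lemma direction_dim_insert:
  assumes "S \<subseteq> I" "i \<in> I" and "\<exists>d\<in>directions S. \<alpha> i \<bullet> d \<noteq> 0"
  shows "direction_dim S = Suc (direction_dim (insert i S))"
  using parametrized_section[OF parametrized_directions[OF assms(1)] normal_carrier[OF assms(2)] assms(3)]
    subspace_dim_parametrized unfolding directions_insert by fastforce

lemma directions_insert_eq:
  assumes "\<not> (\<exists>d\<in>directions S. \<alpha> i \<bullet> d \<noteq> 0)"
  shows "directions (insert i S) = directions S"
  using assms unfolding directions_insert by auto

lemma direction_dim_antimono:
  assumes "S \<subseteq> T" "T \<subseteq> I"
  shows "direction_dim T \<le> direction_dim S \<and> (direction_dim T = direction_dim S \<longrightarrow> directions T = directions S)"
proof -
  have "finite X \<Longrightarrow> X \<subseteq> I \<Longrightarrow> direction_dim (S \<union> X) \<le> direction_dim S \<and>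
      (direction_dim (S \<union> X) = direction_dim S \<longrightarrow> directions (S \<union> X) = directions S)" for X
  proof (induction X rule: finite_induct)
    case (insert i X)
    show ?case
    proof (cases "\<exists>d\<in>directions (S \<union> X). \<alpha> i \<bullet> d \<noteq> 0")
      case True
      have "direction_dim (S \<union> X) = Suc (direction_dim (insert i (S \<union> X)))"
        using True insert.prems assms by (intro direction_dim_insert) auto
      then show ?thesis using insert by auto
    next
      case False
      then show ?thesis using directions_insert_eq[OF False] insert by simp
    qed
  qed simp
  moreover have "finite T" using assms(2) finite_family finite_subset by blast
  moreover have "S \<union> T = T" using assms(1) by auto
  ultimately show ?thesis using assms(2) by metis
qed

lemma direction_dim_le: "S \<subseteq> I \<Longrightarrow> direction_dim S \<le> n"
  using direction_dim_antimono[of "{}" S] direction_dim_empty by simp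

lemma normal_scalar:
  assumes "i \<in> I" "x \<in> carrier_vec n" "y \<in> carrier_vec n"
  shows "\<alpha> i \<bullet> (x + y) = \<alpha> i \<bullet> x + \<alpha> i \<bullet> y" "\<alpha> i \<bullet> (x - y) = \<alpha> i \<bullet> x - \<alpha> i \<bullet> y"
    "\<alpha> i \<bullet> (c \<cdot>\<^sub>v x) = c * (\<alpha> i \<bullet> x)"
  using normal_carrier[OF assms(1)] assms(2,3)
  by (simp_all add: scalar_prod_add_distrib[of _ n] scalar_prod_minus_distrib[of _ n])

lemma meet_translate:
  assumes "S \<subseteq> I" "p \<in> meet S"
  shows "x \<in> meet S \<longleftrightarrow> x \<in> carrier_vec n \<and> x - p \<in> directions S"
proof -
  have p: "p \<in> carrier_vec n" using assms(2) meet_iff by blast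
  have "\<alpha> i \<bullet> x = \<beta> i \<longleftrightarrow> \<alpha> i \<bullet> (x - p) = 0" if "i \<in> S" "x \<in> carrier_vec n" for i
    using normal_scalar(2)[OF subsetD[OF assms(1) that(1)] that(2) p] that(1) assms(2)
    by (auto simp: meet_iff)
  then show ?thesis using p by (auto simp: meet_iff directions_def)
qed

lemma directions_meet:
  assumes "S \<subseteq> I" "meet S \<noteq> {}"
  shows "{x - y | x y. x \<in> meet S \<and> y \<in> meet S} = directions S"
proof (intro equalityI subsetI)
  fix d assume "d \<in> {x - y | x y. x \<in> meet S \<and> y \<in> meet S}"
  then show "d \<in> directions S" using meet_translate[OF assms(1)] by auto
next
  fix d assume d: "d \<in> directions S"
  obtain p where p: "p \<in> meet S" using assms(2) by auto
  have c: "p \<in> carrier_vec n" "d \<in> carrier_vec n" using p d by (auto simp: meet_iff directions_def)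
  then have "(p + d) - p = d" by (intro eq_vecI) auto
  then have "p + d \<in> meet S" "d = (p + d) - p"
    using meet_translate[OF assms(1) p, of "p + d"] c d by auto
  then show "d \<in> {x - y | x y. x \<in> meet S \<and> y \<in> meet S}" using p by blast
qed

lemma codim_meet:
  assumes "S \<subseteq> I" "meet S \<noteq> {}"
  shows "codim n (meet S) = n - direction_dim S"
  unfolding codim_def directions_meet[OF assms] subspace_dim_def ..

lemma meet_insert_nonempty:
  assumes "S \<subseteq> I" "i \<in> I" "meet S \<noteq> {}" "\<exists>d\<in>directions S. \<alpha> i \<bullet> d \<noteq> 0"
  shows "meet (insert i S) \<noteq> {}"
proof -
  obtain p d where p: "p \<in> meet S" and d: "d \<in> directions S" "\<alpha> i \<bullet> d \<noteq> 0" using assms by blast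
  have c: "p \<in> carrier_vec n" "d \<in> carrier_vec n" using p d by (auto simp: meet_iff directions_def)
  define x where "x = p + ((\<beta> i - \<alpha> i \<bullet> p) / (\<alpha> i \<bullet> d)) \<cdot>\<^sub>v d"
  have "\<alpha> j \<bullet> x = \<alpha> j \<bullet> p + (\<beta> i - \<alpha> i \<bullet> p) / (\<alpha> i \<bullet> d) * (\<alpha> j \<bullet> d)" if "j \<in> I" for j
    unfolding x_def using normal_scalar[OF that] c by simp
  note eq = this
  have "\<alpha> j \<bullet> x = \<beta> j" if "j \<in> insert i S" for j
  proof (cases "j = i")
    case True
    then show ?thesis using eq[OF assms(2)] d(2) by simp
  next
    case False
    then have "j \<in> S" using that by simp
    then have "\<alpha> j \<bullet> p = \<beta> j" "\<alpha> j \<bullet> d = 0" "j \<in> I"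
      using p d(1) assms(1) by (auto simp: meet_iff directions_def)
    then show ?thesis using eq by simp
  qed
  moreover have "x \<in> carrier_vec n" using c by (simp add: x_def)
  ultimately have "x \<in> meet (insert i S)" unfolding meet_iff by blast
  then show ?thesis by blast
qed

lemma meet_insert_eq:
  assumes "S \<subseteq> I" "i \<in> I" "\<not> (\<exists>d\<in>directions S. \<alpha> i \<bullet> d \<noteq> 0)" "meet (insert i S) \<noteq> {}"
  shows "meet (insert i S) = meet S"
proof -
  obtain p where p: "p \<in> meet (insert i S)" using assms(4) by blast
  then have p': "p \<in> meet S" by (auto simp: meet_iff)
  have "x \<in> meet (insert i S) \<longleftrightarrow> x \<in> meet S" for x
    using meet_translate[of "insert i S" p x] meet_translate[of S p x] p p' assms(1,2)
      directions_insert_eq[OF assms(3)] by auto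
  then show ?thesis by blast
qed

text \<open>The rank of the vectors \<open>(\<alpha>\<^sub>i, -\<beta>\<^sub>i)\<close> for \<open>Some i \<in> T\<close> and \<open>(0, 1)\<close> for \<open>None \<in> T\<close>. Modulo
  \<open>(0, 1)\<close> it is the rank of the normals, and \<open>(0, 1)\<close> is in the span iff \<open>None \<in> T\<close> or the
  equations are inconsistent.\<close>

definition cone_rank :: "'i option set \<Rightarrow> nat" where
  "cone_rank T = n - direction_dim (Some -` T) + (if None \<in> T \<or> meet (Some -` T) = {} then 1 else 0)"

lemma cone_rank_simps:
  "cone_rank (Some ` S) = n - direction_dim S + (if meet S = {} then 1 else 0)"
  "cone_rank (insert None (Some ` S)) = n - direction_dim S + 1"
proof -
  have "Some -` (Some ` S) = S" "Some -` (insert None (Some ` S)) = S" by auto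
  then show "cone_rank (Some ` S) = n - direction_dim S + (if meet S = {} then 1 else 0)"
    "cone_rank (insert None (Some ` S)) = n - direction_dim S + 1" by (auto simp: cone_rank_def)
qed

lemma cone_rank_insert_None:
  "cone_rank (insert None T) = (if None \<in> T \<or> meet (Some -` T) = {} then cone_rank T else Suc (cone_rank T))"
proof -
  have "Some -` (insert None T) = Some -` T" by auto
  then show ?thesis by (auto simp: cone_rank_def)
qed

text \<open>The rank does not grow iff \<open>\<alpha>\<^sub>i\<close> depends on the normals already present and, unless \<open>(0, 1)\<close>
  is in their span, the new equation is consistent with the old ones.\<close>

lemma cone_rank_insert_Some:
  assumes T: "T \<subseteq> insert None (Some ` I)" and i: "i \<in> I"
  shows "cone_rank (insert (Some i) T) =
    (if \<not> (\<exists>d\<in>directions (Some -` T). \<alpha> i \<bullet> d \<noteq> 0) \<and>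
        (None \<in> T \<or> meet (Some -` T) = {} \<or> meet (insert i (Some -` T)) \<noteq> {})
     then cone_rank T else Suc (cone_rank T))"
proof -
  let ?S = "Some -` T"
  have S: "?S \<subseteq> I" using T by auto
  have eq: "Some -` (insert (Some i) T) = insert i ?S" by auto
  have empty: "meet (insert i ?S) = {}" if "meet ?S = {}"
    using that by (auto simp: meet_iff set_eq_iff)
  show ?thesis
  proof (cases "\<exists>d\<in>directions ?S. \<alpha> i \<bullet> d \<noteq> 0")
    case True
    have "direction_dim ?S = Suc (direction_dim (insert i ?S))"
      by (rule direction_dim_insert[OF S i True])
    moreover have "direction_dim ?S \<le> n" by (rule direction_dim_le[OF S])
    moreover have "meet (insert i ?S) = {} \<longleftrightarrow> meet ?S = {}"
      using meet_insert_nonempty[OF S i _ True] empty by blast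
    ultimately show ?thesis using True by (simp add: cone_rank_def eq)
  next
    case False
    have "directions (insert i ?S) = directions ?S" by (rule directions_insert_eq[OF False])
    moreover have "meet (insert i ?S) = {} \<or> meet (insert i ?S) = meet ?S"
      using meet_insert_eq[OF S i False] by blast
    ultimately show ?thesis using False empty
      by (cases "meet ?S = {}"; cases "meet (insert i ?S) = {}") (simp_all add: cone_rank_def eq)
  qed
qed

lemma rank_matroid_cone_rank: "rank_matroid (insert None (Some ` I)) cone_rank"
proof
  show "finite (insert None (Some ` I))" using finite_family by simp
  have "meet {} \<noteq> {}" unfolding meet_empty using zero_carrier_vec by blast
  then show "cone_rank {} = 0" using cone_rank_simps(1)[of "{}"] direction_dim_empty by simp
  fix S x assume S: "S \<subseteq> insert None (Some ` I)" and x: "x \<in> insert None (Some ` I)"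
  show "cone_rank (insert x S) = cone_rank S \<or> cone_rank (insert x S) = Suc (cone_rank S)"
  proof (cases x)
    case None
    then show ?thesis by (simp add: cone_rank_insert_None)
  next
    case (Some i)
    then have "i \<in> I" using x by auto
    then show ?thesis unfolding Some cone_rank_insert_Some[OF S \<open>i \<in> I\<close>] by simp
  qed
next
  fix S T x assume ST: "S \<subseteq> T" and T: "T \<subseteq> insert None (Some ` I)" and x: "x \<in> insert None (Some ` I)"
    and eq: "cone_rank (insert x S) = cone_rank S"
  have S: "S \<subseteq> insert None (Some ` I)" using ST T by auto
  let ?S = "Some -` S" and ?T = "Some -` T"
  have ST': "?S \<subseteq> ?T" using ST by auto
  have meet: "meet ?T \<subseteq> meet ?S" by (rule meet_antimono[OF ST'])
  have dir: "directions ?T \<subseteq> directions ?S" by (rule directions_antimono[OF ST'])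
  show "cone_rank (insert x T) = cone_rank T"
  proof (cases x)
    case None
    then show ?thesis using eq ST meet by (auto simp: cone_rank_insert_None split: if_splits)
  next
    case (Some i)
    then have i: "i \<in> I" using x by auto
    have S1: "\<not> (\<exists>d\<in>directions ?S. \<alpha> i \<bullet> d \<noteq> 0)"
      and S2: "None \<in> S \<or> meet ?S = {} \<or> meet (insert i ?S) \<noteq> {}"
      using eq unfolding Some cone_rank_insert_Some[OF S i] by (auto split: if_splits)
    have T1: "\<not> (\<exists>d\<in>directions ?T. \<alpha> i \<bullet> d \<noteq> 0)" using S1 dir by blast
    have "None \<in> T \<or> meet ?T = {} \<or> meet (insert i ?T) \<noteq> {}"
    proof (rule ccontr)
      assume neg: "\<not> ?thesis"
      then obtain p where p: "p \<in> meet ?T" by blast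
      have "meet (insert i ?S) \<noteq> {}" using S2 neg ST meet by auto
      then have "meet (insert i ?S) = meet ?S" using S i S1 by (intro meet_insert_eq) auto
      then have "p \<in> meet (insert i ?S)" using p meet by auto
      then have "p \<in> meet (insert i ?T)" using p by (auto simp: meet_iff)
      then show False using neg by blast
    qed
    then show ?thesis unfolding Some cone_rank_insert_Some[OF T i] using T1 by simp
  qed
qed

lemma meet_psubset_dim:
  assumes S: "S \<subseteq> I" and T: "T \<subseteq> I" and ne: "meet S \<noteq> {}" and sub: "meet S \<subset> meet T"
  shows "direction_dim S < direction_dim T"
proof -
  have ST: "S \<union> T \<subseteq> I" using S T by auto
  have eq: "meet (S \<union> T) = meet S" using sub by (auto simp: meet_Un)
  have dS: "directions (S \<union> T) = directions S"
    using directions_meet[OF S ne] directions_meet[OF ST] ne unfolding eq by simp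
  have le: "direction_dim S \<le> direction_dim T"
    using direction_dim_antimono[of T "S \<union> T"] ST dS by simp
  moreover have "direction_dim S \<noteq> direction_dim T"
  proof
    assume "direction_dim S = direction_dim T"
    then have "directions T = directions S" using direction_dim_antimono[of T "S \<union> T"] ST dS by simp
    moreover obtain p where p: "p \<in> meet S" using ne by blast
    moreover have "p \<in> meet T" using p sub by auto
    ultimately have "meet T = meet S" using meet_translate[OF S p] meet_translate[OF T] by blast
    then show False using sub by simp
  qed
  ultimately show ?thesis by simp
qed

lemma intersection_poset_eq: "intersection_poset n (hyp ` I) = {meet S | S. S \<subseteq> I \<and> meet S \<noteq> {}}"
  unfolding intersection_poset_def meet_def by (auto simp: subset_image_iff)

text \<open>A hyperplane whose normal does not vanish on the current directions cuts the flat down to a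
  smaller one, of dimension one less.\<close>

lemma chain_exists:
  assumes "S \<subseteq> I" "meet S \<noteq> {}"
  shows "\<exists>C. subset.chain (intersection_poset n (hyp ` I)) C \<and> finite C \<and>
    card C = Suc (n - direction_dim S) \<and> (\<forall>X\<in>C. meet S \<subseteq> X)"
proof -
  have "finite S" using assms finite_family finite_subset by blast
  then show ?thesis using assms
  proof (induction S)
    case empty
    have "subset.chain (intersection_poset n (hyp ` I)) {meet {}}"
      unfolding subset_chain_def intersection_poset_eq using empty by auto
    then show ?case using direction_dim_empty by (intro exI[of _ "{meet {}}"]) auto
  next
    case (insert i S)
    have S: "S \<subseteq> I" "i \<in> I" using insert.prems by auto
    have sub: "meet (insert i S) \<subseteq> meet S" by (auto simp: meet_iff)
    then have ne: "meet S \<noteq> {}" using insert.prems by auto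
    obtain C where C: "subset.chain (intersection_poset n (hyp ` I)) C" "finite C"
        "card C = Suc (n - direction_dim S)" "\<forall>X\<in>C. meet S \<subseteq> X"
      using insert.IH[OF S(1) ne] by blast
    show ?case
    proof (cases "\<exists>d\<in>directions S. \<alpha> i \<bullet> d \<noteq> 0")
      case False
      then show ?thesis using C sub directions_insert_eq[OF False] by (intro exI[of _ C]) auto
    next
      case True
      have d: "direction_dim S = Suc (direction_dim (insert i S))"
        by (rule direction_dim_insert[OF S True])
      have "meet (insert i S) \<noteq> meet S"
      proof
        assume "meet (insert i S) = meet S"
        then have "directions (insert i S) = directions S"
          using directions_meet[OF S(1) ne] directions_meet[OF insert.prems] by simp
        then show False using d by simp
      qed
      then have "meet (insert i S) \<notin> C" using C(4) sub by blast
      moreover have "subset.chain (intersection_poset n (hyp ` I)) (insert (meet (insert i S)) C)"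
        using C(1,4) sub insert.prems unfolding subset_chain_def intersection_poset_eq by blast
      ultimately show ?thesis
        using C d sub direction_dim_le[OF S(1)]
        by (intro exI[of _ "insert (meet (insert i S)) C"]) auto
    qed
  qed
qed

text \<open>Dimension is injective on a chain of flats, with values in \<open>{0..n}\<close>; a chain of \<open>n + 1\<close> flats
  therefore contains a point.\<close>

lemma chain_card:
  assumes C: "subset.chain (intersection_poset n (hyp ` I)) C"
  shows "card C \<le> Suc n"
    and "card C = Suc n \<Longrightarrow> \<exists>S\<subseteq>I. meet S \<noteq> {} \<and> direction_dim S = 0"
proof -
  define \<delta> where "\<delta> X = subspace_dim n {x - y | x y. x \<in> X \<and> y \<in> X}" for X
  have \<delta>: "\<delta> (meet S) = direction_dim S" if "S \<subseteq> I" "meet S \<noteq> {}" for S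
    unfolding \<delta>_def directions_meet[OF that] ..
  have CL: "\<exists>S\<subseteq>I. X = meet S \<and> meet S \<noteq> {}" if "X \<in> C" for X
    using C that unfolding subset_chain_def intersection_poset_eq by blast
  have inj: "inj_on \<delta> C"
  proof (rule inj_onI)
    fix X Y assume XY: "X \<in> C" "Y \<in> C" "\<delta> X = \<delta> Y"
    obtain S T where S: "S \<subseteq> I" "X = meet S" "meet S \<noteq> {}" and T: "T \<subseteq> I" "Y = meet T" "meet T \<noteq> {}"
      using CL[OF XY(1)] CL[OF XY(2)] by blast
    have "direction_dim S = direction_dim T" using XY(3) \<delta> S T by simp
    moreover have "X \<subseteq> Y \<or> Y \<subseteq> X" using C XY(1,2) unfolding subset_chain_def by blast
    moreover have "\<not> X \<subset> Y" "\<not> Y \<subset> X"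
      using meet_psubset_dim[OF S(1) T(1) S(3)] meet_psubset_dim[OF T(1) S(1) T(3)] S(2) T(2) calculation(1)
      by auto
    ultimately show "X = Y" by blast
  qed
  have sub: "\<delta> ` C \<subseteq> {..n}"
  proof
    fix k assume "k \<in> \<delta> ` C"
    then obtain S where "S \<subseteq> I" "meet S \<noteq> {}" "k = \<delta> (meet S)" using CL by blast
    then show "k \<in> {..n}" using \<delta> direction_dim_le by simp
  qed
  have "card (\<delta> ` C) \<le> card {..n}" by (rule card_mono[OF _ sub]) simp
  then show "card C \<le> Suc n" using card_image[OF inj] by simp
  assume "card C = Suc n"
  then have "card (\<delta> ` C) = card {..n}" using card_image[OF inj] by simp
  then have "\<delta> ` C = {..n}" using card_subset_eq[OF _ sub] by simp
  then have "0 \<in> \<delta> ` C" by simp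
  then obtain X where "X \<in> C" "\<delta> X = 0" by auto
  then obtain S where "S \<subseteq> I" "X = meet S" "meet S \<noteq> {}" using CL by blast
  then show "\<exists>S\<subseteq>I. meet S \<noteq> {} \<and> direction_dim S = 0" using \<delta> \<open>\<delta> X = 0\<close> by auto
qed

text \<open>If \<open>d\<close> is the least dimension of a flat, a longest chain of flats has \<open>n - d\<close> steps.\<close>

lemma poset_rank_iff:
  "poset_rank (intersection_poset n (hyp ` I)) = n \<longleftrightarrow> (\<exists>S\<subseteq>I. meet S \<noteq> {} \<and> direction_dim S = 0)"
proof -
  let ?L = "intersection_poset n (hyp ` I)"
  let ?V = "{card C - 1 | C. subset.chain ?L C}"
  have bound: "v \<le> n" if "v \<in> ?V" for v using that chain_card(1) by fastforce
  then have fin: "finite ?V" by (meson finite_nat_set_iff_bounded_le)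
  have "subset.chain ?L {}" by (simp add: subset_chain_def)
  then have ne: "?V \<noteq> {}" by blast
  have Max: "poset_rank ?L = Max ?V" by (simp add: poset_rank_def)
  show ?thesis
  proof
    assume "poset_rank ?L = n"
    then have "n \<in> ?V" using Max_in[OF fin ne] Max by simp
    then obtain C where C: "subset.chain ?L C" "n = card C - 1" by blast
    show "\<exists>S\<subseteq>I. meet S \<noteq> {} \<and> direction_dim S = 0"
    proof (cases "n = 0")
      case True
      have "meet {} \<noteq> {}" unfolding meet_empty using zero_carrier_vec by blast
      then show ?thesis using direction_dim_empty True by (intro exI[of _ "{}"]) auto
    next
      case False
      then have "card C = Suc n" using C(2) by simp
      then show ?thesis by (rule chain_card(2)[OF C(1)])
    qed
  next
    assume "\<exists>S\<subseteq>I. meet S \<noteq> {} \<and> direction_dim S = 0"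
    then obtain S where S: "S \<subseteq> I" "meet S \<noteq> {}" "direction_dim S = 0" by blast
    obtain C where "subset.chain ?L C" "card C = Suc n" using chain_exists[OF S(1,2)] S(3) by auto
    then have "n \<in> ?V" by force
    then have "n \<le> Max ?V" by (rule Max_ge[OF fin])
    moreover have "Max ?V \<le> n" by (rule bound[OF Max_in[OF fin ne]])
    ultimately show "poset_rank ?L = n" using Max by simp
  qed
qed

end

section \<open>Reducible arrangements\<close>

lemma parametrized_trivial_iff:
  assumes "parametrized n k D" shows "D = {0\<^sub>v n} \<longleftrightarrow> k = 0"
proof -
  obtain Q where Q: "Q \<in> carrier_mat n k" and D: "D = (\<lambda>y. Q *\<^sub>v y) ` carrier_vec k"
    and inj: "\<And>y. y \<in> carrier_vec k \<Longrightarrow> Q *\<^sub>v y = 0\<^sub>v n \<Longrightarrow> y = 0\<^sub>v k"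
    by (rule parametrizedE[OF assms]) blast
  show ?thesis
  proof
    assume D0: "D = {0\<^sub>v n}"
    show "k = 0"
    proof (rule ccontr)
      assume "k \<noteq> 0"
      have "Q *\<^sub>v unit_vec k 0 \<in> D" unfolding D by simp
      then have "unit_vec k 0 = (0\<^sub>v k :: complex vec)" using D0 by (intro inj) auto
      then have "unit_vec k 0 $ 0 = (0\<^sub>v k $ 0 :: complex)" by simp
      then show False using \<open>k \<noteq> 0\<close> by simp
    qed
  next
    assume k: "k = 0"
    have "carrier_vec k = {0\<^sub>v k :: complex vec}" unfolding k by auto
    moreover have "Q *\<^sub>v 0\<^sub>v k = 0\<^sub>v n" using Q by auto
    ultimately show "D = {0\<^sub>v n}" unfolding D by simp
  qed
qed

lemma four_block_row_mult:
  fixes Q1 Q2 :: "complex mat"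
  assumes "Q1 \<in> carrier_mat n n1" "Q2 \<in> carrier_mat n n2" "y1 \<in> carrier_vec n1" "y2 \<in> carrier_vec n2"
  shows "four_block_mat Q1 Q2 (0\<^sub>m 0 n1) (0\<^sub>m 0 n2) *\<^sub>v (y1 @\<^sub>v y2) = Q1 *\<^sub>v y1 + Q2 *\<^sub>v y2"
proof -
  have "four_block_mat Q1 Q2 (0\<^sub>m 0 n1) (0\<^sub>m 0 n2) *\<^sub>v (y1 @\<^sub>v y2) =
      (Q1 *\<^sub>v y1 + Q2 *\<^sub>v y2) @\<^sub>v (0\<^sub>m 0 n1 *\<^sub>v y1 + 0\<^sub>m 0 n2 *\<^sub>v y2)"
    by (rule four_block_mat_mult_vec[OF assms(1,2) zero_carrier_mat zero_carrier_mat assms(3,4)])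
  also have "\<dots> = Q1 *\<^sub>v y1 + Q2 *\<^sub>v y2" using assms by (intro eq_vecI) auto
  finally show ?thesis .
qed

lemma injective_square_mat_inverse:
  fixes M :: "complex mat"
  assumes M: "M \<in> carrier_mat n n" and inj: "\<And>y. y \<in> carrier_vec n \<Longrightarrow> M *\<^sub>v y = 0\<^sub>v n \<Longrightarrow> y = 0\<^sub>v n"
  obtains P where "P \<in> carrier_mat n n" "P * M = 1\<^sub>m n" "M * P = 1\<^sub>m n" "invertible_mat P"
proof -
  have "det M \<noteq> 0" using det_0_iff_vec_prod_zero_field[OF M] inj by blast
  from det_non_zero_imp_unit[OF M this, of "()"]
  obtain P where P: "P \<in> carrier_mat n n" "P * M = 1\<^sub>m n" "M * P = 1\<^sub>m n"
    unfolding Units_def by (auto simp: ring_mat_simps)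
  moreover have "invertible_mat P"
    using P M unfolding invertible_mat_def inverts_mat_def by (auto intro!: exI[of _ M])
  ultimately show thesis by (rule that)
qed

context hyperplane_family
begin

lemma directions_zero_iff: "S \<subseteq> I \<Longrightarrow> directions S = {0\<^sub>v n} \<longleftrightarrow> direction_dim S = 0"
  by (rule parametrized_trivial_iff[OF parametrized_directions])

lemma normal_zero:
  assumes "i \<in> I" "\<And>x. x \<in> carrier_vec n \<Longrightarrow> \<alpha> i \<bullet> x = 0"
  shows "\<alpha> i = 0\<^sub>v n"
proof (rule eq_vecI)
  fix j assume "j < dim_vec (0\<^sub>v n :: complex vec)"
  then have j: "j < n" by simp
  have "\<alpha> i \<bullet> unit_vec n j = \<alpha> i $ j" using normal_carrier[OF assms(1)] j by simp
  then show "\<alpha> i $ j = 0\<^sub>v n $ j" using assms(2)[of "unit_vec n j"] j by simp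
qed (use normal_carrier[OF assms(1)] in simp)

lemma pullback_normal:
  assumes Q: "Q \<in> carrier_mat n m" and i: "i \<in> I"
  shows "transpose_mat Q *\<^sub>v \<alpha> i \<in> carrier_vec m"
    and "y \<in> carrier_vec m \<Longrightarrow> \<alpha> i \<bullet> (Q *\<^sub>v y) = (transpose_mat Q *\<^sub>v \<alpha> i) \<bullet> y"
  using transpose_vec_mult_scalar[OF Q _ normal_carrier[OF i]]
    mult_mat_vec_carrier[OF _ normal_carrier[OF i], of "transpose_mat Q" m] Q by auto

text \<open>A factor of a product, as the restriction of the hyperplanes in \<open>S\<close> to a complement of their
  common directions, with linear coordinates given by \<open>Q\<close>. It is essential because the hyperplanes
  outside \<open>S\<close> do not constrain directions in that complement: if \<open>B\<close> cuts out a point, then \<open>B \<inter> S\<close>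
  cuts out a point there.\<close>

lemma arrangement_pullback:
  assumes nz: "\<And>i. i \<in> S \<Longrightarrow> \<alpha> i \<noteq> 0\<^sub>v n" and SI: "S \<subseteq> I"
    and Q: "Q \<in> carrier_mat n m" and inj: "\<And>y. y \<in> carrier_vec m \<Longrightarrow> Q *\<^sub>v y = 0\<^sub>v n \<Longrightarrow> y = 0\<^sub>v m"
    and vanish: "\<And>i y. i \<in> I - S \<Longrightarrow> y \<in> carrier_vec m \<Longrightarrow> \<alpha> i \<bullet> (Q *\<^sub>v y) = 0"
    and compl: "\<And>x. x \<in> carrier_vec n \<Longrightarrow> \<exists>y\<in>carrier_vec m. \<exists>d\<in>directions S. x = Q *\<^sub>v y + d"
    and B: "B \<subseteq> I" "meet B \<noteq> {}" "directions B = {0\<^sub>v n}"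
  defines "\<alpha>' \<equiv> \<lambda>i. transpose_mat Q *\<^sub>v \<alpha> i"
  shows "arrangement m (hyperplane_family.hyp m \<alpha>' \<beta> ` S)"
proof -
  have \<alpha>': "\<alpha>' i \<in> carrier_vec m" "\<And>y. y \<in> carrier_vec m \<Longrightarrow> \<alpha> i \<bullet> (Q *\<^sub>v y) = \<alpha>' i \<bullet> y" if "i \<in> I" for i
    unfolding \<alpha>'_def using pullback_normal[OF Q that] by auto
  interpret F: hyperplane_family m S \<alpha>' \<beta>
    by unfold_locales (use finite_family SI finite_subset \<alpha>'(1) in auto)
  have Qc: "Q *\<^sub>v y \<in> carrier_vec n" if "y \<in> carrier_vec m" for y by (rule mult_mat_vec_carrier[OF Q that])
  have split: "\<alpha> i \<bullet> (Q *\<^sub>v y + d) = \<alpha>' i \<bullet> y"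
    if "i \<in> S" "y \<in> carrier_vec m" "d \<in> directions S" for i y d
  proof -
    have i: "i \<in> I" and d: "d \<in> carrier_vec n" "\<alpha> i \<bullet> d = 0" using that SI unfolding directions_def by auto
    show ?thesis using normal_scalar(1)[OF i Qc[OF that(2)] d(1)] d(2) \<alpha>'(2)[OF i that(2)] by simp
  qed
  have nz': "\<alpha>' i \<noteq> 0\<^sub>v m" if i: "i \<in> S" for i
  proof
    assume 0: "\<alpha>' i = 0\<^sub>v m"
    have "\<alpha> i \<bullet> x = 0" if "x \<in> carrier_vec n" for x using compl[OF that] split[OF i] 0 by auto
    then show False using normal_zero[of i] nz i SI by auto
  qed
  show ?thesis
    unfolding arrangement_def
  proof (intro conjI ballI)
    show "finite (F.hyp ` S)" using F.finite_family by simp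
    show "affine_hyperplane m H" if "H \<in> F.hyp ` S" for H
      using that nz' F.normal_carrier unfolding affine_hyperplane_def F.hyp_def by blast
    show "poset_rank (intersection_poset m (F.hyp ` S)) = m"
      unfolding F.poset_rank_iff
    proof (intro exI[of _ "B \<inter> S"] conjI)
      obtain q where q: "q \<in> meet B" using B(2) by blast
      have qc: "q \<in> carrier_vec n" using q by (simp add: meet_iff)
      obtain y d where y: "y \<in> carrier_vec m" "d \<in> directions S" "q = Q *\<^sub>v y + d"
        using compl[OF qc] by auto
      have "\<alpha>' i \<bullet> y = \<beta> i" if "i \<in> B \<inter> S" for i
      proof -
        have "i \<in> S" "\<alpha> i \<bullet> q = \<beta> i" using that q by (auto simp: meet_iff)
        then show ?thesis using split[OF _ y(1,2)] unfolding y(3) by simp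
      qed
      then have "y \<in> F.meet (B \<inter> S)" using y(1) by (simp add: F.meet_iff)
      then show "F.meet (B \<inter> S) \<noteq> {}" by blast
      have "v = 0\<^sub>v m" if v: "v \<in> F.directions (B \<inter> S)" for v
      proof -
        have vc: "v \<in> carrier_vec m" using v by (simp add: F.directions_def)
        have "\<alpha> i \<bullet> (Q *\<^sub>v v) = 0" if i: "i \<in> B" for i
        proof (cases "i \<in> S")
          case True
          then have "\<alpha>' i \<bullet> v = 0" using v i unfolding F.directions_def by blast
          then show ?thesis using \<alpha>'(2)[of i v] vc i B(1) by auto
        next
          case False
          then show ?thesis using vanish[of i v] i B(1) vc by auto
        qed
        then have "Q *\<^sub>v v \<in> directions B" using Qc[OF vc] by (simp add: directions_def)
        then show ?thesis using B(3) inj[OF vc] by simp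
      qed
      moreover have "0\<^sub>v m \<in> F.directions (B \<inter> S)" using F.normal_carrier by (simp add: F.directions_def)
      ultimately have "F.directions (B \<inter> S) = {0\<^sub>v m}" by blast
      then show "F.direction_dim (B \<inter> S) = 0"
        using parametrized_trivial_iff[OF F.parametrized_directions[of "B \<inter> S"]] by simp
    qed simp
  qed
qed

text \<open>The directions of \<open>S\<close> and of \<open>T\<close> intersect trivially, since \<open>B\<close> cuts out a point, and by their
  dimensions they span the whole space. In coordinates \<open>y1\<close> on \<open>directions T\<close> and \<open>y2\<close> on
  \<open>directions S\<close> the equations of \<open>S\<close> involve only \<open>y1\<close>, because their normals vanish on
  \<open>directions S\<close>, and those of \<open>T\<close> only \<open>y2\<close>.\<close>

lemma reducible_if_directions_split:
  assumes nz: "\<And>i. i \<in> I \<Longrightarrow> \<alpha> i \<noteq> 0\<^sub>v n"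
    and ST: "S \<union> T = I" and dim: "direction_dim S + direction_dim T = n"
    and pos: "0 < direction_dim S" "0 < direction_dim T"
    and B: "B \<subseteq> I" "meet B \<noteq> {}" "direction_dim B = 0"
  shows "\<not> irreducible_arrangement n (hyp ` I)"
proof -
  have SI: "S \<subseteq> I" and TI: "T \<subseteq> I" using ST by auto
  define n1 n2 where "n1 = direction_dim T" and "n2 = direction_dim S"
  have n: "n1 + n2 = n" using dim by (simp add: n1_def n2_def)
  obtain Q1 where Q1: "Q1 \<in> carrier_mat n n1" "directions T = (\<lambda>y. Q1 *\<^sub>v y) ` carrier_vec n1"
    and inj1: "\<And>y. y \<in> carrier_vec n1 \<Longrightarrow> Q1 *\<^sub>v y = 0\<^sub>v n \<Longrightarrow> y = 0\<^sub>v n1"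
    using parametrizedE[OF parametrized_directions[OF TI]] unfolding n1_def by blast
  obtain Q2 where Q2: "Q2 \<in> carrier_mat n n2" "directions S = (\<lambda>y. Q2 *\<^sub>v y) ` carrier_vec n2"
    and inj2: "\<And>y. y \<in> carrier_vec n2 \<Longrightarrow> Q2 *\<^sub>v y = 0\<^sub>v n \<Longrightarrow> y = 0\<^sub>v n2"
    using parametrizedE[OF parametrized_directions[OF SI]] unfolding n2_def by blast
  have Qc: "Q1 *\<^sub>v y1 \<in> carrier_vec n" if "y1 \<in> carrier_vec n1" for y1
    by (rule mult_mat_vec_carrier[OF Q1(1) that])
  have Qc2: "Q2 *\<^sub>v y2 \<in> carrier_vec n" if "y2 \<in> carrier_vec n2" for y2
    by (rule mult_mat_vec_carrier[OF Q2(1) that])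
  have dir: "Q1 *\<^sub>v y1 \<in> directions T" "Q2 *\<^sub>v y2 \<in> directions S"
    if "y1 \<in> carrier_vec n1" "y2 \<in> carrier_vec n2" for y1 y2
    using that Q1(2) Q2(2) by blast+
  have z1: "\<alpha> i \<bullet> (Q1 *\<^sub>v y) = 0" if "i \<in> T" "y \<in> carrier_vec n1" for i y
    using that Q1(2) unfolding directions_def by blast
  have z2: "\<alpha> i \<bullet> (Q2 *\<^sub>v y) = 0" if "i \<in> S" "y \<in> carrier_vec n2" for i y
    using that Q2(2) unfolding directions_def by blast
  have dirB: "directions B = {0\<^sub>v n}" using directions_zero_iff[OF B(1)] B(3) by simp
  have dir0: "d = 0\<^sub>v n" if "d \<in> directions S" "d \<in> directions T" for d
  proof -
    have "d \<in> directions B" using that B(1) ST unfolding directions_def by blast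
    then show ?thesis using dirB by simp
  qed
  define M where "M = four_block_mat Q1 Q2 (0\<^sub>m 0 n1) (0\<^sub>m 0 n2)"
  have M: "M \<in> carrier_mat n n" unfolding M_def using Q1(1) Q2(1) n by auto
  have My: "M *\<^sub>v (y1 @\<^sub>v y2) = Q1 *\<^sub>v y1 + Q2 *\<^sub>v y2" if "y1 \<in> carrier_vec n1" "y2 \<in> carrier_vec n2" for y1 y2
    unfolding M_def by (rule four_block_row_mult[OF Q1(1) Q2(1) that])
  have app: "\<exists>y1\<in>carrier_vec n1. \<exists>y2\<in>carrier_vec n2. y = y1 @\<^sub>v y2" if "y \<in> carrier_vec n" for y :: "complex vec"
    using vec_first_last_append[of y n1 n2] that n by (metis vec_first_carrier vec_last_carrier)
  have "y = 0\<^sub>v n" if y: "y \<in> carrier_vec n" "M *\<^sub>v y = 0\<^sub>v n" for y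
  proof -
    obtain y1 y2 where y12: "y1 \<in> carrier_vec n1" "y2 \<in> carrier_vec n2" "y = y1 @\<^sub>v y2" using app y(1) by blast
    have sum0: "Q1 *\<^sub>v y1 + Q2 *\<^sub>v y2 = 0\<^sub>v n" using My[OF y12(1,2)] y(2) y12(3) by simp
    have "\<alpha> i \<bullet> (Q1 *\<^sub>v y1) = 0" if i: "i \<in> S" for i
    proof -
      have iI: "i \<in> I" using i SI by auto
      have "\<alpha> i \<bullet> (Q1 *\<^sub>v y1) + \<alpha> i \<bullet> (Q2 *\<^sub>v y2) = 0"
        unfolding normal_scalar(1)[OF iI Qc[OF y12(1)] Qc2[OF y12(2)], symmetric] sum0
        using normal_carrier[OF iI] by simp
      then show ?thesis using z2[OF i y12(2)] by simp
    qed
    then have "Q1 *\<^sub>v y1 \<in> directions S" using Qc[OF y12(1)] by (simp add: directions_def)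
    then have Q10: "Q1 *\<^sub>v y1 = 0\<^sub>v n" using dir0 dir(1)[OF y12(1,2)] by blast
    then have "Q2 *\<^sub>v y2 = 0\<^sub>v n" using sum0 Qc2[OF y12(2)] by simp
    then have "y1 = 0\<^sub>v n1" "y2 = 0\<^sub>v n2" using inj1[OF y12(1) Q10] inj2[OF y12(2)] by auto
    then show ?thesis unfolding y12(3) using n by (intro eq_vecI) auto
  qed
  then obtain P where P: "P \<in> carrier_mat n n" "P * M = 1\<^sub>m n" "M * P = 1\<^sub>m n" "invertible_mat P"
    using injective_square_mat_inverse[OF M] by blast
  have Pc: "P *\<^sub>v x \<in> carrier_vec n" if "x \<in> carrier_vec n" for x by (rule mult_mat_vec_carrier[OF P(1) that])
  have M_surj: "\<exists>y1\<in>carrier_vec n1. \<exists>y2\<in>carrier_vec n2. x = Q1 *\<^sub>v y1 + Q2 *\<^sub>v y2"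
    if x: "x \<in> carrier_vec n" for x
  proof -
    obtain y1 y2 where y: "y1 \<in> carrier_vec n1" "y2 \<in> carrier_vec n2" "P *\<^sub>v x = y1 @\<^sub>v y2"
      using app[OF Pc[OF x]] by blast
    have "Q1 *\<^sub>v y1 + Q2 *\<^sub>v y2 = M *\<^sub>v (P *\<^sub>v x)" unfolding y(3) My[OF y(1,2)] ..
    also have "\<dots> = (M * P) *\<^sub>v x" using assoc_mult_mat_vec[OF M P(1) x] by simp
    also have "\<dots> = x" unfolding P(3) using x by simp
    finally show ?thesis using y(1,2) by blast
  qed
  define f where "f = (\<lambda>x. P *\<^sub>v x + 0\<^sub>v n)"
  define g where "g y1 y2 = Q1 *\<^sub>v y1 + Q2 *\<^sub>v y2" for y1 y2
  have gc: "g y1 y2 \<in> carrier_vec n" if "y1 \<in> carrier_vec n1" "y2 \<in> carrier_vec n2" for y1 y2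
    unfolding g_def using Qc Qc2 that by simp
  have fg: "f (g y1 y2) = y1 @\<^sub>v y2" if y: "y1 \<in> carrier_vec n1" "y2 \<in> carrier_vec n2" for y1 y2
  proof -
    have yc: "y1 @\<^sub>v y2 \<in> carrier_vec n" using y n by auto
    have "P *\<^sub>v (M *\<^sub>v (y1 @\<^sub>v y2)) = (P * M) *\<^sub>v (y1 @\<^sub>v y2)"
      using assoc_mult_mat_vec[OF P(1) M yc] by simp
    also have "\<dots> = y1 @\<^sub>v y2" unfolding P(2) using yc by simp
    finally have PM: "P *\<^sub>v (M *\<^sub>v (y1 @\<^sub>v y2)) = y1 @\<^sub>v y2" .
    show ?thesis unfolding f_def g_def My[OF y, symmetric] PM using yc by simp
  qed
  have g_surj: "\<exists>y1\<in>carrier_vec n1. \<exists>y2\<in>carrier_vec n2. x = g y1 y2" if "x \<in> carrier_vec n" for x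
    unfolding g_def by (rule M_surj[OF that])
  define \<alpha>1 where "\<alpha>1 = (\<lambda>i. transpose_mat Q1 *\<^sub>v \<alpha> i)"
  define \<alpha>2 where "\<alpha>2 = (\<lambda>i. transpose_mat Q2 *\<^sub>v \<alpha> i)"
  interpret F1: hyperplane_family n1 S \<alpha>1 \<beta>
    by unfold_locales (use finite_family SI finite_subset pullback_normal(1)[OF Q1(1)] in \<open>auto simp: \<alpha>1_def\<close>)
  interpret F2: hyperplane_family n2 T \<alpha>2 \<beta>
    by unfold_locales (use finite_family TI finite_subset pullback_normal(1)[OF Q2(1)] in \<open>auto simp: \<alpha>2_def\<close>)
  have compl: "\<exists>y\<in>carrier_vec n1. \<exists>d\<in>directions S. x = Q1 *\<^sub>v y + d"
    "\<exists>y\<in>carrier_vec n2. \<exists>d\<in>directions T. x = Q2 *\<^sub>v y + d" if x: "x \<in> carrier_vec n" for x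
  proof -
    obtain y1 y2 where y: "y1 \<in> carrier_vec n1" "y2 \<in> carrier_vec n2" "x = Q1 *\<^sub>v y1 + Q2 *\<^sub>v y2"
      using M_surj[OF x] by blast
    moreover have "x = Q2 *\<^sub>v y2 + Q1 *\<^sub>v y1"
      unfolding y(3) by (rule comm_add_vec[OF Qc[OF y(1)] Qc2[OF y(2)]])
    ultimately show "\<exists>y\<in>carrier_vec n1. \<exists>d\<in>directions S. x = Q1 *\<^sub>v y + d"
      "\<exists>y\<in>carrier_vec n2. \<exists>d\<in>directions T. x = Q2 *\<^sub>v y + d" using dir by blast+
  qed
  have arr1: "arrangement n1 (F1.hyp ` S)"
    unfolding \<alpha>1_def
    by (rule arrangement_pullback[OF nz SI Q1(1) inj1 _ compl(1) B(1,2) dirB]) (use SI ST z1 in auto)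
  have arr2: "arrangement n2 (F2.hyp ` T)"
    unfolding \<alpha>2_def
    by (rule arrangement_pullback[OF nz TI Q2(1) inj2 _ compl(2) B(1,2) dirB]) (use TI ST z2 in auto)
  have \<alpha>g: "\<alpha> i \<bullet> g v w = \<alpha> i \<bullet> (Q1 *\<^sub>v v) + \<alpha> i \<bullet> (Q2 *\<^sub>v w)"
    if "i \<in> I" "v \<in> carrier_vec n1" "w \<in> carrier_vec n2" for i v w
    unfolding g_def using normal_scalar(1)[OF that(1)] Qc Qc2 that by simp
  have image: "f ` hyp i = {v @\<^sub>v w | v w. v \<in> X \<and> w \<in> Y}"
    if XY: "X \<subseteq> carrier_vec n1" "Y \<subseteq> carrier_vec n2"
      and mem: "\<And>v w. v \<in> carrier_vec n1 \<Longrightarrow> w \<in> carrier_vec n2 \<Longrightarrow> g v w \<in> hyp i \<longleftrightarrow> v \<in> X \<and> w \<in> Y"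
    for i X Y
  proof (intro equalityI subsetI)
    fix u assume "u \<in> f ` hyp i"
    then obtain x where x: "x \<in> hyp i" "u = f x" by blast
    then have "x \<in> carrier_vec n" by (simp add: hyp_def)
    then obtain v w where "v \<in> carrier_vec n1" "w \<in> carrier_vec n2" "x = g v w" using g_surj by blast
    then show "u \<in> {v @\<^sub>v w | v w. v \<in> X \<and> w \<in> Y}" using mem fg x by blast
  next
    fix u assume "u \<in> {v @\<^sub>v w | v w. v \<in> X \<and> w \<in> Y}"
    then obtain v w where vw: "v \<in> X" "w \<in> Y" "u = v @\<^sub>v w" by blast
    then have "v \<in> carrier_vec n1" "w \<in> carrier_vec n2" using XY by auto
    then have "g v w \<in> hyp i" "f (g v w) = u" using mem fg vw by blast+
    then show "u \<in> f ` hyp i" by blast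
  qed
  have im1: "f ` hyp i = {v @\<^sub>v w | v w. v \<in> F1.hyp i \<and> w \<in> carrier_vec n2}" if i: "i \<in> S" for i
  proof (rule image)
    have iI: "i \<in> I" using i SI by auto
    fix v w :: "complex vec" assume vw: "v \<in> carrier_vec n1" "w \<in> carrier_vec n2"
    have "\<alpha> i \<bullet> g v w = \<alpha>1 i \<bullet> v"
      using \<alpha>g[OF iI vw] z2[OF i vw(2)] pullback_normal(2)[OF Q1(1) iI vw(1)] by (simp add: \<alpha>1_def)
    then show "g v w \<in> hyp i \<longleftrightarrow> v \<in> F1.hyp i \<and> w \<in> carrier_vec n2"
      using gc[OF vw] vw by (auto simp: hyp_def F1.hyp_def)
  qed (auto simp: F1.hyp_def)
  have im2: "f ` hyp i = {v @\<^sub>v w | v w. v \<in> carrier_vec n1 \<and> w \<in> F2.hyp i}" if i: "i \<in> T" for i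
  proof (rule image)
    have iI: "i \<in> I" using i TI by auto
    fix v w :: "complex vec" assume vw: "v \<in> carrier_vec n1" "w \<in> carrier_vec n2"
    have "\<alpha> i \<bullet> g v w = \<alpha>2 i \<bullet> w"
      using \<alpha>g[OF iI vw] z1[OF i vw(1)] pullback_normal(2)[OF Q2(1) iI vw(2)] by (simp add: \<alpha>2_def)
    then show "g v w \<in> hyp i \<longleftrightarrow> v \<in> carrier_vec n1 \<and> w \<in> F2.hyp i"
      using gc[OF vw] vw by (auto simp: hyp_def F2.hyp_def)
  qed (auto simp: F2.hyp_def)
  have "(\<lambda>H. f ` H) ` hyp ` I = (\<lambda>i. f ` hyp i) ` S \<union> (\<lambda>i. f ` hyp i) ` T"
    unfolding ST[symmetric] by (auto simp: image_iff)
  also have "(\<lambda>i. f ` hyp i) ` S = (\<lambda>i. {v @\<^sub>v w | v w. v \<in> F1.hyp i \<and> w \<in> carrier_vec n2}) ` S"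
    by (rule image_cong[OF refl im1])
  also have "(\<lambda>i. f ` hyp i) ` T = (\<lambda>i. {v @\<^sub>v w | v w. v \<in> carrier_vec n1 \<and> w \<in> F2.hyp i}) ` T"
    by (rule image_cong[OF refl im2])
  also have "(\<lambda>i. {v @\<^sub>v w | v w. v \<in> F1.hyp i \<and> w \<in> carrier_vec n2}) ` S \<union>
      (\<lambda>i. {v @\<^sub>v w | v w. v \<in> carrier_vec n1 \<and> w \<in> F2.hyp i}) ` T
      = product_arrangement n1 (F1.hyp ` S) n2 (F2.hyp ` T)"
    unfolding product_arrangement_def Setcompr_eq_image image_image ..
  finally have prod: "(\<lambda>H. f ` H) ` hyp ` I = product_arrangement n1 (F1.hyp ` S) n2 (F2.hyp ` T)" .
  have "affine_coordinate_change n f"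
    unfolding affine_coordinate_change_def
  proof (intro exI conjI)
    show "P \<in> carrier_mat n n" "invertible_mat P" by (rule P)+
    show "0\<^sub>v n \<in> carrier_vec n" by simp
    show "f = (\<lambda>x. P *\<^sub>v x + 0\<^sub>v n)" by (rule f_def)
  qed
  moreover have "0 < n1" "0 < n2" using pos by (simp_all add: n1_def n2_def)
  ultimately show ?thesis
    unfolding irreducible_arrangement_def not_not
    by (intro exI conjI) (rule n arr1 arr2 prod | assumption)+
qed

end

section \<open>Irreducible arrangements and connected matroids\<close>

context hyperplane_family
begin

lemma direction_dim_less:
  assumes "S \<subseteq> I" "i \<in> S" "\<alpha> i \<noteq> 0\<^sub>v n"
  shows "direction_dim S < n"
proof -
  have i: "i \<in> I" using assms by auto
  have "\<exists>d\<in>directions {}. \<alpha> i \<bullet> d \<noteq> 0"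
  proof (rule ccontr)
    assume neg: "\<not> ?thesis"
    have "\<alpha> i = 0\<^sub>v n" by (rule normal_zero[OF i]) (use neg in \<open>auto simp: directions_def\<close>)
    then show False using assms(3) by simp
  qed
  then have "direction_dim {} = Suc (direction_dim {i})" using i by (intro direction_dim_insert) auto
  moreover have "direction_dim S \<le> direction_dim {i}"
    using direction_dim_antimono[of "{i}" S] assms by auto
  ultimately show ?thesis using direction_dim_empty by simp
qed

end

locale essential_irreducible = hyperplane_family n I \<alpha> \<beta>
  for n and I :: "'i::linorder set" and \<alpha> \<beta> +
  assumes normal_nonzero: "i \<in> I \<Longrightarrow> \<alpha> i \<noteq> 0\<^sub>v n"
    and essential: "poset_rank (intersection_poset n (hyp ` I)) = n"
    and irreducible: "irreducible_arrangement n (hyp ` I)"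
begin

sublocale cone: rank_matroid "cone_ground I" cone_rank by (rule rank_matroid_cone_rank)

lemma direction_dim_all: "direction_dim I = 0"
proof -
  obtain S where "S \<subseteq> I" "direction_dim S = 0" using essential poset_rank_iff by blast
  then show ?thesis using direction_dim_antimono[of S I] by simp
qed

lemma no_split:
  assumes "S \<union> T = I" "direction_dim S + direction_dim T = n" "S \<noteq> {}" "T \<noteq> {}"
  shows False
proof -
  obtain B where B: "B \<subseteq> I" "meet B \<noteq> {}" "direction_dim B = 0" using essential poset_rank_iff by blast
  obtain i j where "i \<in> S" "j \<in> T" using assms(3,4) by blast
  then have "direction_dim S < n" "direction_dim T < n"
    using assms(1) normal_nonzero by (auto intro!: direction_dim_less)
  then have "0 < direction_dim S" "0 < direction_dim T" using assms(2) by auto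
  from reducible_if_directions_split[OF normal_nonzero assms(1,2) this B] irreducible
  show False by simp
qed

lemma cone_rank_None: "cone_rank {None} = 1"
  using cone_rank_simps(2)[of "{}"] direction_dim_empty by simp

text \<open>Let \<open>S\<close> be the hyperplanes on the side of \<open>None\<close> in a separation and \<open>T\<close> the others. The rank of
  \<open>S\<close> with \<open>None\<close> is the codimension of the directions of \<open>S\<close> plus one; comparing ranks, the
  hyperplanes of \<open>T\<close> meet and the two direction spaces have complementary dimension.\<close>

lemma connected_cone:
  assumes noncentral: "meet I = {}"
  shows "connected_matroid (cone_ground I) cone_rank"
proof -
  have rE: "cone_rank (cone_ground I) = Suc n"
    using cone_rank_simps(2)[of I] direction_dim_all by simp
  have main: "cone_rank (cone_ground I) < cone_rank U + cone_rank (cone_ground I - U)"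
    if U: "U \<subseteq> cone_ground I" "None \<in> U" "U \<noteq> cone_ground I" for U
  proof (rule ccontr)
    assume neg: "\<not> ?thesis"
    define S T where "S = Some -` U" and "T = I - S"
    have S: "S \<subseteq> I" "U = insert None (Some ` S)" using U by (auto simp: S_def)
    have T: "T \<subseteq> I" "cone_ground I - U = Some ` T" using S by (auto simp: T_def)
    have ST: "S \<union> T = I" using S by (auto simp: T_def)
    have "T \<noteq> {}" using U(3) S by (auto simp: T_def)
    have le: "direction_dim S \<le> n" "direction_dim T \<le> n" using S T direction_dim_le by auto
    have 1: "Suc n \<ge> n - direction_dim S + 1 + (n - direction_dim T + (if meet T = {} then 1 else 0))"
      using neg unfolding rE T(2) unfolding S(2) cone_rank_simps by simp
    \<comment> \<open>Submodularity bounds the sum of the dimensions from above, the failure of strictness bounds it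
      from below.\<close>
    have "cone_rank (U \<union> insert None (Some ` T)) + cone_rank (U \<inter> insert None (Some ` T))
        \<le> cone_rank U + cone_rank (insert None (Some ` T))"
      using U(1) T(1) by (intro cone.rank_submodular) auto
    moreover have "U \<union> insert None (Some ` T) = cone_ground I" using S ST by auto
    moreover have "U \<inter> insert None (Some ` T) = {None}" using S T(1) by (auto simp: T_def)
    ultimately have "Suc n + 1 \<le> cone_rank U + cone_rank (insert None (Some ` T))"
      by (simp only: rE cone_rank_None)
    then have "Suc n + 1 \<le> n - direction_dim S + 1 + (n - direction_dim T + 1)"
      unfolding S(2) cone_rank_simps .
    then have sum: "direction_dim S + direction_dim T = n" and ne: "meet T \<noteq> {}"
      using 1 le by (auto split: if_splits)
    have "S \<noteq> {}" using noncentral ne ST by auto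
    from no_split[OF ST sum this \<open>T \<noteq> {}\<close>] show False .
  qed
  show ?thesis
    unfolding connected_matroid_def
  proof (intro allI impI)
    fix U assume U: "U \<subseteq> cone_ground I" "U \<noteq> {}" "U \<noteq> cone_ground I"
    show "cone_rank (cone_ground I) < cone_rank U + cone_rank (cone_ground I - U)"
    proof (cases "None \<in> U")
      case True
      then show ?thesis using main U by blast
    next
      case False
      have "cone_ground I - (cone_ground I - U) = U" using U(1) by auto
      moreover have "cone_ground I - U \<noteq> cone_ground I" using U by auto
      ultimately show ?thesis using main[of "cone_ground I - U"] False by (simp add: add.commute)
    qed
  qed
qed

text \<open>All subfamilies of a central arrangement meet, so the rank is the codimension of the directions
  and a separation splits them at once.\<close>

lemma connected_dehomogenize:
  assumes central: "meet I \<noteq> {}" and z: "z \<in> I"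
  shows "connected_matroid (cone_ground (I - {z})) (dehomogenize z (\<lambda>S. cone_rank (Some ` S)))"
  unfolding connected_matroid_def
proof (intro allI impI, rule ccontr)
  let ?E = "cone_ground (I - {z})" and ?r = "\<lambda>S. cone_rank (Some ` S)" and ?\<phi> = "case_option z id"
  fix U assume U: "U \<subseteq> ?E" "U \<noteq> {}" "U \<noteq> ?E"
    and neg: "\<not> dehomogenize z ?r ?E < dehomogenize z ?r U + dehomogenize z ?r (?E - U)"
  interpret rank_matroid I ?r by (rule rank_matroid_Some[OF rank_matroid_cone_rank])
  have meet: "meet S \<noteq> {}" if "S \<subseteq> I" for S using central meet_antimono[OF that] by auto
  have r: "?r S = n - direction_dim S" if "S \<subseteq> I" for S using cone_rank_simps(1)[of S] meet[OF that] by simp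
  define S T where "S = ?\<phi> ` U" and "T = ?\<phi> ` (?E - U)"
  have E: "?\<phi> ` ?E = I" using z by (auto simp: image_iff split: option.splits)
  have "inj_on ?\<phi> ?E" using z by (auto simp: inj_on_def split: option.splits)
  then have dis: "S \<inter> T = {}" unfolding S_def T_def using U(1) by (auto simp: inj_on_def)
  have ST: "S \<union> T = I" 
  proof -
    have "U \<union> (?E - U) = ?E" using U(1) by blast
    then show ?thesis unfolding S_def T_def image_Un[symmetric] using E by simp
  qed
  have ne: "S \<noteq> {}" "T \<noteq> {}" using U by (auto simp: S_def T_def)
  have sub: "S \<subseteq> I" "T \<subseteq> I" using ST by auto
  have le: "direction_dim S \<le> n" "direction_dim T \<le> n" using sub direction_dim_le by auto
  have rI: "?r I = n" using r[of I] direction_dim_all by simp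
  have "?r S + ?r T \<le> ?r I" using neg unfolding dehomogenize_def E S_def[symmetric] T_def[symmetric] by simp
  moreover have "?r I \<le> ?r S + ?r T" using rank_submodular[OF sub] unfolding ST dis by simp
  ultimately have "direction_dim S + direction_dim T = n" using r sub le rI by auto
  from no_split[OF ST this ne] show False .
qed

end

section \<open>The singular variety\<close>

definition coefficient_sum :: "'i set \<Rightarrow> ('i set \<Rightarrow> 'k::field) \<Rightarrow> 'k" where
  "coefficient_sum I x = (\<Sum>i\<in>I. x {i})"

lemma subspace_ext_degree: "ext.subspace (ext_degree I d :: ('i::linorder set \<Rightarrow> 'k::field) set)"
  unfolding subspace_ext_iff
proof (intro conjI ballI allI)
  show "0 \<in> ext_degree I d" using ext.subspace_0[OF subspace_ext_space] by (simp add: ext_degree_def)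
  fix x :: "'i set \<Rightarrow> 'k" assume x: "x \<in> ext_degree I d"
  show "ext_scale c x \<in> ext_degree I d" for c
    using x ext.subspace_scale[OF subspace_ext_space, of x I c] by (simp add: ext_degree_def ext_scale_def)
  fix y :: "'i set \<Rightarrow> 'k" assume y: "y \<in> ext_degree I d"
  have "card S = d" if "(x + y) S \<noteq> 0" for S
  proof -
    have "x S \<noteq> 0 \<or> y S \<noteq> 0" using that by auto
    then show ?thesis using x y unfolding ext_degree_def by blast
  qed
  then show "x + y \<in> ext_degree I d"
    using x y ext.subspace_add[OF subspace_ext_space, of x I y] unfolding ext_degree_def by blast
qed

lemma ext_degree_one_expand:
  fixes x :: "'i::linorder set \<Rightarrow> 'k::field"
  assumes I: "finite I" and x: "x \<in> ext_degree I 1"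
  shows "x = (\<Sum>i\<in>I. ext_scale (x {i}) (ext_gen i))"
proof
  fix S
  have eq: "(\<Sum>i\<in>I. ext_scale (x {i}) (ext_gen i)) S = (\<Sum>i\<in>I. if S = {i} then x {i} else 0)"
    unfolding sum_fun_apply by (rule sum.cong) (auto simp: ext_scale_def ext_gen_def ext_mono_def)
  show "x S = (\<Sum>i\<in>I. ext_scale (x {i}) (ext_gen i)) S"
  proof (cases "\<exists>i\<in>I. S = {i}")
    case True
    then obtain i where i: "i \<in> I" "S = {i}" by blast
    have "(\<Sum>j\<in>I. if S = {j} then x {j} else 0) = (\<Sum>j\<in>I. if j = i then x {i} else 0)"
      unfolding i(2) by (rule sum.cong) auto
    then show ?thesis using eq I i by simp
  next
    case False
    have "x S = 0"
    proof (rule ccontr)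
      assume "x S \<noteq> 0"
      then have "S \<subseteq> I" "card S = 1" using x unfolding ext_degree_def ext_space_iff by blast+
      moreover from this(2) obtain i where "S = {i}" by (rule card_1_singletonE)
      ultimately show False using False by auto
    qed
    moreover have "(\<Sum>i\<in>I. if S = {i} then x {i} else 0) = 0" using False by (intro sum.neutral) auto
    ultimately show ?thesis using eq by simp
  qed
qed

text \<open>If the coefficients \<open>x\<^sub>i\<close> sum up to zero, then \<open>\<Sum>i. x\<^sub>i e\<^sub>i = \<Sum>i. x\<^sub>i (e\<^sub>i - e\<^sub>z)\<close> for any
  \<open>z\<close>.\<close>

lemma span_differences:
  fixes I :: "'i::linorder set"
  assumes I: "finite I"
  shows "ext.span {ext_gen i - ext_gen j | i j. i \<in> I \<and> j \<in> I} =
    {x \<in> ext_degree I 1. coefficient_sum I x = (0::'k::field)}" (is "ext.span ?D = ?W")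
proof
  show "ext.span ?D \<subseteq> ?W"
  proof (rule ext.span_minimal)
    show "?D \<subseteq> ?W"
    proof
      fix x assume "x \<in> ?D"
      then obtain i j where ij: "i \<in> I" "j \<in> I" and x: "x = ext_gen i - ext_gen j" by blast
      have "x \<in> ext_degree I 1"
        unfolding x by (intro ext.subspace_diff[OF subspace_ext_degree] ext_gen_degree ij)
      moreover have "coefficient_sum I (ext_gen i) = (1::'k)" if "i \<in> I" for i
        using that I by (simp add: coefficient_sum_def ext_gen_def ext_mono_def)
      ultimately show "x \<in> ?W" using ij by (simp add: x coefficient_sum_def sum_subtractf)
    qed
    show "ext.subspace ?W"
      unfolding subspace_ext_iff
    proof (intro conjI ballI allI)
      show "0 \<in> ?W" using ext.subspace_0[OF subspace_ext_degree] by (simp add: coefficient_sum_def)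
      fix x assume x: "x \<in> ?W"
      show "x + y \<in> ?W" if "y \<in> ?W" for y
        using x that ext.subspace_add[OF subspace_ext_degree, of x I 1 y]
        by (simp add: coefficient_sum_def sum.distrib)
      show "ext_scale c x \<in> ?W" for c
        using x ext.subspace_scale[OF subspace_ext_degree, of x I 1 c]
        by (simp add: coefficient_sum_def ext_scale_def flip: sum_distrib_left)
    qed
  qed
  show "?W \<subseteq> ext.span ?D"
  proof
    fix x assume "x \<in> ?W"
    then have x: "x \<in> ext_degree I 1" and sum: "coefficient_sum I x = 0" by auto
    show "x \<in> ext.span ?D"
    proof (cases "I = {}")
      case True
      then have "x = 0" using ext_degree_one_expand[OF I x] by simp
      then show ?thesis by (simp add: ext.span_zero)
    next
      case False
      then obtain z where z: "z \<in> I" by blast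
      have "(\<Sum>i\<in>I. ext_scale (x {i}) (ext_gen z)) = ext_scale (coefficient_sum I x) (ext_gen z)"
        unfolding coefficient_sum_def ext.scale_sum_left ..
      also have "\<dots> = 0" unfolding sum by (rule ext.scale_zero_left)
      finally have zero: "(\<Sum>i\<in>I. ext_scale (x {i}) (ext_gen z)) = 0" .
      have "x = (\<Sum>i\<in>I. ext_scale (x {i}) (ext_gen i)) - (\<Sum>i\<in>I. ext_scale (x {i}) (ext_gen z))"
        unfolding zero using ext_degree_one_expand[OF I x] by simp
      also have "\<dots> = (\<Sum>i\<in>I. ext_scale (x {i}) (ext_gen i - ext_gen z))"
        by (simp only: ext.scale_right_diff_distrib sum_subtractf)
      finally have x_eq: "x = (\<Sum>i\<in>I. ext_scale (x {i}) (ext_gen i - ext_gen z))" .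
      show ?thesis
        by (subst x_eq, intro ext.span_sum ext.span_scale ext.span_base) (use z in blast)
    qed
  qed
qed

lemma linear_hyperplane_coefficient_sum:
  fixes I :: "'i::linorder set"
  assumes I: "finite I" and ne: "I \<noteq> {}"
  shows "linear_hyperplane (ext_degree I 1) {x \<in> ext_degree I 1. coefficient_sum I x = (0::'k::field)}"
proof -
  let ?V = "ext_degree I 1 :: ('i set \<Rightarrow> 'k) set"
  \<comment> \<open>The coefficient sum with its value placed on \<open>e\<^bsub>{}\<^esub>\<close>, as an endomorphism to which
    rank--nullity applies.\<close>
  define f :: "('i set \<Rightarrow> 'k) \<Rightarrow> 'i set \<Rightarrow> 'k"
    where "f x = (\<lambda>S. if S = {} then coefficient_sum I x else 0)" for x
  have lin: "Vector_Spaces.linear ext_scale ext_scale f"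
    by (auto simp: Vector_Spaces.linear_iff vector_space_ext_scale f_def coefficient_sum_def ext_scale_def
        sum.distrib sum_distrib_left fun_eq_iff)
  obtain z where z: "z \<in> I" using ne by blast
  have gen: "f (ext_gen z) = ext_mono {}"
    using z I by (auto simp: f_def coefficient_sum_def ext_gen_def ext_mono_def fun_eq_iff)
  have "ext.dim (f ` ?V) = 1"
  proof (rule ext.dim_unique[of "{ext_mono {}}"])
    show "{ext_mono {}} \<subseteq> f ` ?V"
      using gen ext_gen_degree[OF z] by (metis empty_subsetI image_eqI insert_subset)
    show "f ` ?V \<subseteq> ext.span {ext_mono {}}"
    proof
      fix u assume "u \<in> f ` ?V"
      then obtain x where "u = f x" by blast
      then have u: "u = ext_scale (coefficient_sum I x) (ext_mono {})"
        by (auto simp: f_def ext_scale_def ext_mono_def fun_eq_iff)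
      show "u \<in> ext.span {ext_mono {}}" unfolding u by (intro ext.span_scale ext.span_base) simp
    qed
    have "ext_mono {} \<noteq> (0 :: 'i set \<Rightarrow> 'k)" by (auto simp: ext_mono_def fun_eq_iff)
    then show "ext.independent {ext_mono {} :: 'i set \<Rightarrow> 'k}"
      using ext.independent_insertI[of "ext_mono {}" "{}"] ext.independent_empty by auto
  qed simp
  moreover have "?V \<subseteq> ext.span (ext_mono ` Pow I)"
    using ext_space_span[OF I, where 'k = 'k] by (auto simp: ext_degree_def)
  moreover have "{x \<in> ?V. f x = 0} = {x \<in> ?V. coefficient_sum I x = 0}"
    by (auto simp: f_def fun_eq_iff)
  ultimately have "ext.dim {x \<in> ?V. coefficient_sum I x = 0} + 1 = ext.dim ?V"
    using ext.dim_kernel_image[OF lin subspace_ext_degree, of I 1 "ext_mono ` Pow I"] I by simp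
  moreover have "ext.subspace {x \<in> ?V. coefficient_sum I x = 0}"
    unfolding span_differences[OF I, symmetric] by (rule ext.subspace_span)
  ultimately show ?thesis unfolding linear_hyperplane_def by blast
qed

context arrangement_rank
begin

lemma exact_on_dual_if_not_singular:
  fixes x :: "'i set \<Rightarrow> 'k::field"
  assumes x: "x \<in> ext_degree I 1" and "\<not> singular_on (os_module n I H) x"
  shows "exact_on I (\<lambda>i. x {i}) dual"
proof (rule exact_on_dual[OF finite_index subspace_affine_dual])
  show "dual \<subseteq> ext_space I" by (auto simp: affine_dual_def)
  show "\<exists>y\<in>ext_space I. m - wedge I (\<lambda>i. x {i}) y \<in> annihilator I dual"
    if "m \<in> ext_space I" "wedge I (\<lambda>i. x {i}) m \<in> annihilator I dual" for m
    using assms(2) that unfolding singular_on_iff[OF x] os_ideal_eq_annihilator by blast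
qed

text \<open>Nonsingularity would force the Euler characteristic to vanish, which connectedness excludes.\<close>

lemma singular_if_cone_connected:
  fixes x :: "'i set \<Rightarrow> 'k::field"
  assumes conn: "connected_matroid (cone_ground I) r" and "r {None} = 1" and x: "x \<in> ext_degree I 1"
  shows "singular_on (os_module n I H) x"
proof (rule ccontr)
  assume "\<not> ?thesis"
  then have "exact_on I (\<lambda>i. x {i}) (dual :: ('i set \<Rightarrow> 'k) set)" by (rule exact_on_dual_if_not_singular[OF x])
  then have "euler_char (dual :: ('i set \<Rightarrow> 'k) set) = 0"
  proof (rule euler_char_exact[OF finite_index subspace_affine_dual, rotated 3])
    show "dual \<subseteq> ext_space I" by (auto simp: affine_dual_def)
    show "contract I (\<lambda>i. x {i}) f \<in> dual" if "f \<in> dual" for f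
      by (rule contract_affine_dual[OF matroid that])
    show "(\<lambda>S. if even (card S) = q then f S else 0) \<in> dual" if "f \<in> dual" for f :: "'i set \<Rightarrow> 'k" and q
      by (rule affine_dual_project[OF finite_index that, of "\<lambda>c. even c = q"])
  qed
  then show False using euler_char_affine_dual(2)[OF matroid assms(1,2)] by blast
qed

end

locale central_arrangement_rank = arrangement_rank +
  assumes central: "flat n (H ` I) \<noteq> {}"
begin

abbreviation r0 :: "'a set \<Rightarrow> nat" where "r0 S \<equiv> r (Some ` S)"

lemma r1: "S \<subseteq> I \<Longrightarrow> r (insert None (Some ` S)) = Suc (r0 S)"
proof -
  assume S: "S \<subseteq> I"
  have "flat n (H ` I) \<subseteq> flat n (H ` S)" using S by (auto simp: flat_def)
  then have "flat n (H ` S) \<noteq> {}" using central by auto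
  then show ?thesis using flat_empty_iff[OF S] cone_rank_cases(1)[OF matroid S] by simp
qed

text \<open>In a central arrangement \<open>None\<close> is in the closure of no set of hyperplanes, so dependence of a
  set together with \<open>None\<close> is dependence of the set.\<close>

lemma dual_eq_os_dual: "dual = (os_dual I r0 :: ('a set \<Rightarrow> 'k::field) set)"
proof (intro equalityI subsetI)
  fix f :: "'a set \<Rightarrow> 'k"
  show "f \<in> os_dual I r0" if "f \<in> dual" by (rule affine_dual_subset_os_dual[OF matroid that])
  assume f: "f \<in> os_dual I r0"
  show "f \<in> dual"
  proof (rule affine_dualI)
    show "f S = 0" if "\<not> S \<subseteq> I" for S using os_dualD(2)[OF f] that by blast
    show "f S = 0" if "S \<subseteq> I" "r (insert None (Some ` S)) \<le> card S" for S
      using os_dualD(3)[OF f that(1)] that(2) r1[OF that(1)] by simp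
    show "coboundary I f S = 0" if "S \<subseteq> I" "r0 S < card S" for S
      by (rule os_dualD(4)[OF f that])
  qed
qed

lemma coboundary_dual:
  fixes f :: "'a set \<Rightarrow> 'k::field"
  shows "f \<in> dual \<Longrightarrow> coboundary I f \<in> dual"
  unfolding dual_eq_os_dual by (rule coboundary_os_dual[OF finite_index])

text \<open>For a central arrangement \<open>\<partial>\<close> maps the ideal into itself, because its transpose, the coboundary,
  maps the dual into itself. With \<open>\<partial>e\<^sub>i = 1\<close> and \<open>c\<close> the sum of the coefficients, \<open>\<partial>(x m) = c m - x \<partial>m\<close>; if \<open>x m\<close>
  is in the ideal, this writes \<open>m\<close> as \<open>x y\<close> modulo the ideal, with \<open>y = c\<^sup>-\<^sup>1 \<partial>m\<close>.\<close>

lemma not_singular_if_sum_nonzero: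
  fixes x :: "'a set \<Rightarrow> 'k::field"
  assumes x: "x \<in> ext_degree I 1" and nz: "coefficient_sum I x \<noteq> 0"
  shows "\<not> singular_on (os_module n I H) x"
  unfolding singular_on_iff[OF x] not_not os_ideal_eq_annihilator
proof (intro ballI impI)
  let ?w = "wedge I (\<lambda>i. x {i})" and ?d = "contract I (\<lambda>_. 1 :: 'k)" and ?c = "coefficient_sum I x"
  fix m :: "'a set \<Rightarrow> 'k" assume m: "m \<in> ext_space I" "?w m \<in> annihilator I dual"
  have d: "?d j \<in> annihilator I dual" if "j \<in> annihilator I dual" for j
  proof -
    have "pairing I f (?d j) = 0" if "f \<in> dual" for f
    proof -
      have "pairing I f (?d j) = pairing I (?d j) f" by (rule pairing_commute)
      also have "\<dots> = pairing I j (coboundary I f)" by (rule pairing_contract[OF finite_index])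
      also have "\<dots> = pairing I (coboundary I f) j" by (rule pairing_commute)
      also have "\<dots> = 0"
        using \<open>j \<in> annihilator I dual\<close> coboundary_dual[OF that] unfolding annihilator_def by blast
      finally show ?thesis .
    qed
    then show ?thesis by (simp add: annihilator_def)
  qed
  define y where "y = ext_scale (1 / ?c) (?d m)"
  have "?d (?w m) = ext_scale ?c m - ?w (?d m)"
    using contract_wedge[OF finite_index m(1), of "\<lambda>_. 1" "\<lambda>i. x {i}"]
    by (simp add: coefficient_sum_def)
  then have "ext_scale (1 / ?c) (?d (?w m)) = ext_scale (1 / ?c) (ext_scale ?c m) - ?w y"
    by (simp only: y_def ext.scale_right_diff_distrib wedge_scale)
  also have "ext_scale (1 / ?c) (ext_scale ?c m) = m" using nz by (simp add: ext_scale_def)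
  finally have "m - ?w y = ext_scale (1 / ?c) (?d (?w m))" ..
  moreover have "\<dots> \<in> annihilator I dual"
    by (rule ext.subspace_scale[OF subspace_annihilator d[OF m(2)]])
  moreover have "y \<in> ext_space I"
    unfolding y_def by (rule ext.subspace_scale[OF subspace_ext_space]) simp
  ultimately show "\<exists>y\<in>ext_space I. m - ?w y \<in> annihilator I dual" by (metis (no_types))
qed

text \<open>The Euler characteristic of \<open>dual\<close> is zero if there are hyperplanes, as all of them meet, and
  gives no contradiction. The kernel of the contraction at a hyperplane \<open>z\<close> inherits exactness, and
  it is the dual for the affine arrangement with \<open>z\<close> at infinity, whose Euler characteristic is
  nonzero.\<close>

lemma singular_if_sum_zero:
  fixes x :: "'a set \<Rightarrow> 'k::field"
  assumes x: "x \<in> ext_degree I 1" and sum: "coefficient_sum I x = 0"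
    and conn: "\<And>z. z \<in> I \<Longrightarrow> connected_matroid (cone_ground (I - {z})) (dehomogenize z r0)"
    and nonloop: "\<And>z. z \<in> I \<Longrightarrow> r0 {z} = 1"
  shows "singular_on (os_module n I H) x"
proof (rule ccontr)
  let ?a = "\<lambda>i. x {i}"
  assume "\<not> ?thesis"
  then have exact: "exact_on I ?a (dual :: ('a set \<Rightarrow> 'k) set)" by (rule exact_on_dual_if_not_singular[OF x])
  show False
  proof (cases "I = {}")
    case True
    \<comment> \<open>Without hyperplanes the algebra is the field, on which multiplication by 0 is not exact.\<close>
    have "ext_mono {} \<in> (dual :: ('a set \<Rightarrow> 'k) set)"
      unfolding dual_eq_os_dual by (rule os_dualI) (auto simp: True ext_mono_def)
    moreover have "contract I ?a f = 0" for f by (simp add: contract_def True fun_eq_iff)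
    ultimately have "ext_mono {} = (0 :: 'a set \<Rightarrow> 'k)" using exact unfolding exact_on_def by metis
    from fun_cong[OF this, of "{}"] show False by (simp add: ext_mono_def)
  next
    case False
    then obtain z where z: "z \<in> I" by blast
    have M0: "rank_matroid I r0" by (rule rank_matroid_Some[OF matroid])
    let ?K = "{f \<in> dual. contract I (unit_form z) f = 0} :: ('a set \<Rightarrow> 'k) set"
    have K: "?K = affine_dual (I - {z}) (dehomogenize z r0)"
      unfolding dual_eq_os_dual by (rule os_dual_kernel_eq_affine_dual[OF M0 z])
    have dsub: "(dual :: ('a set \<Rightarrow> 'k) set) \<subseteq> ext_space I" by (auto simp: affine_dual_def)
    have contr: "contract I b f \<in> dual" if "f \<in> dual" for b and f :: "'a set \<Rightarrow> 'k"
      by (rule contract_affine_dual[OF matroid that])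
    have exK: "exact_on I ?a ?K"
      by (rule exact_on_kernel[OF finite_index z _ subspace_affine_dual dsub contr coboundary_dual exact])
        (use sum in \<open>simp add: coefficient_sum_def\<close>)
    have "euler_char ?K = 0"
    proof (rule euler_char_exact[OF finite_index _ _ _ _ exK])
      show "ext.subspace ?K" unfolding K by (rule subspace_affine_dual)
      show "?K \<subseteq> ext_space I" using dsub by auto
      show "contract I ?a f \<in> ?K" if "f \<in> ?K" for f
        using that contr contract_anticommute[OF finite_index, of "unit_form z" ?a f] by simp
      show "(\<lambda>S. if even (card S) = q then f S else 0) \<in> ?K" if "f \<in> ?K" for f q
        using that finite_index unfolding K by (intro affine_dual_project[of _ _ _ "\<lambda>c. even c = q"]) auto
    qed
    moreover have "dehomogenize z r0 {None} = 1"
      using dehomogenize_simps(2)[of z r0 "{}"] nonloop[OF z] by simp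
    ultimately show False
      using euler_char_affine_dual(2)[OF rank_matroid_dehomogenize[OF M0 z] conn[OF z], where 'k = 'k]
      unfolding K by blast
  qed
qed

end

theorem theorem2p2:
  fixes n :: nat
    and A :: "complex vec set set"
    and I :: "'i::linorder set"
    and H :: "'i \<Rightarrow> complex vec set"
    and M :: "('i set \<Rightarrow> 'k::field, ('i set \<Rightarrow> 'k) set) module"
    and V :: "('i set \<Rightarrow> 'k) set"
  assumes "arrangement n A"
    and "irreducible_arrangement n A"
    and "bij_betw H I A"
    and "M = os_module n I H"
    and "V = ext_degree I 1"
  shows "(\<not> central n A \<longrightarrow> singular_variety I M = V) \<and>
    (central n A \<longrightarrow>
      singular_variety I M =
        Modules.module.span ext_scale {ext_gen i - ext_gen j | i j. i \<in> I \<and> j \<in> I} \<and>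
      (0 < n \<longrightarrow> linear_hyperplane V (singular_variety I M)))"
proof -
  have A: "A = H ` I" using assms(3) by (simp add: bij_betw_def)
  have finI: "finite I" using assms(1,3) by (auto simp: arrangement_def bij_betw_finite)
  have "\<forall>i\<in>I. \<exists>a c. a \<in> carrier_vec n \<and> a \<noteq> 0\<^sub>v n \<and> H i = {x \<in> carrier_vec n. a \<bullet> x = c}"
    using assms(1) unfolding A arrangement_def affine_hyperplane_def by blast
  from bchoice[OF this] obtain \<alpha> where
    "\<forall>i\<in>I. \<exists>c. \<alpha> i \<in> carrier_vec n \<and> \<alpha> i \<noteq> 0\<^sub>v n \<and> H i = {x \<in> carrier_vec n. \<alpha> i \<bullet> x = c}" ..
  from bchoice[OF this] obtain \<beta> where
    "\<forall>i\<in>I. \<alpha> i \<in> carrier_vec n \<and> \<alpha> i \<noteq> 0\<^sub>v n \<and> H i = {x \<in> carrier_vec n. \<alpha> i \<bullet> x = \<beta> i}" ..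
  then have \<alpha>: "\<And>i. i \<in> I \<Longrightarrow> \<alpha> i \<in> carrier_vec n" "\<And>i. i \<in> I \<Longrightarrow> \<alpha> i \<noteq> 0\<^sub>v n"
      "\<And>i. i \<in> I \<Longrightarrow> H i = {x \<in> carrier_vec n. \<alpha> i \<bullet> x = \<beta> i}"
    by blast+
  interpret hyperplane_family n I \<alpha> \<beta> by unfold_locales (use finI \<alpha>(1) in auto)
  have H: "H i = hyp i" if "i \<in> I" for i using \<alpha>(3)[OF that] by (simp add: hyp_def)
  have HS: "H ` S = hyp ` S" if "S \<subseteq> I" for S using that H by (intro image_cong) auto
  have flatS: "flat n (H ` S) = meet S" if "S \<subseteq> I" for S unfolding HS[OF that] meet_def ..
  interpret essential_irreducible n I \<alpha> \<beta>
    by unfold_locales (use \<alpha>(2) assms(1,2) in \<open>auto simp: arrangement_def A HS\<close>)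
  interpret R: arrangement_rank n I H cone_rank
  proof
    show "(flat n (H ` S) = {}) = (cone_rank (insert None (Some ` S)) = cone_rank (Some ` S))"
      if "S \<subseteq> I" for S unfolding flatS[OF that] cone_rank_simps by simp
    show "codim n (flat n (H ` S)) = cone_rank (Some ` S)" if "S \<subseteq> I" "flat n (H ` S) \<noteq> {}" for S
      using codim_meet that unfolding cone_rank_simps flatS[OF that(1)] by simp
  qed
  have central: "central n A \<longleftrightarrow> meet I \<noteq> {}" unfolding central_def A using flatS[of I] by simp
  show ?thesis
  proof (intro conjI impI)
    assume "\<not> central n A"
    then have "connected_matroid (cone_ground I) cone_rank" using central by (intro connected_cone) simp
    then show "singular_variety I M = V"
      using R.singular_if_cone_connected[OF _ cone_rank_None] assms(4,5) unfolding singular_variety_def by auto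
  next
    assume c: "central n A"
    interpret C: central_arrangement_rank n I H cone_rank
      by unfold_locales (use c in \<open>simp add: central_def A\<close>)
    have mI: "meet I \<noteq> {}" using c central by simp
    have nonloop: "cone_rank (Some ` {z}) = 1" if z: "z \<in> I" for z
    proof -
      have "direction_dim {z} < n" using z normal_nonzero by (intro direction_dim_less[of "{z}" z]) auto
      moreover have "meet {z} \<noteq> {}" using mI meet_antimono[of "{z}" I] z by auto
      ultimately have "cone_rank (Some ` {z}) > 0" unfolding cone_rank_simps by simp
      moreover have "cone_rank (Some ` {z}) \<le> 1" using cone.rank_le_card[of "Some ` {z}"] z by simp
      ultimately show ?thesis by simp
    qed
    have "singular_on M x \<longleftrightarrow> coefficient_sum I x = 0" if x: "x \<in> V" for x
      using C.not_singular_if_sum_nonzero[of x] C.singular_if_sum_zero[of x] connected_dehomogenize[OF mI]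
        nonloop x unfolding assms(4,5) by blast
    then have W: "singular_variety I M = {x \<in> ext_degree I 1. coefficient_sum I x = 0}"
      unfolding singular_variety_def assms(5) by blast
    then show "singular_variety I M =
        Modules.module.span ext_scale {ext_gen i - ext_gen j | i j. i \<in> I \<and> j \<in> I}"
      unfolding span_differences[OF finI] .
    assume "0 < n"
    then have "I \<noteq> {}" using direction_dim_all direction_dim_empty by auto
    then show "linear_hyperplane V (singular_variety I M)"
      unfolding W assms(5) by (rule linear_hyperplane_coefficient_sum[OF finI])
  qed
qed

end
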